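(* A tight decomposition space is split.
   Context: $\mathbf{Grpd}$ is the $\infty$-category of $\infty$-groupoids; pullbacks and fibres are homotopy pullbacks and fibres; a monomorphism of $\infty$-groupoids is a map whose fibres are empty or contractible. $\Delta$ is the category of nonempty finite ordinals. A map in $\Delta$ is generic if it preserves both end-points, and free if $f(i+1)=f(i)+1$ for all $i$; generic and free maps admit pushouts along each other. A decomposition space is a functor $X:\Delta^{\mathrm{op}}\to\mathbf{Grpd}$ sending every pushout square in $\Delta$ of a generic map along a free map to a pullback. It is complete if $s_0:X_0\to X_1$ is a monomorphism (equivalently, for decomposition spaces, all degeneracy maps are monomorphisms). For a complete decomposition space $X$, an edge in $X_1$ is nondegenerate if it lies in the complement of $s_0(X_0)\subset X_1$, and $\vec X_r\subset X_r$ denotes the full subgroupoid of $r$-simplices all of whose principal edges are nondegenerate (with $\vec X_0=X_0$). A decomposition space is called tight (or of locally finite length) if it is complete and for each $a\in X_1$ the fibre over $a$ of $\vec X_r\to X_1$ (restriction of the map induced by the unique generic map $[1]\to[r]$) is empty for $r$ sufficiently large. In a complete simplicial space (all degeneracy maps are monomorphisms), an $n$-simplex is nondegenerate if it lies in the complement of the images of the degeneracy maps $s_i:X_{n-1}\to X_n$. A complete simplicial space is split if all face maps preserve nondegenerate simplices. *)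

theory Defs
  imports Main "HOL-Library.FuncSet"
begin

section \<open>The category of nonempty finite ordinals\<close>

text \<open>A morphism \<open>[src] \<rightarrow> [tgt]\<close>, where \<open>[n] = {0, \<dots>, n}\<close>.  The underlying function is kept
  extensional, so that equality of records is equality of morphisms.\<close>

record dmap =
  src :: nat
  tgt :: nat
  ap :: "nat \<Rightarrow> nat"

definition is_dmap :: "dmap \<Rightarrow> bool" where
  "is_dmap f \<longleftrightarrow> ap f \<in> {..src f} \<rightarrow>\<^sub>E {..tgt f} \<and> mono_on {..src f} (ap f)"

definition mk_dmap :: "nat \<Rightarrow> nat \<Rightarrow> (nat \<Rightarrow> nat) \<Rightarrow> dmap" where
  "mk_dmap m n f = \<lparr>src = m, tgt = n, ap = restrict f {..m}\<rparr>"

definition did :: "nat \<Rightarrow> dmap" where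
  "did n = mk_dmap n n (\<lambda>i. i)"

definition dcomp :: "dmap \<Rightarrow> dmap \<Rightarrow> dmap" where
  "dcomp g f = mk_dmap (src f) (tgt g) (\<lambda>i. ap g (ap f i))"

definition dconst :: "nat \<Rightarrow> nat \<Rightarrow> nat \<Rightarrow> dmap" where
  "dconst m n j = mk_dmap m n (\<lambda>_. j)"

definition coface :: "nat \<Rightarrow> nat \<Rightarrow> dmap" where
  "coface n i = mk_dmap n (Suc n) (\<lambda>j. if j < i then j else Suc j)"

definition codegeneracy :: "nat \<Rightarrow> nat \<Rightarrow> dmap" where
  "codegeneracy n i = mk_dmap (Suc n) n (\<lambda>j. if j \<le> i then j else j - 1)"

definition is_generic :: "dmap \<Rightarrow> bool" where
  "is_generic f \<longleftrightarrow> is_dmap f \<and> ap f 0 = 0 \<and> ap f (src f) = tgt f"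

definition is_free :: "dmap \<Rightarrow> bool" where
  "is_free f \<longleftrightarrow> is_dmap f \<and> (\<forall>i<src f. ap f (Suc i) = Suc (ap f i))"

text \<open>The square with sides \<open>f : A \<rightarrow> B\<close>, \<open>g : A \<rightarrow> C\<close>, \<open>f' : B \<rightarrow> P\<close>, \<open>g' : C \<rightarrow> P\<close>.\<close>

definition commuting_square :: "dmap \<Rightarrow> dmap \<Rightarrow> dmap \<Rightarrow> dmap \<Rightarrow> bool" where
  "commuting_square f g f' g' \<longleftrightarrow>
     is_dmap f \<and> is_dmap g \<and> is_dmap f' \<and> is_dmap g' \<and>
     src f = src g \<and> src f' = tgt f \<and> src g' = tgt g \<and> tgt f' = tgt g' \<and>
     dcomp f' f = dcomp g' g"

definition pushout_square :: "dmap \<Rightarrow> dmap \<Rightarrow> dmap \<Rightarrow> dmap \<Rightarrow> bool" where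
  "pushout_square f g f' g' \<longleftrightarrow>
     commuting_square f g f' g' \<and>
     (\<forall>h k. commuting_square f g h k \<longrightarrow>
        (\<exists>!l. is_dmap l \<and> src l = tgt f' \<and> tgt l = tgt h \<and>
              dcomp l f' = h \<and> dcomp l g' = k))"

section \<open>Simplicial sets and Kan complexes\<close>

record 'a sset =
  splx :: "nat \<Rightarrow> 'a set"
  act :: "dmap \<Rightarrow> 'a \<Rightarrow> 'a"

definition is_sset :: "'a sset \<Rightarrow> bool" where
  "is_sset K \<longleftrightarrow>
     (\<forall>f x. is_dmap f \<and> x \<in> splx K (tgt f) \<longrightarrow> act K f x \<in> splx K (src f)) \<and>
     (\<forall>n. \<forall>x\<in>splx K n. act K (did n) x = x) \<and>
     (\<forall>f g x. is_dmap f \<and> is_dmap g \<and> src g = tgt f \<and> x \<in> splx K (tgt g) \<longrightarrow>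
        act K (dcomp g f) x = act K f (act K g x))"

text \<open>A horn in \<open>K\<close> of dimension \<open>n + 1\<close> is the family of its faces \<open>x i\<close>, \<open>i \<noteq> k\<close>; for \<open>n = 0\<close>
  the compatibility condition is vacuous.\<close>

definition kan :: "'a sset \<Rightarrow> bool" where
  "kan K \<longleftrightarrow> is_sset K \<and>
     (\<forall>n k x. k \<le> Suc n \<and>
        (\<forall>i\<le>Suc n. i \<noteq> k \<longrightarrow> x i \<in> splx K n) \<and>
        (\<forall>i j. i < j \<and> j \<le> Suc n \<and> i \<noteq> k \<and> j \<noteq> k \<longrightarrow>
           act K (coface (n - 1) i) (x j) = act K (coface (n - 1) (j - 1)) (x i)) \<longrightarrow>
        (\<exists>y\<in>splx K (Suc n). \<forall>i\<le>Suc n. i \<noteq> k \<longrightarrow> act K (coface n i) y = x i))"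

definition smap :: "'a sset \<Rightarrow> 'b sset \<Rightarrow> (nat \<Rightarrow> 'a \<Rightarrow> 'b) \<Rightarrow> bool" where
  "smap K L f \<longleftrightarrow>
     (\<forall>n. \<forall>x\<in>splx K n. f n x \<in> splx L n) \<and>
     (\<forall>\<phi> x. is_dmap \<phi> \<and> x \<in> splx K (tgt \<phi>) \<longrightarrow>
        f (src \<phi>) (act K \<phi> x) = act L \<phi> (f (tgt \<phi>) x))"

definition std :: "nat \<Rightarrow> dmap sset" where
  "std p = \<lparr>splx = (\<lambda>n. {\<sigma>. is_dmap \<sigma> \<and> src \<sigma> = n \<and> tgt \<sigma> = p}),
            act = (\<lambda>\<phi> \<sigma>. dcomp \<sigma> \<phi>)\<rparr>"

definition sprod :: "'a sset \<Rightarrow> 'b sset \<Rightarrow> ('a \<times> 'b) sset" where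
  "sprod K L = \<lparr>splx = (\<lambda>n. splx K n \<times> splx L n),
                act = (\<lambda>\<phi> (x, y). (act K \<phi> x, act L \<phi> y))\<rparr>"

text \<open>The cube \<open>(\<Delta>\<^sup>1)\<^sup>n\<close>.\<close>

definition cube :: "nat \<Rightarrow> dmap list sset" where
  "cube n = \<lparr>splx = (\<lambda>m. {ts. length ts = n \<and> set ts \<subseteq> splx (std 1) m}),
             act = (\<lambda>\<phi>. map (\<lambda>t. dcomp t \<phi>))\<rparr>"

section \<open>Homotopy theory of Kan complexes\<close>

definition homotopy ::
  "'a sset \<Rightarrow> 'b sset \<Rightarrow> (nat \<Rightarrow> 'a \<Rightarrow> 'b) \<Rightarrow> (nat \<Rightarrow> 'a \<Rightarrow> 'b) \<Rightarrow> (nat \<Rightarrow> 'a \<times> dmap \<Rightarrow> 'b) \<Rightarrow> bool"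
where
  "homotopy K L f g H \<longleftrightarrow>
     smap (sprod K (std 1)) L H \<and>
     (\<forall>n. \<forall>x\<in>splx K n. H n (x, dconst n 1 0) = f n x \<and> H n (x, dconst n 1 1) = g n x)"

definition hequiv :: "'a sset \<Rightarrow> 'b sset \<Rightarrow> (nat \<Rightarrow> 'a \<Rightarrow> 'b) \<Rightarrow> bool" where
  "hequiv K L f \<longleftrightarrow> smap K L f \<and>
     (\<exists>g H H'. smap L K g \<and>
        homotopy K K (\<lambda>n x. g n (f n x)) (\<lambda>n x. x) H \<and>
        homotopy L L (\<lambda>n y. f n (g n y)) (\<lambda>n y. y) H')"

definition contractible :: "'a sset \<Rightarrow> bool" where
  "contractible K \<longleftrightarrow> hequiv K (std 0) (\<lambda>n _. dconst n 0 0)"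

text \<open>The path object \<open>L\<close> to the power \<open>\<Delta>\<^sup>1\<close>: an \<open>n\<close>-simplex is a simplicial map
  \<open>\<Delta>\<^sup>n \<times> \<Delta>\<^sup>1 \<rightarrow> L\<close>, made extensional.\<close>

type_synonym 'a path = "nat \<Rightarrow> dmap \<times> dmap \<Rightarrow> 'a"

definition path_restrict :: "nat \<Rightarrow> 'a path \<Rightarrow> 'a path" where
  "path_restrict n h = (\<lambda>k. restrict (h k) (splx (sprod (std n) (std 1)) k))"

definition path_obj :: "'a sset \<Rightarrow> 'a path sset" where
  "path_obj L =
     \<lparr>splx = (\<lambda>n. {h. smap (sprod (std n) (std 1)) L h \<and> path_restrict n h = h}),
      act = (\<lambda>\<phi> h. path_restrict (src \<phi>) (\<lambda>k (\<sigma>, t). h k (dcomp \<phi> \<sigma>, t)))\<rparr>"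

text \<open>Evaluation of an \<open>n\<close>-simplex of the path object at the end-point \<open>j \<in> {0, 1}\<close>.\<close>

definition path_end :: "nat \<Rightarrow> nat \<Rightarrow> 'a path \<Rightarrow> 'a" where
  "path_end j n h = h n (did n, dconst n 1 j)"

text \<open>The map \<open>P \<rightarrow> C\<close> to the power \<open>\<Delta>\<^sup>1\<close> adjoint to \<open>H : P \<times> \<Delta>\<^sup>1 \<rightarrow> C\<close>.\<close>

definition adjoint_path :: "'a sset \<Rightarrow> (nat \<Rightarrow> 'a \<times> dmap \<Rightarrow> 'c) \<Rightarrow> nat \<Rightarrow> 'a \<Rightarrow> 'c path" where
  "adjoint_path P H n x = path_restrict n (\<lambda>k (\<sigma>, t). H k (act P \<sigma> x, t))"

text \<open>The homotopy pullback of \<open>f : A \<rightarrow> C\<close> and \<open>g : B \<rightarrow> C\<close> for Kan complexes.  A point consists of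
  \<open>a\<close>, \<open>b\<close>, a point \<open>c\<close> of \<open>C\<close> and paths from \<open>c\<close> to \<open>f a\<close> and from \<open>c\<close> to \<open>g b\<close>.  Compared with
  the model using one path from \<open>f a\<close> to \<open>g b\<close>, this one receives a map from every square
  that commutes up to a pair of homotopies starting at its diagonal, with no need to choose
  composites.\<close>

definition hpullback ::
  "'a sset \<Rightarrow> 'b sset \<Rightarrow> 'c sset \<Rightarrow> (nat \<Rightarrow> 'a \<Rightarrow> 'c) \<Rightarrow> (nat \<Rightarrow> 'b \<Rightarrow> 'c) \<Rightarrow>
   ('a \<times> 'c path \<times> 'c path \<times> 'b) sset"
where
  "hpullback A B C f g =
     \<lparr>splx = (\<lambda>n. {(a, \<alpha>, \<beta>, b).
          a \<in> splx A n \<and> b \<in> splx B n \<and>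
          \<alpha> \<in> splx (path_obj C) n \<and> \<beta> \<in> splx (path_obj C) n \<and>
          path_end 0 n \<alpha> = path_end 0 n \<beta> \<and>
          path_end 1 n \<alpha> = f n a \<and> path_end 1 n \<beta> = g n b}),
      act = (\<lambda>\<phi> (a, \<alpha>, \<beta>, b).
          (act A \<phi> a, act (path_obj C) \<phi> \<alpha>, act (path_obj C) \<phi> \<beta>, act B \<phi> b))\<rparr>"

text \<open>The square with sides \<open>u : P \<rightarrow> A\<close>, \<open>v : P \<rightarrow> B\<close>, \<open>f : A \<rightarrow> C\<close>, \<open>g : B \<rightarrow> C\<close> and a
  diagonal \<open>P \<rightarrow> C\<close>, filled by homotopies \<open>H\<close>, \<open>H'\<close> from the diagonal to \<open>f u\<close> and to \<open>g v\<close>.\<close>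

definition pullback_square ::
  "'p sset \<Rightarrow> 'a sset \<Rightarrow> 'b sset \<Rightarrow> 'c sset \<Rightarrow>
   (nat \<Rightarrow> 'p \<Rightarrow> 'a) \<Rightarrow> (nat \<Rightarrow> 'p \<Rightarrow> 'b) \<Rightarrow> (nat \<Rightarrow> 'a \<Rightarrow> 'c) \<Rightarrow> (nat \<Rightarrow> 'b \<Rightarrow> 'c) \<Rightarrow>
   (nat \<Rightarrow> 'p \<times> dmap \<Rightarrow> 'c) \<Rightarrow> (nat \<Rightarrow> 'p \<times> dmap \<Rightarrow> 'c) \<Rightarrow> bool"
where
  "pullback_square P A B C u v f g H H' \<longleftrightarrow>
     hequiv P (hpullback A B C f g)
       (\<lambda>n x. (u n x, adjoint_path P H n x, adjoint_path P H' n x, v n x))"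

text \<open>The fibre over a vertex \<open>b\<close> is the homotopy pullback along \<open>b : \<Delta>\<^sup>0 \<rightarrow> L\<close>.\<close>

definition point_map :: "'b sset \<Rightarrow> 'b \<Rightarrow> nat \<Rightarrow> dmap \<Rightarrow> 'b" where
  "point_map L b n \<sigma> = act L \<sigma> b"

definition hfibre ::
  "'a sset \<Rightarrow> 'b sset \<Rightarrow> (nat \<Rightarrow> 'a \<Rightarrow> 'b) \<Rightarrow> 'b \<Rightarrow> ('a \<times> 'b path \<times> 'b path \<times> dmap) sset"
where
  "hfibre K L f b = hpullback K (std 0) L f (point_map L b)"

definition empty_sset :: "'a sset \<Rightarrow> bool" where
  "empty_sset K \<longleftrightarrow> (\<forall>n. splx K n = {})"

definition monomorphism :: "'a sset \<Rightarrow> 'b sset \<Rightarrow> (nat \<Rightarrow> 'a \<Rightarrow> 'b) \<Rightarrow> bool" where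
  "monomorphism K L f \<longleftrightarrow>
     (\<forall>b\<in>splx L 0. empty_sset (hfibre K L f b) \<or> contractible (hfibre K L f b))"

text \<open>Images and complements are invariant under equivalence, hence closed under paths.  Since
  they are full subgroupoids, they are given by their vertices.\<close>

definition path_connected :: "'a sset \<Rightarrow> 'a \<Rightarrow> 'a \<Rightarrow> bool" where
  "path_connected K x y \<longleftrightarrow>
     (\<exists>e\<in>splx K 1. act K (dconst 0 1 0) e = x \<and> act K (dconst 0 1 1) e = y)"

definition ess_image :: "'a sset \<Rightarrow> 'b sset \<Rightarrow> (nat \<Rightarrow> 'a \<Rightarrow> 'b) \<Rightarrow> 'b set" where
  "ess_image K L f = {y \<in> splx L 0. \<exists>x\<in>splx K 0. path_connected L (f 0 x) y}"

definition full_sub :: "'a sset \<Rightarrow> 'a set \<Rightarrow> 'a sset" where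
  "full_sub K V = K\<lparr>splx := (\<lambda>n. {x \<in> splx K n. \<forall>i\<le>n. act K (dconst 0 n i) x \<in> V})\<rparr>"

section \<open>Functors from the opposite of \<open>\<Delta>\<close> to \<open>\<infinity>\<close>-groupoids\<close>

text \<open>\<open>Grpd\<close> is the homotopy coherent nerve of the simplicial category of Kan complexes, and an
  \<open>\<infinity>\<close>-functor is a simplicial map to it from the nerve of the opposite of \<open>\<Delta>\<close>.  By adjunction this amounts to a Kan
  complex \<open>ob X k\<close> for each \<open>k\<close> and, for each composable chain
  \<open>[k\<^sub>0] \<rightarrow> [k\<^sub>1] \<rightarrow> \<dots> \<rightarrow> [k\<^sub>n]\<close> of maps \<open>f\<^sub>1, \<dots>, f\<^sub>n\<close> in \<open>\<Delta>\<close> with \<open>n \<ge> 1\<close>, a simplicial map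
  \<open>(\<Delta>\<^sup>1)\<^sup>n\<^sup>-\<^sup>1 \<times> X\<^sub>k\<^sub>n \<rightarrow> X\<^sub>k\<^sub>0\<close>.  The cube is the nerve of the poset of subsets of
  \<open>{1, \<dots>, n - 1}\<close>: the coordinate \<open>t\<^sub>i\<close> sits between \<open>f\<^sub>i\<close> and \<open>f\<^sub>i\<^sub>+\<^sub>1\<close>, the value 0 means that the
  two maps are composed in \<open>\<Delta>\<close>, and the value 1 that the maps induced by the two parts of the
  chain are composed.  In particular a chain \<open>f, g\<close> gives a homotopy from \<open>X (g f)\<close> to
  \<open>X f \<circ> X g\<close>.\<close>

record 'a cdiag =
  ob :: "nat \<Rightarrow> 'a sset"
  cell :: "dmap list \<Rightarrow> nat \<Rightarrow> dmap list \<times> 'a \<Rightarrow> 'a"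

definition chain :: "dmap list \<Rightarrow> bool" where
  "chain c \<longleftrightarrow> c \<noteq> [] \<and> (\<forall>f\<in>set c. is_dmap f) \<and> successively (\<lambda>f g. src g = tgt f) c"

definition dmax :: "dmap \<Rightarrow> dmap \<Rightarrow> dmap" where
  "dmax s t = mk_dmap (src s) (tgt s) (\<lambda>i. max (ap s i) (ap t i))"

definition simplicial_space :: "'a cdiag \<Rightarrow> bool" where
  "simplicial_space X \<longleftrightarrow>
     (\<forall>k. kan (ob X k)) \<and>
     (\<forall>c. chain c \<longrightarrow>
        smap (sprod (cube (length c - 1)) (ob X (tgt (last c)))) (ob X (src (hd c))) (cell X c)) \<and>
     \<comment> \<open>inner faces\<close>
     (\<forall>as f g bs m ts us x. chain (as @ f # g # bs) \<and>
        ts \<in> splx (cube (length as)) m \<and> us \<in> splx (cube (length bs)) m \<and>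
        x \<in> splx (ob X (tgt (last (f # g # bs)))) m \<longrightarrow>
        cell X (as @ f # g # bs) m (ts @ dconst m 1 0 # us, x) =
        cell X (as @ dcomp g f # bs) m (ts @ us, x)) \<and>
     \<comment> \<open>composition\<close>
     (\<forall>as bs m ts us x. as \<noteq> [] \<and> bs \<noteq> [] \<and> chain (as @ bs) \<and>
        ts \<in> splx (cube (length as - 1)) m \<and> us \<in> splx (cube (length bs - 1)) m \<and>
        x \<in> splx (ob X (tgt (last bs))) m \<longrightarrow>
        cell X (as @ bs) m (ts @ dconst m 1 1 # us, x) =
        cell X as m (ts, cell X bs m (us, x))) \<and>
     \<comment> \<open>degeneracies: an identity alone, at the start, at the end, in the interior\<close>
     (\<forall>k m. \<forall>x\<in>splx (ob X k) m. cell X [did k] m ([], x) = x) \<and>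
     (\<forall>k bs m t us x. bs \<noteq> [] \<and> chain (did k # bs) \<and>
        t # us \<in> splx (cube (length bs)) m \<and> x \<in> splx (ob X (tgt (last bs))) m \<longrightarrow>
        cell X (did k # bs) m (t # us, x) = cell X bs m (us, x)) \<and>
     (\<forall>k as m ts t x. as \<noteq> [] \<and> chain (as @ [did k]) \<and>
        ts @ [t] \<in> splx (cube (length as)) m \<and> x \<in> splx (ob X k) m \<longrightarrow>
        cell X (as @ [did k]) m (ts @ [t], x) = cell X as m (ts, x)) \<and>
     (\<forall>k as bs m ts s t us x. as \<noteq> [] \<and> bs \<noteq> [] \<and> chain (as @ did k # bs) \<and>
        ts \<in> splx (cube (length as - 1)) m \<and> us \<in> splx (cube (length bs - 1)) m \<and>
        s \<in> splx (std 1) m \<and> t \<in> splx (std 1) m \<and> x \<in> splx (ob X (tgt (last bs))) m \<longrightarrow>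
        cell X (as @ did k # bs) m (ts @ s # t # us, x) =
        cell X (as @ bs) m (ts @ dmax s t # us, x))"

definition ind :: "'a cdiag \<Rightarrow> dmap \<Rightarrow> nat \<Rightarrow> 'a \<Rightarrow> 'a" where
  "ind X f n x = cell X [f] n ([], x)"

definition ind2 :: "'a cdiag \<Rightarrow> dmap \<Rightarrow> dmap \<Rightarrow> nat \<Rightarrow> 'a \<times> dmap \<Rightarrow> 'a" where
  "ind2 X f g n = (\<lambda>(x, t). cell X [f, g] n ([t], x))"

text \<open>The functor sends the square \<open>f' f = g' g\<close> of \<open>\<Delta>\<close>, seen as a pair of composable chains with
  common composite, to a pair of homotopies with common source \<open>X (f' f)\<close>.\<close>

definition sends_to_pullback :: "'a cdiag \<Rightarrow> dmap \<Rightarrow> dmap \<Rightarrow> dmap \<Rightarrow> dmap \<Rightarrow> bool" where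
  "sends_to_pullback X f g f' g' \<longleftrightarrow>
     pullback_square (ob X (tgt f')) (ob X (tgt f)) (ob X (tgt g)) (ob X (src f))
       (ind X f') (ind X g') (ind X f) (ind X g) (ind2 X f f') (ind2 X g g')"

section \<open>Decomposition spaces\<close>

definition decomposition_space :: "'a cdiag \<Rightarrow> bool" where
  "decomposition_space X \<longleftrightarrow> simplicial_space X \<and>
     (\<forall>g f g' f'. is_generic g \<and> is_free f \<and> pushout_square g f g' f' \<longrightarrow>
        sends_to_pullback X g f g' f')"

abbreviation face :: "'a cdiag \<Rightarrow> nat \<Rightarrow> nat \<Rightarrow> nat \<Rightarrow> 'a \<Rightarrow> 'a" where
  "face X n i \<equiv> ind X (coface n i)"

abbreviation degen :: "'a cdiag \<Rightarrow> nat \<Rightarrow> nat \<Rightarrow> nat \<Rightarrow> 'a \<Rightarrow> 'a" where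
  "degen X n i \<equiv> ind X (codegeneracy n i)"

definition complete_decomposition_space :: "'a cdiag \<Rightarrow> bool" where
  "complete_decomposition_space X \<longleftrightarrow>
     decomposition_space X \<and> monomorphism (ob X 0) (ob X 1) (degen X 0 0)"

definition nondegenerate_edges :: "'a cdiag \<Rightarrow> 'a set" where
  "nondegenerate_edges X = splx (ob X 1) 0 - ess_image (ob X 0) (ob X 1) (degen X 0 0)"

definition principal_edge :: "nat \<Rightarrow> nat \<Rightarrow> dmap" where
  "principal_edge r i = mk_dmap 1 r (\<lambda>j. i + j)"

definition vec_ob :: "'a cdiag \<Rightarrow> nat \<Rightarrow> 'a sset" where
  "vec_ob X r = full_sub (ob X r)
     {x \<in> splx (ob X r) 0. \<forall>i<r. ind X (principal_edge r i) 0 x \<in> nondegenerate_edges X}"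

definition long_edge :: "nat \<Rightarrow> dmap" where
  "long_edge r = mk_dmap 1 r (\<lambda>j. if j = 0 then 0 else r)"

definition tight_decomposition_space :: "'a cdiag \<Rightarrow> bool" where
  "tight_decomposition_space X \<longleftrightarrow> complete_decomposition_space X \<and>
     (\<forall>a\<in>splx (ob X 1) 0. \<exists>N. \<forall>r\<ge>N.
        empty_sset (hfibre (vec_ob X r) (ob X 1) (ind X (long_edge r)) a))"

definition complete_simplicial_space :: "'a cdiag \<Rightarrow> bool" where
  "complete_simplicial_space X \<longleftrightarrow> simplicial_space X \<and>
     (\<forall>n i. i \<le> n \<longrightarrow> monomorphism (ob X n) (ob X (Suc n)) (degen X n i))"

definition nondegenerate :: "'a cdiag \<Rightarrow> nat \<Rightarrow> 'a set" where
  "nondegenerate X n = {x \<in> splx (ob X n) 0.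
     \<forall>m i. n = Suc m \<and> i \<le> m \<longrightarrow> x \<notin> ess_image (ob X m) (ob X n) (degen X m i)}"

definition split_simplicial_space :: "'a cdiag \<Rightarrow> bool" where
  "split_simplicial_space X \<longleftrightarrow> complete_simplicial_space X \<and>
     (\<forall>n i. i \<le> Suc n \<longrightarrow>
        (\<forall>x\<in>nondegenerate X (Suc n). face X n i 0 x \<in> nondegenerate X n))"

end

(* Both halves rest on the pullback squares
     X_n -> X_0, X_(n+1) -> X_1   (pushouts of the codegeneracy [1] -> [0] along principal edges).

   Degeneracies are monomorphisms because they are homotopy pullbacks of s_0.  With fibres and
   equivalences spelled out simplicially, this needs: the homotopy extension property for Kan
   complexes (extend a partial lift over S x [1], by Zorn's lemma and horn filling), from which horn
   extension over S x [n] follows by a retract argument; and the fact that a homotopy equivalence,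
   replaced by a fibration, has the lifting property for all boundary inclusions.

   On components, the same squares show that a simplex is nondegenerate iff all its principal edges
   are.  So only inner faces matter, and they reduce to the claim that the long edge of a 2-simplex
   with nondegenerate principal edges a, b is nondegenerate.  If it were degenerate, then copies of
   the 2-simplex could be glued end to end, giving simplices with principal edges a, b, a, b, ... of
   arbitrary length over the same long edge, against tightness. *)

theory Submission
  imports Defs
begin

section \<open>Monotone maps\<close>

text \<open>The two halves draw on the squares with different strength. Gluing and nondegeneracy
  concern vertices up to paths, so surjectivity of the comparison map on components is what is
  extracted there (\<open>pullback_square_vertex\<close>). Monomorphisms ask for contractible
  fibres, hence spheres of every dimension must be filled strictly; this is what forces fibrations
  into the argument. A fibration is not treated as a map but as a relation \<open>R n x y\<close>
  between simplices: base change is then composition of \<open>R\<close> with a map, and no strict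
  pullback has to be built. Simplices are attached one at a time, which requires that a missing
  simplex carry no hidden identifications. Instead of the Eilenberg-Zilber lemma,
  \<open>surjection_separation\<close> serves: two operators with the same effect on a simplex, one
  of them surjective, exhibit it as obtained from its own proper faces. The two homotopies of a
  homotopy equivalence come without coherence. The remedy is \<open>glue_homotopies\<close>, which
  fills a horn of homotopies fibrewise and also yields symmetry and transitivity of
  homotopy.\<close>

definition dhom :: "nat \<Rightarrow> nat \<Rightarrow> dmap set" where
  "dhom m n = {f. is_dmap f \<and> src f = m \<and> tgt f = n}"

lemma dhomD:
  assumes "f \<in> dhom m n"
  shows "is_dmap f" "src f = m" "tgt f = n"
  using assms by (auto simp: dhom_def)

lemma ap_le: "f \<in> dhom m n \<Longrightarrow> i \<le> m \<Longrightarrow> ap f i \<le> n"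
  by (auto simp: dhom_def is_dmap_def PiE_def Pi_def)

lemma ap_mono: "f \<in> dhom m n \<Longrightarrow> i \<le> j \<Longrightarrow> j \<le> m \<Longrightarrow> ap f i \<le> ap f j"
  by (auto simp: dhom_def is_dmap_def mono_on_def)

lemma dhom_eqI:
  assumes "f \<in> dhom m n" "g \<in> dhom m n" "\<And>i. i \<le> m \<Longrightarrow> ap f i = ap g i"
  shows "f = g"
proof -
  have "ap f = ap g"
  proof
    fix i
    show "ap f i = ap g i"
    proof (cases "i \<le> m")
      case False
      then show ?thesis
        using assms(1,2) by (auto simp: dhom_def is_dmap_def PiE_def extensional_def)
    qed (use assms in auto)
  qed
  then show ?thesis
    using assms by (auto simp: dhom_def intro: dmap.equality)
qed

lemma mk_dmap_simps [simp]: "src (mk_dmap m n f) = m" "tgt (mk_dmap m n f) = n"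
  by (simp_all add: mk_dmap_def)

lemma ap_mk_dmap [simp]: "i \<le> m \<Longrightarrow> ap (mk_dmap m n f) i = f i"
  by (simp add: mk_dmap_def)

lemma mk_dmap_dhom:
  assumes "\<And>i. i \<le> m \<Longrightarrow> f i \<le> n" "\<And>i j. i \<le> j \<Longrightarrow> j \<le> m \<Longrightarrow> f i \<le> f j"
  shows "mk_dmap m n f \<in> dhom m n"
  using assms by (auto simp: dhom_def is_dmap_def mk_dmap_def mono_on_def)

lemma did_dhom [simp]: "did n \<in> dhom n n"
  unfolding did_def by (rule mk_dmap_dhom) auto

lemma dconst_dhom [simp]: "j \<le> n \<Longrightarrow> dconst m n j \<in> dhom m n"
  unfolding dconst_def by (rule mk_dmap_dhom) auto

lemma coface_dhom [simp]: "coface n i \<in> dhom n (Suc n)"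
  unfolding coface_def by (rule mk_dmap_dhom) auto

lemma codegeneracy_dhom [simp]: "i \<le> n \<Longrightarrow> codegeneracy n i \<in> dhom (Suc n) n"
  unfolding codegeneracy_def by (rule mk_dmap_dhom) auto

lemma dcomp_dhom: "g \<in> dhom m n \<Longrightarrow> f \<in> dhom l m \<Longrightarrow> dcomp g f \<in> dhom l n"
  unfolding dcomp_def
  using mk_dmap_dhom[of l "\<lambda>i. ap g (ap f i)" n]
  by (metis ap_le ap_mono dhomD(2,3))

lemma src_tgt_simps [simp]:
  "src (did n) = n" "tgt (did n) = n"
  "src (dconst m n j) = m" "tgt (dconst m n j) = n"
  "src (coface n i) = n" "tgt (coface n i) = Suc n"
  "src (codegeneracy n i) = Suc n" "tgt (codegeneracy n i) = n"
  "src (dcomp g f) = src f" "tgt (dcomp g f) = tgt g"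
  by (simp_all add: did_def dconst_def coface_def codegeneracy_def dcomp_def)

lemma ap_did [simp]: "i \<le> n \<Longrightarrow> ap (did n) i = i"
  by (simp add: did_def)

lemma ap_dconst [simp]: "i \<le> m \<Longrightarrow> ap (dconst m n j) i = j"
  by (simp add: dconst_def)

lemma ap_coface: "j \<le> n \<Longrightarrow> ap (coface n i) j = (if j < i then j else Suc j)"
  by (simp add: coface_def)

lemma ap_codegeneracy: "j \<le> Suc n \<Longrightarrow> ap (codegeneracy n i) j = (if j \<le> i then j else j - 1)"
  by (simp add: codegeneracy_def)

lemma ap_dcomp: "f \<in> dhom l m \<Longrightarrow> i \<le> l \<Longrightarrow> ap (dcomp g f) i = ap g (ap f i)"
  by (simp add: dcomp_def dhomD)

lemma dcomp_assoc:
  assumes "f \<in> dhom k l" "g \<in> dhom l m" "h \<in> dhom m n"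
  shows "dcomp (dcomp h g) f = dcomp h (dcomp g f)"
  using assms
  by (intro dhom_eqI[of _ k n])
    (auto intro: dcomp_dhom simp: ap_dcomp[of f k l] ap_dcomp[of "dcomp g f" k m] ap_dcomp[of g l m]
      dcomp_dhom ap_le)

lemma dcomp_did_left: "f \<in> dhom m n \<Longrightarrow> dcomp (did n) f = f"
  by (rule dhom_eqI[of _ m n]) (auto intro!: dcomp_dhom simp: ap_dcomp ap_le)

lemma dcomp_did_right: "f \<in> dhom m n \<Longrightarrow> dcomp f (did m) = f"
  by (rule dhom_eqI[of _ m n]) (auto intro!: dcomp_dhom simp: ap_dcomp[of _ m m])

lemma dcomp_dconst_left: "f \<in> dhom l m \<Longrightarrow> j \<le> n \<Longrightarrow> dcomp (dconst m n j) f = dconst l n j"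
  by (rule dhom_eqI[of _ l n]) (auto intro!: dcomp_dhom simp: ap_dcomp ap_le)

lemma dcomp_dconst_right:
  "f \<in> dhom m n \<Longrightarrow> j \<le> m \<Longrightarrow> dcomp f (dconst l m j) = dconst l n (ap f j)"
  by (rule dhom_eqI[of _ l n]) (auto intro!: dcomp_dhom simp: ap_dcomp[of _ l m] ap_le)

lemma dhom_0: "f \<in> dhom m 0 \<Longrightarrow> f = dconst m 0 0"
  by (rule dhom_eqI[of _ m 0]) (auto dest: ap_le)

text \<open>Choosing the least preimage makes the factor monotone: a descent of \<open>s\<close>
  would force equal values of \<open>g\<close>, and then leastness rules it out. Sections of
  surjections and factorizations through cofaces are instances.\<close>

lemma dfactor:
  assumes f: "f \<in> dhom l n" and g: "g \<in> dhom m n"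
    and sub: "\<And>i. i \<le> m \<Longrightarrow> \<exists>j\<le>l. ap f j = ap g i"
  obtains s where "s \<in> dhom m l" "dcomp f s = g"
proof
  define s where "s i = (LEAST j. j \<le> l \<and> ap f j = ap g i)" for i
  have s: "s i \<le> l \<and> ap f (s i) = ap g i" if "i \<le> m" for i
    using LeastI_ex[of "\<lambda>j. j \<le> l \<and> ap f j = ap g i"] sub[OF that] by (auto simp: s_def)
  have mono: "s i \<le> s j" if "i \<le> j" "j \<le> m" for i j
  proof (rule ccontr)
    assume "\<not> s i \<le> s j"
    then have lt: "s j < s i" by simp
    then have "ap f (s j) \<le> ap f (s i)"
      using ap_mono[OF f, of "s j" "s i"] s[of i] that by auto
    moreover have "ap g i \<le> ap g j" using ap_mono[OF g] that by auto
    ultimately have "ap f (s j) = ap g i" using s[of i] s[of j] that by auto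
    then have "s i \<le> s j" using s[of j] that unfolding s_def[of i] by (intro Least_le) auto
    then show False using lt by simp
  qed
  show "mk_dmap m l s \<in> dhom m l" using s mono by (intro mk_dmap_dhom) auto
  then show "dcomp f (mk_dmap m l s) = g"
    by (intro dhom_eqI[OF dcomp_dhom[OF f] g]) (auto simp: ap_dcomp s)
qed

text \<open>A section of \<open>f\<close> can be made to pass through a point where \<open>f\<close>
  and \<open>g\<close> differ. Then \<open>dcomp g s\<close> is not the identity of
  \<open>[n]\<close>, and the identity is the only surjective monotone endomap.\<close>

lemma surjection_separation:
  assumes f: "f \<in> dhom m n" and g: "g \<in> dhom m n" and ne: "f \<noteq> g"
    and surj: "\<And>i. i \<le> n \<Longrightarrow> \<exists>j\<le>m. ap f j = i"
  obtains s where "s \<in> dhom n m" "dcomp f s = did n" "\<exists>i\<le>n. \<forall>j\<le>n. ap (dcomp g s) j \<noteq> i"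
proof -
  obtain j0 where j0: "j0 \<le> m" "ap f j0 \<noteq> ap g j0" using dhom_eqI[OF f g] ne by blast
  obtain t where t: "t \<in> dhom n m" "dcomp f t = did n"
    using dfactor[OF f did_dhom] surj by auto
  have ft: "ap f (ap t i) = i" if "i \<le> n" for i
    using ap_dcomp[OF t(1) that, of f] t(2) that by simp
  let ?a = "ap f j0"
  have a: "?a \<le> n" using ap_le[OF f j0(1)] .
  \<comment> \<open>The section \<open>t\<close> is redirected through \<open>j0\<close> at the
    single value \<open>?a\<close>, the image of \<open>j0\<close>; monotonicity of \<open>f\<close>
    keeps the result monotone.\<close>
  define s where "s = mk_dmap n m (\<lambda>i. if i = ?a then j0 else ap t i)"
  have lt: "ap t i \<le> j0" if "i < ?a" for i
  proof (rule ccontr)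
    assume "\<not> ap t i \<le> j0"
    then have "?a \<le> ap f (ap t i)" using ap_mono[OF f, of j0 "ap t i"] ap_le[OF t(1), of i] that a by auto
    then show False using ft[of i] that a by simp
  qed
  have gt: "j0 \<le> ap t i" if "i > ?a" "i \<le> n" for i
  proof (rule ccontr)
    assume "\<not> j0 \<le> ap t i"
    then have "ap f (ap t i) \<le> ?a" using ap_mono[OF f, of "ap t i" j0] j0 by auto
    then show False using ft[of i] that by simp
  qed
  have s: "s \<in> dhom n m"
    unfolding s_def using j0 ap_le[OF t(1)] ap_mono[OF t(1)] lt gt
    by (intro mk_dmap_dhom) auto
  have s_eq: "ap s i = (if i = ?a then j0 else ap t i)" if "i \<le> n" for i
    using that by (simp add: s_def)
  have fs: "dcomp f s = did n"
    by (rule dhom_eqI[OF dcomp_dhom[OF f s] did_dhom]) (auto simp: ap_dcomp[OF s] s_eq ft)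
  have "\<exists>i\<le>n. \<forall>j\<le>n. ap (dcomp g s) j \<noteq> i"
  proof (rule ccontr)
    let ?h = "dcomp g s"
    assume "\<not> ?thesis"
    then have sur: "\<And>i. i \<le> n \<Longrightarrow> \<exists>j\<le>n. ap ?h j = i" by blast
    have h: "?h \<in> dhom n n" using dcomp_dhom[OF g s] .
    have "ap ?h ` {..n} = {..n}" using sur ap_le[OF h] by fastforce
    then have inj: "inj_on (ap ?h) {..n}" by (simp add: eq_card_imp_inj_on)
    \<comment> \<open>An injective monotone endomap is squeezed to the identity: from below by
      \<open>ge\<close>, from the top by \<open>le\<close>.\<close>
    have ge: "i \<le> ap ?h i" if "i \<le> n" for i using that
    proof (induction i)
      case (Suc i)
      have "ap ?h i \<le> ap ?h (Suc i)" using ap_mono[OF h, of i "Suc i"] Suc by auto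
      moreover have "ap ?h i \<noteq> ap ?h (Suc i)" using inj Suc.prems by (auto dest: inj_onD)
      ultimately show ?case using Suc by auto
    qed simp
    have le: "ap ?h (n - d) \<le> n - d" for d
    proof (induction d)
      case 0 then show ?case using ap_le[OF h] by simp
    next
      case (Suc d)
      show ?case
      proof (cases "d < n")
        case True
        have "ap ?h (n - Suc d) \<le> ap ?h (n - d)" using ap_mono[OF h] by auto
        moreover have "ap ?h (n - Suc d) \<noteq> ap ?h (n - d)"
          using inj_onD[OF inj, of "n - Suc d" "n - d"] True by auto
        ultimately show ?thesis using Suc True by auto
      qed (use Suc in auto)
    qed
    have "ap ?h ?a = ?a" using ge[OF a] le[of "n - ?a"] a by auto
    moreover have "ap ?h ?a = ap g j0" using a by (simp add: ap_dcomp[OF s] s_eq)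
    ultimately show False using j0 by simp
  qed
  then show thesis using that s fs by blast
qed

section \<open>Simplicial sets\<close>

lemma act_closed: "is_sset K \<Longrightarrow> f \<in> dhom m n \<Longrightarrow> x \<in> splx K n \<Longrightarrow> act K f x \<in> splx K m"
  by (auto simp: is_sset_def dhom_def)

lemma act_did: "is_sset K \<Longrightarrow> x \<in> splx K n \<Longrightarrow> act K (did n) x = x"
  by (auto simp: is_sset_def)

lemma act_dcomp:
  "is_sset K \<Longrightarrow> f \<in> dhom l m \<Longrightarrow> g \<in> dhom m n \<Longrightarrow> x \<in> splx K n \<Longrightarrow>
   act K (dcomp g f) x = act K f (act K g x)"
  by (auto simp: is_sset_def dhom_def)

lemma is_ssetI:
  assumes "\<And>f m n x. f \<in> dhom m n \<Longrightarrow> x \<in> splx K n \<Longrightarrow> act K f x \<in> splx K m"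
    and "\<And>n x. x \<in> splx K n \<Longrightarrow> act K (did n) x = x"
    and "\<And>f g l m n x. f \<in> dhom l m \<Longrightarrow> g \<in> dhom m n \<Longrightarrow> x \<in> splx K n \<Longrightarrow>
      act K (dcomp g f) x = act K f (act K g x)"
  shows "is_sset K"
  using assms by (auto simp: is_sset_def dhom_def)

lemma smap_closed: "smap K L F \<Longrightarrow> x \<in> splx K n \<Longrightarrow> F n x \<in> splx L n"
  by (auto simp: smap_def)

lemma smap_act:
  "smap K L F \<Longrightarrow> f \<in> dhom m n \<Longrightarrow> x \<in> splx K n \<Longrightarrow> F m (act K f x) = act L f (F n x)"
  by (auto simp: smap_def dhom_def)

lemma smapI:
  assumes "\<And>n x. x \<in> splx K n \<Longrightarrow> F n x \<in> splx L n"
    and "\<And>f m n x. f \<in> dhom m n \<Longrightarrow> x \<in> splx K n \<Longrightarrow> F m (act K f x) = act L f (F n x)"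
  shows "smap K L F"
  using assms by (auto simp: smap_def dhom_def)

lemma smap_comp: "smap K L F \<Longrightarrow> smap L M G \<Longrightarrow> smap K M (\<lambda>n x. G n (F n x))"
  by (rule smapI) (auto simp: smap_closed smap_act[of K] smap_act[of L])

lemma smap_id: "smap K K (\<lambda>n x. x)"
  by (rule smapI) auto

lemma splx_std [simp]: "splx (std n) m = dhom m n"
  by (simp add: std_def dhom_def)

lemma act_std [simp]: "act (std n) f g = dcomp g f"
  by (simp add: std_def)

lemma is_sset_std: "is_sset (std n)"
  by (rule is_ssetI) (auto intro: dcomp_dhom simp: dcomp_did_right dcomp_assoc)

lemma splx_sprod [simp]: "splx (sprod K L) n = splx K n \<times> splx L n"
  by (simp add: sprod_def)

lemma act_sprod [simp]: "act (sprod K L) f (x, y) = (act K f x, act L f y)"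
  by (simp add: sprod_def)

lemma is_sset_sprod: "is_sset K \<Longrightarrow> is_sset L \<Longrightarrow> is_sset (sprod K L)"
  by (rule is_ssetI) (auto simp: act_closed act_did act_dcomp)

definition sub :: "'a sset \<Rightarrow> (nat \<Rightarrow> 'a set) \<Rightarrow> 'a sset" where
  "sub K A = K\<lparr>splx := A\<rparr>"

lemma sub_simps [simp]: "splx (sub K A) = A" "act (sub K A) = act K"
  by (simp_all add: sub_def)

definition subcomplex :: "'a sset \<Rightarrow> (nat \<Rightarrow> 'a set) \<Rightarrow> bool" where
  "subcomplex K A \<longleftrightarrow> (\<forall>n. A n \<subseteq> splx K n) \<and>
     (\<forall>m n. \<forall>f\<in>dhom m n. \<forall>x\<in>A n. act K f x \<in> A m)"

lemma is_sset_sub: "is_sset K \<Longrightarrow> subcomplex K A \<Longrightarrow> is_sset (sub K A)"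
  by (rule is_ssetI) (auto simp: subcomplex_def act_did subset_iff intro: act_dcomp)

lemma smap_simplex: "is_sset K \<Longrightarrow> x \<in> splx K n \<Longrightarrow> smap (std n) K (\<lambda>m f. act K f x)"
  by (rule smapI) (auto simp: act_closed act_dcomp)

section \<open>Boundaries and horns of the standard simplex\<close>

definition boundary :: "nat \<Rightarrow> nat \<Rightarrow> dmap set" where
  "boundary n m = {f \<in> dhom m n. \<exists>l\<le>n. \<forall>j\<le>m. ap f j \<noteq> l}"

definition horn :: "nat \<Rightarrow> nat \<Rightarrow> nat \<Rightarrow> dmap set" where
  "horn n k m = {f \<in> dhom m n. \<exists>l\<le>n. l \<noteq> k \<and> (\<forall>j\<le>m. ap f j \<noteq> l)}"

lemma boundary_dcomp: "g \<in> boundary n m \<Longrightarrow> f \<in> dhom l m \<Longrightarrow> dcomp g f \<in> boundary n l"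
  by (auto simp: boundary_def ap_dcomp intro: dcomp_dhom dest: ap_le)

lemma horn_dcomp: "g \<in> horn n k m \<Longrightarrow> f \<in> dhom l m \<Longrightarrow> dcomp g f \<in> horn n k l"
  by (auto simp: horn_def ap_dcomp intro: dcomp_dhom dest: ap_le)

lemma boundary_dhom: "f \<in> boundary n m \<Longrightarrow> f \<in> dhom m n"
  by (simp add: boundary_def)

lemma horn_dhom: "f \<in> horn n k m \<Longrightarrow> f \<in> dhom m n"
  by (simp add: horn_def)

lemma subcomplex_boundary: "subcomplex (std n) (boundary n)"
  by (auto simp: subcomplex_def boundary_dcomp boundary_dhom)

lemma subcomplex_horn: "subcomplex (std n) (horn n k)"
  by (auto simp: subcomplex_def horn_dcomp horn_dhom)

lemma coface_factor:
  assumes f: "f \<in> dhom m (Suc n)" and "l \<le> Suc n" "\<forall>j\<le>m. ap f j \<noteq> l"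
  obtains g where "g \<in> dhom m n" "dcomp (coface n l) g = f"
proof (rule dfactor[OF coface_dhom f])
  fix i assume i: "i \<le> m"
  let ?v = "ap f i"
  have v: "?v \<le> Suc n" "?v \<noteq> l" using ap_le[OF f i] assms i by auto
  show "\<exists>j\<le>n. ap (coface n l) j = ?v"
    using v assms(2) by (intro exI[of _ "if ?v < l then ?v else ?v - 1"]) (auto simp: ap_coface)
qed (use that in auto)

lemma coface_comp:
  assumes "i < j" "j \<le> Suc (Suc n)"
  shows "dcomp (coface (Suc n) j) (coface n i) = dcomp (coface (Suc n) i) (coface n (j - 1))"
  by (rule dhom_eqI[of _ n "Suc (Suc n)"])
    (use assms in \<open>auto intro!: dcomp_dhom[OF coface_dhom coface_dhom] simp: ap_dcomp[OF coface_dhom] ap_coface\<close>)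

section \<open>Lifting by attaching cells\<close>

text \<open>A family of lifting problems over \<open>K\<close> is given by a relation: \<open>R n x y\<close> says that \<open>y\<close> lies
  over \<open>x\<close>.\<close>

type_synonym ('k, 'e) over = "nat \<Rightarrow> 'k \<Rightarrow> 'e \<Rightarrow> bool"

definition closed_over :: "'k sset \<Rightarrow> 'e sset \<Rightarrow> ('k, 'e) over \<Rightarrow> bool" where
  "closed_over K E R \<longleftrightarrow> (\<forall>m n. \<forall>f\<in>dhom m n. \<forall>x\<in>splx K n. \<forall>y\<in>splx E n.
     R n x y \<longrightarrow> R m (act K f x) (act E f y))"

text \<open>The right lifting property against boundary inclusions. If \<open>R n x y\<close> says
  that some map sends \<open>y\<close> to \<open>x\<close>, this makes that map a trivial fibration;
  with \<open>R\<close> always true over \<open>std 0\<close> it expresses contractibility of a Kan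
  complex. The next definition is the analogue for horns, that is, for fibrations.\<close>

definition sphere_fill :: "'k sset \<Rightarrow> 'e sset \<Rightarrow> ('k, 'e) over \<Rightarrow> bool" where
  "sphere_fill K E R \<longleftrightarrow> (\<forall>n. \<forall>x\<in>splx K n. \<forall>F.
     smap (sub (std n) (boundary n)) E F \<and>
     (\<forall>m. \<forall>f\<in>boundary n m. R m (act K f x) (F m f)) \<longrightarrow>
     (\<exists>z\<in>splx E n. R n x z \<and> (\<forall>m. \<forall>f\<in>boundary n m. act E f z = F m f)))"

definition horn_fill :: "'k sset \<Rightarrow> 'e sset \<Rightarrow> ('k, 'e) over \<Rightarrow> bool" where
  "horn_fill K E R \<longleftrightarrow> (\<forall>n\<ge>1. \<forall>k\<le>n. \<forall>x\<in>splx K n. \<forall>F.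
     smap (sub (std n) (horn n k)) E F \<and>
     (\<forall>m. \<forall>f\<in>horn n k m. R m (act K f x) (F m f)) \<longrightarrow>
     (\<exists>z\<in>splx E n. R n x z \<and> (\<forall>m. \<forall>f\<in>horn n k m. act E f z = F m f)))"

lemma horn_fillD:
  assumes "horn_fill K E R" "1 \<le> n" "k \<le> n" "x \<in> splx K n"
    "smap (sub (std n) (horn n k)) E F" "\<And>m f. f \<in> horn n k m \<Longrightarrow> R m (act K f x) (F m f)"
  obtains z where "z \<in> splx E n" "R n x z" "\<And>m f. f \<in> horn n k m \<Longrightarrow> act E f z = F m f"
  using assms unfolding horn_fill_def by metis

lemma sphere_fillD:
  assumes "sphere_fill K E R" "x \<in> splx K n"
    "smap (sub (std n) (boundary n)) E F" "\<And>m f. f \<in> boundary n m \<Longrightarrow> R m (act K f x) (F m f)"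
  obtains z where "z \<in> splx E n" "R n x z" "\<And>m f. f \<in> boundary n m \<Longrightarrow> act E f z = F m f"
  using assms unfolding sphere_fill_def by metis

text \<open>Base change of a fibration along \<open>\<phi>\<close>: the total space stays
  \<open>E\<close>, and a lifting problem over \<open>K'\<close> is literally one over
  \<open>K\<close>.\<close>

lemma horn_fill_pullback:
  assumes "horn_fill K E R" "smap K' K \<phi>"
  shows "horn_fill K' E (\<lambda>n x y. R n (\<phi> n x) y)"
  unfolding horn_fill_def
proof (intro allI ballI impI)
  fix n k x F
  assume *: "1 \<le> n" "k \<le> n" "x \<in> splx K' n"
    "smap (sub (std n) (horn n k)) E F \<and> (\<forall>m. \<forall>f\<in>horn n k m. R m (\<phi> m (act K' f x)) (F m f))"
  have "R m (act K f (\<phi> n x)) (F m f)" if "f \<in> horn n k m" for m f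
    using * that smap_act[OF assms(2) horn_dhom *(3)] by metis
  then show "\<exists>z\<in>splx E n. R n (\<phi> n x) z \<and> (\<forall>m. \<forall>f\<in>horn n k m. act E f z = F m f)"
    using horn_fillD[OF assms(1) *(1,2) smap_closed[OF assms(2) *(3)], of F] * by metis
qed

text \<open>\<open>kan\<close> prescribes a horn by its faces, \<open>horn_fill\<close> by a map. A
  simplex of the horn misses some \<open>l \<noteq> k\<close>, so it factors through face
  \<open>l\<close>, and agreement on faces suffices.\<close>

lemma kan_horn_fill:
  assumes "kan L"
  shows "horn_fill K L (\<lambda>_ _ _. True)"
  unfolding horn_fill_def
proof (intro allI ballI impI)
  fix n k x F
  assume n: "1 \<le> n" and k: "k \<le> n" and "smap (sub (std n) (horn n k)) L F \<and> (\<forall>m. \<forall>f\<in>horn n k m. True)"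
  then have F: "smap (sub (std n) (horn n k)) L F" by simp
  obtain n' where n': "n = Suc n'" using n by (cases n) auto
  have L: "is_sset L" using assms by (simp add: kan_def)
  define y where "y i = F n' (coface n' i)" for i
  have cf: "coface n' i \<in> horn n k n'" if "i \<le> n" "i \<noteq> k" for i
    using that by (auto simp: horn_def n' ap_coface intro!: exI[of _ i])
  have y: "y i \<in> splx L n'" if "i \<le> n" "i \<noteq> k" for i
    unfolding y_def using smap_closed[OF F] cf[OF that] by simp
  have "act L (coface (n' - 1) i) (y j) = act L (coface (n' - 1) (j - 1)) (y i)"
    if ij: "i < j" "j \<le> Suc n'" "i \<noteq> k" "j \<noteq> k" for i j
  proof -
    obtain p where p: "n' = Suc p" using ij k n' by (cases n') auto
    have "act L (coface (n' - 1) i) (y j) = F p (dcomp (coface n' j) (coface p i))"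
      using smap_act[OF F, of "coface p i" p n' "coface n' j"] cf[of j] ij n' p by (simp add: y_def)
    also have "\<dots> = F p (dcomp (coface n' i) (coface p (j - 1)))"
      using coface_comp[of i j p] ij p by simp
    also have "\<dots> = act L (coface (n' - 1) (j - 1)) (y i)"
      using smap_act[OF F, of "coface p (j - 1)" p n' "coface n' i"] cf[of i] ij n' p by (simp add: y_def)
    finally show ?thesis .
  qed
  then obtain z where z: "z \<in> splx L n" "\<And>i. i \<le> n \<Longrightarrow> i \<noteq> k \<Longrightarrow> act L (coface n' i) z = y i"
    using assms y k unfolding kan_def n' by metis
  have "act L f z = F m f" if f: "f \<in> horn n k m" for m f
  proof -
    obtain l where l: "l \<le> n" "l \<noteq> k" "\<forall>j\<le>m. ap f j \<noteq> l" using f by (auto simp: horn_def)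
    obtain g where g: "g \<in> dhom m n'" "dcomp (coface n' l) g = f"
      using coface_factor l f n' by (metis horn_dhom)
    have "act L (dcomp (coface n' l) g) z = act L g (act L (coface n' l) z)"
      using act_dcomp[OF L g(1) coface_dhom, of z] z(1) n' by simp
    then have "act L f z = act L g (y l)" using z(2) l g(2) by simp
    also have "\<dots> = F m f" using smap_act[OF F g(1), of "coface n' l"] cf[of l] l g by (simp add: y_def)
    finally show ?thesis .
  qed
  then show "\<exists>z\<in>splx L n. True \<and> (\<forall>m. \<forall>f\<in>horn n k m. act L f z = F m f)" using z by auto
qed

text \<open>A partial lift is stored as its graph: its domain is a subcomplex, extension is
  inclusion, and unions of chains are available to Zorn's lemma.\<close>

definition lift_graph :: "'k sset \<Rightarrow> 'e sset \<Rightarrow> ('k, 'e) over \<Rightarrow> (nat \<times> 'k \<times> 'e) set \<Rightarrow> bool" where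
  "lift_graph K E R G \<longleftrightarrow>
     (\<forall>n x y. (n, x, y) \<in> G \<longrightarrow> x \<in> splx K n \<and> y \<in> splx E n \<and> R n x y) \<and>
     (\<forall>n x y y'. (n, x, y) \<in> G \<and> (n, x, y') \<in> G \<longrightarrow> y = y') \<and>
     (\<forall>m n x y. \<forall>f\<in>dhom m n. (n, x, y) \<in> G \<longrightarrow> (m, act K f x, act E f y) \<in> G)"

lemma lift_graphD:
  assumes "lift_graph K E R G" "(n, x, y) \<in> G"
  shows "x \<in> splx K n" "y \<in> splx E n" "R n x y"
    and "(n, x, y') \<in> G \<Longrightarrow> y' = y"
    and "f \<in> dhom m n \<Longrightarrow> (m, act K f x, act E f y) \<in> G"
  using assms unfolding lift_graph_def by blast+

definition attach :: "'k sset \<Rightarrow> 'e sset \<Rightarrow> nat \<Rightarrow> 'k \<Rightarrow> 'e \<Rightarrow> (nat \<times> 'k \<times> 'e) set" where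
  "attach K E n x z = {(m, act K f x, act E f z) | m f. f \<in> dhom m n}"

text \<open>The last two hypotheses make the attached values well defined: \<open>old\<close> on the
  overlap with the domain of \<open>G\<close>, and \<open>new\<close> outside it, where distinct
  operators have to give distinct simplices.\<close>

lemma attach_lift_graph:
  assumes K: "is_sset K" and E: "is_sset E" and R: "closed_over K E R" and G: "lift_graph K E R G"
    and x: "x \<in> splx K n" and z: "z \<in> splx E n" and xz: "R n x z"
    and old: "\<And>m f w. f \<in> dhom m n \<Longrightarrow> (m, act K f x, w) \<in> G \<Longrightarrow> w = act E f z"
    and new: "\<And>m f g. f \<in> dhom m n \<Longrightarrow> g \<in> dhom m n \<Longrightarrow> act K f x = act K g x \<Longrightarrow>
      (\<And>w. (m, act K f x, w) \<notin> G) \<Longrightarrow> f = g"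
  shows "lift_graph K E R (G \<union> attach K E n x z)"
  unfolding lift_graph_def
proof (intro conjI allI impI ballI)
  fix m a b assume "(m, a, b) \<in> G \<union> attach K E n x z"
  then show "a \<in> splx K m" "b \<in> splx E m" "R m a b"
    using lift_graphD[OF G] act_closed[OF K _ x] act_closed[OF E _ z] R x z xz
    by (auto simp: attach_def closed_over_def)
next
  fix m a b b' assume "(m, a, b) \<in> G \<union> attach K E n x z \<and> (m, a, b') \<in> G \<union> attach K E n x z"
  then have bb: "(m, a, b) \<in> G \<or> (m, a, b) \<in> attach K E n x z"
    "(m, a, b') \<in> G \<or> (m, a, b') \<in> attach K E n x z" by auto
  have old': "w = c" if w: "(m, a, w) \<in> G" and c: "(m, a, c) \<in> attach K E n x z" for w c
  proof -
    obtain f where "f \<in> dhom m n" "a = act K f x" "c = act E f z"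
      using c by (auto simp: attach_def)
    then show ?thesis using old w by blast
  qed
  consider "(m, a, b) \<in> G" "(m, a, b') \<in> G"
    | "(m, a, b) \<in> attach K E n x z" "(m, a, b') \<in> attach K E n x z" "\<forall>w. (m, a, w) \<notin> G"
    | "(m, a, b) \<in> G" "(m, a, b') \<in> attach K E n x z"
    | "(m, a, b') \<in> G" "(m, a, b) \<in> attach K E n x z"
    | "\<exists>w. (m, a, w) \<in> G" "(m, a, b) \<in> attach K E n x z" "(m, a, b') \<in> attach K E n x z"
    using bb by blast
  then show "b = b'"
  proof cases
    case 1
    then show ?thesis using lift_graphD(4)[OF G 1(2)] by simp
  next
    case 2
    obtain f where f: "f \<in> dhom m n" "a = act K f x" "b = act E f z"
      using 2(1) by (auto simp: attach_def)
    obtain g where g: "g \<in> dhom m n" "a = act K g x" "b' = act E g z"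
      using 2(2) by (auto simp: attach_def)
    have "f = g" using new[OF f(1) g(1)] f(2) g(2) 2(3) by blast
    then show ?thesis using f g by simp
  next
    case 3
    then show ?thesis by (rule old')
  next
    case 4
    then show ?thesis by (rule old'[symmetric])
  next
    case 5
    then obtain w where w: "(m, a, w) \<in> G" by blast
    show ?thesis using old'[OF w 5(2)] old'[OF w 5(3)] by simp
  qed
next
  fix l m a b f assume f: "f \<in> dhom l m" and "(m, a, b) \<in> G \<union> attach K E n x z"
  then consider "(m, a, b) \<in> G" | g where "g \<in> dhom m n" "a = act K g x" "b = act E g z"
    by (auto simp: attach_def)
  then show "(l, act K f a, act E f b) \<in> G \<union> attach K E n x z"
  proof cases
    case 1
    then show ?thesis using lift_graphD(5)[OF G 1 f] by simp
  next
    case 2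
    then show ?thesis
      using act_dcomp[OF K f _ x] act_dcomp[OF E f _ z] dcomp_dhom[OF _ f]
      by (auto simp: attach_def intro!: exI[of _ "dcomp g f"])
  qed
qed

lemma lift_graph_smap:
  assumes G: "lift_graph K E R G" and tot: "\<And>n x. x \<in> splx K n \<Longrightarrow> \<exists>y. (n, x, y) \<in> G"
  obtains F where "smap K E F" "\<And>n x. x \<in> splx K n \<Longrightarrow> R n x (F n x)"
    "\<And>n x y. (n, x, y) \<in> G \<Longrightarrow> F n x = y"
proof -
  define F where "F n x = (SOME y. (n, x, y) \<in> G)" for n x
  have F: "(n, x, F n x) \<in> G" if "x \<in> splx K n" for n x
    using someI_ex[OF tot[OF that]] by (simp add: F_def)
  show thesis
  proof (rule that[of F])
    show "smap K E F"
    proof (rule smapI)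
      fix f m n x assume f: "f \<in> dhom m n" and x: "x \<in> splx K n"
      have "(m, act K f x, act E f (F n x)) \<in> G" using lift_graphD(5)[OF G F[OF x] f] .
      then show "F m (act K f x) = act E f (F n x)"
        using lift_graphD(1,4)[OF G] F by metis
    qed (use lift_graphD(2)[OF G F] in auto)
    show "F n x = y" if "(n, x, y) \<in> G" for n x y
      using lift_graphD[OF G that] F by metis
  qed (use lift_graphD(3)[OF G F] in auto)
qed

lemma lift_graph_Union:
  assumes "subset.chain {G. lift_graph K E R G} C" 
  shows "lift_graph K E R (\<Union>C)"
proof -
  have g: "\<And>G. G \<in> C \<Longrightarrow> lift_graph K E R G" using assms by (auto simp: subset.chain_def)
  have c: "G \<subseteq> H \<or> H \<subseteq> G" if "G \<in> C" "H \<in> C" for G H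
    using assms that by (auto simp: subset.chain_def)
  show ?thesis
    unfolding lift_graph_def
  proof (intro conjI allI impI ballI)
    fix n x y y' assume "(n, x, y) \<in> \<Union>C \<and> (n, x, y') \<in> \<Union>C"
    then obtain G H where GH: "G \<in> C" "H \<in> C" "(n, x, y) \<in> G" "(n, x, y') \<in> H" by blast
    then show "y = y'" using c[OF GH(1,2)] lift_graphD(4)[OF g] by blast
  next
    fix m n x y f assume "f \<in> dhom m n" "(n, x, y) \<in> \<Union>C"
    then show "(m, act K f x, act E f y) \<in> \<Union>C" using lift_graphD(5)[OF g] by blast
  qed (use lift_graphD(1-3)[OF g] in blast)+
qed

text \<open>\<open>P\<close> is an invariant of partial lifts that must survive unions and one-step
  extensions. It is trivial for spheres and \<open>closer_closed\<close> for prisms.\<close>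

lemma lift_zorn:
  assumes G0: "lift_graph K E R G0" "P G0"
    and un: "\<And>C. C \<noteq> {} \<Longrightarrow> (\<And>G. G \<in> C \<Longrightarrow> P G) \<Longrightarrow> P (\<Union>C)"
    and step: "\<And>G n x. lift_graph K E R G \<Longrightarrow> P G \<Longrightarrow> G0 \<subseteq> G \<Longrightarrow> x \<in> splx K n \<Longrightarrow>
      (\<And>y. (n, x, y) \<notin> G) \<Longrightarrow> \<exists>G'. lift_graph K E R G' \<and> P G' \<and> G \<subset> G'"
  obtains F where "smap K E F" "\<And>n x. x \<in> splx K n \<Longrightarrow> R n x (F n x)"
    "\<And>n x y. (n, x, y) \<in> G0 \<Longrightarrow> F n x = y"
proof -
  let ?S = "{G. lift_graph K E R G \<and> P G \<and> G0 \<subseteq> G}"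
  have "\<exists>M\<in>?S. \<forall>X\<in>?S. M \<subseteq> X \<longrightarrow> X = M"
  proof (rule subset_Zorn_nonempty)
    show "?S \<noteq> {}" using G0 by blast
    fix C assume C: "C \<noteq> {}" "subset.chain ?S C"
    then have "subset.chain {G. lift_graph K E R G} C" by (auto simp: subset.chain_def)
    then have "lift_graph K E R (\<Union>C)" by (rule lift_graph_Union)
    moreover have "P (\<Union>C)" using C by (intro un) (auto simp: subset.chain_def)
    moreover have "G0 \<subseteq> \<Union>C" using C by (fastforce simp: subset.chain_def)
    ultimately show "\<Union>C \<in> ?S" by blast
  qed
  then obtain M where MS: "M \<in> ?S" and max': "\<forall>X\<in>?S. M \<subseteq> X \<longrightarrow> X = M" ..
  have M: "lift_graph K E R M" "P M" "G0 \<subseteq> M" using MS by auto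
  have max: "X = M" if "lift_graph K E R X" "P X" "M \<subseteq> X" for X
  proof -
    have "X \<in> ?S" using that M(3) by auto
    then show ?thesis using max' that(3) by simp
  qed
  have tot: "\<exists>y. (n, x, y) \<in> M" if "x \<in> splx K n" for n x
  proof (rule ccontr)
    assume "\<not> ?thesis"
    then obtain G' where "lift_graph K E R G'" "P G'" "M \<subset> G'"
      using step[OF M \<open>x \<in> splx K n\<close>] by auto
    then show False using max[of G'] by blast
  qed
  show thesis by (rule lift_graph_smap[OF M(1) tot]) (use that M(3) in \<open>simp_all add: subset_iff\<close>)
qed

lemma smap_lift_graph:
  assumes "smap (sub K A) E F" "subcomplex K A" "\<And>n x. x \<in> A n \<Longrightarrow> R n x (F n x)"
  shows "lift_graph K E R {(n, x, F n x) | n x. x \<in> A n}"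
  using assms smap_closed[OF assms(1)] smap_act[OF assms(1)]
  unfolding lift_graph_def subcomplex_def by auto

text \<open>A missing simplex of least dimension has its whole boundary in the domain, so attaching
  it is exactly filling a sphere.\<close>

theorem sphere_fill_extension:
  assumes K: "is_sset K" and E: "is_sset E" and R: "closed_over K E R" and fill: "sphere_fill K E R"
    and A: "subcomplex K A" and F: "smap (sub K A) E F" "\<And>n x. x \<in> A n \<Longrightarrow> R n x (F n x)"
  obtains F' where "smap K E F'" "\<And>n x. x \<in> splx K n \<Longrightarrow> R n x (F' n x)"
    "\<And>n x. x \<in> A n \<Longrightarrow> F' n x = F n x"
proof -
  let ?G0 = "{(n, x, F n x) | n x. x \<in> A n}"
  have G0: "lift_graph K E R ?G0" by (rule smap_lift_graph[OF F(1) A]) (rule F(2))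
  have step: "\<exists>G'. lift_graph K E R G' \<and> True \<and> G \<subset> G'"
    if G: "lift_graph K E R G" and ex: "x0 \<in> splx K n0" "\<And>y. (n0, x0, y) \<notin> G" for G n0 x0
  proof -
    let ?P = "\<lambda>n. \<exists>x\<in>splx K n. \<forall>y. (n, x, y) \<notin> G"
    define n where "n = (LEAST n. ?P n)"
    have "?P n" unfolding n_def by (rule LeastI_ex) (use ex in blast)
    then obtain x where x: "x \<in> splx K n" "\<And>y. (n, x, y) \<notin> G" by blast
    have less: "\<exists>y. (m, a, y) \<in> G" if "m < n" "a \<in> splx K m" for m a
      using not_less_Least[of m ?P] that unfolding n_def by blast
    have bd: "\<exists>y. (m, act K f x, y) \<in> G" if f: "f \<in> boundary n m" for m f
    proof -
      obtain l where l: "l \<le> n" "\<forall>j\<le>m. ap f j \<noteq> l" using f by (auto simp: boundary_def)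
      have "n \<noteq> 0" using l ap_le[OF boundary_dhom[OF f], of 0] by (metis le_0_eq le0)
      then obtain p where p: "n = Suc p" by (cases n) auto
      obtain g where g: "g \<in> dhom m p" "dcomp (coface p l) g = f"
        using coface_factor[of f m p l] l boundary_dhom[OF f] p by metis
      obtain y where "(p, act K (coface p l) x, y) \<in> G"
        using less[of p "act K (coface p l) x"] act_closed[OF K coface_dhom] x p by auto
      then have "(m, act K g (act K (coface p l) x), act E g y) \<in> G"
        using lift_graphD(5)[OF G _ g(1)] by blast
      then show ?thesis using act_dcomp[OF K g(1) coface_dhom, of x l] x p g by auto
    qed
    define h where "h m f = (SOME y. (m, act K f x, y) \<in> G)" for m f
    have h: "(m, act K f x, h m f) \<in> G" if "f \<in> boundary n m" for m f
      using someI_ex[OF bd[OF that]] by (simp add: h_def)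
    have hs: "smap (sub (std n) (boundary n)) E h"
    proof (rule smapI)
      fix f l m g assume f: "f \<in> dhom l m" and "g \<in> splx (sub (std n) (boundary n)) m"
      then have g: "g \<in> boundary n m" by simp
      have "(l, act K f (act K g x), act E f (h m g)) \<in> G" using lift_graphD(5)[OF G h[OF g] f] .
      then have "(l, act K (dcomp g f) x, act E f (h m g)) \<in> G"
        using act_dcomp[OF K f boundary_dhom[OF g] x(1)] by simp
      then show "h l (act (sub (std n) (boundary n)) f g) = act E f (h m g)"
        using lift_graphD(4)[OF G] h[OF boundary_dcomp[OF g f]] by auto
    qed (use lift_graphD(2)[OF G h] in auto)
    obtain z where z: "z \<in> splx E n" "R n x z" "\<And>m f. f \<in> boundary n m \<Longrightarrow> act E f z = h m f"
      using sphere_fillD[OF fill x(1) hs] lift_graphD(3)[OF G h] by blast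
    \<comment> \<open>An operator outside the boundary is surjective, hence has a section, and
      applying the section to \<open>act K f x\<close> would recover the missing \<open>x\<close>.
      So the overlap with the old domain is the boundary only.\<close>
    have sur: "f \<in> boundary n m" if f: "f \<in> dhom m n" and w: "(m, act K f x, w) \<in> G" for m f w
    proof (rule ccontr)
      assume "f \<notin> boundary n m"
      then have "\<And>i. i \<le> n \<Longrightarrow> \<exists>j\<le>m. ap f j = i" using f by (auto simp: boundary_def)
      then obtain s where s: "s \<in> dhom n m" "dcomp f s = did n" using dfactor[OF f did_dhom] by auto
      have "(n, act K s (act K f x), act E s w) \<in> G" using lift_graphD(5)[OF G w s(1)] .
      then show False using x act_dcomp[OF K s(1) f x(1)] act_did[OF K x(1)] s by simp
    qed
    have "lift_graph K E R (G \<union> attach K E n x z)"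
    proof (rule attach_lift_graph[OF K E R G x(1) z(1,2)])
      show "w = act E f z" if f: "f \<in> dhom m n" and w: "(m, act K f x, w) \<in> G" for m f w
        using z(3)[OF sur[OF f w]] lift_graphD(4)[OF G w h[OF sur[OF f w]]] by simp
      \<comment> \<open>If \<open>f\<close> and \<open>g\<close> differed, \<open>x\<close> would be
        its own image under a boundary operator, and such images are already in the domain.\<close>
      show "f = g" if f: "f \<in> dhom m n" and g: "g \<in> dhom m n" and eq: "act K f x = act K g x"
        and no: "\<And>w. (m, act K f x, w) \<notin> G" for m f g
      proof (rule ccontr)
        assume ne: "f \<noteq> g"
        have "f \<notin> boundary n m" using bd no by blast
        then have "\<And>i. i \<le> n \<Longrightarrow> \<exists>j\<le>m. ap f j = i" using f by (auto simp: boundary_def)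
        then obtain s where s: "s \<in> dhom n m" "dcomp f s = did n" "\<exists>i\<le>n. \<forall>j\<le>n. ap (dcomp g s) j \<noteq> i"
          using surjection_separation[OF f g ne] by metis
        have "dcomp g s \<in> boundary n n" using s dcomp_dhom[OF g s(1)] by (auto simp: boundary_def)
        moreover have "act K (dcomp g s) x = x"
          using act_dcomp[OF K s(1) f x(1)] act_dcomp[OF K s(1) g x(1)] eq s act_did[OF K x(1)] by simp
        ultimately show False using bd x(2) by metis
      qed
    qed
    moreover have "(n, x, z) \<in> attach K E n x z"
      unfolding attach_def using act_did[OF K x(1)] act_did[OF E z(1)]
      by (auto intro!: exI[of _ "did n"])
    ultimately show ?thesis using x(2) by (intro exI[of _ "G \<union> attach K E n x z"]) blast
  qed
  obtain F' where F': "smap K E F'" "\<And>n x. x \<in> splx K n \<Longrightarrow> R n x (F' n x)"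
    "\<And>n x y. (n, x, y) \<in> ?G0 \<Longrightarrow> F' n x = y"
    by (rule lift_zorn[OF G0, of "\<lambda>_. True"]) (use step in auto)
  show thesis by (rule that[OF F'(1,2)]) (use F'(3) in auto)
qed

text \<open>Keeps the literal \<open>1\<close> in terms such as \<open>dhom n 1\<close> and
  \<open>dconst n 1 j\<close>, so that rules stated with it still match after
  simplification.\<close>

declare One_nat_def [simp del]

section \<open>Homotopy extension\<close>

text \<open>The partial lifts below are kept closed under moving the \<open>[1]\<close>-component towards the end \<open>e\<close>.
  This invariant guarantees that every attached prism piece meets the earlier ones in a horn.\<close>

definition closer :: "nat \<Rightarrow> dmap \<Rightarrow> dmap \<Rightarrow> bool" where
  "closer e s t \<longleftrightarrow> (\<forall>i\<le>src t. ap s i = ap t i \<or> ap s i = e)"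

definition step :: "nat \<Rightarrow> nat \<Rightarrow> dmap" where
  "step n i = mk_dmap n 1 (\<lambda>l. if i \<le> l then 1 else 0)"

lemma step_dhom [simp]: "step n i \<in> dhom n 1"
  unfolding step_def by (rule mk_dmap_dhom) auto

lemma ap_step: "l \<le> n \<Longrightarrow> ap (step n i) l = (if i \<le> l then 1 else 0)"
  by (simp add: step_def)

lemma ap_dhom_1: "t \<in> dhom n 1 \<Longrightarrow> i \<le> n \<Longrightarrow> ap t i = 0 \<or> ap t i = 1"
  using ap_le[of t n 1 i] by linarith

lemma dhom_1_step:
  assumes t: "t \<in> dhom n 1"
  obtains i where "i \<le> Suc n" "t = step n i"
proof -
  define i where "i = (LEAST l. l = Suc n \<or> (l \<le> n \<and> ap t l = 1))"
  have i: "i = Suc n \<or> (i \<le> n \<and> ap t i = 1)" unfolding i_def by (rule LeastI[of _ "Suc n"]) simp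
  have less: "ap t l = 0" if "l < i" "l \<le> n" for l
    using not_less_Least[of l "\<lambda>l. l = Suc n \<or> (l \<le> n \<and> ap t l = 1)"] that ap_dhom_1[OF t, of l]
    unfolding i_def by auto
  have "t = step n i"
  proof (rule dhom_eqI[OF t step_dhom])
    fix l assume l: "l \<le> n"
    show "ap t l = ap (step n i) l"
    proof (cases "i \<le> l")
      case True
      then have "1 \<le> ap t l" using i l ap_mono[OF t, of i l] by auto
      then show ?thesis using ap_dhom_1[OF t l] True l by (auto simp: ap_step)
    qed (use less l in \<open>auto simp: ap_step\<close>)
  qed
  then show thesis using that[of i] i by auto
qed

lemma step_0: "step n 0 = dconst n 1 1"
  by (rule dhom_eqI[of _ n 1]) (auto simp: ap_step)

lemma step_Suc: "step n (Suc n) = dconst n 1 0"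
  by (rule dhom_eqI[of _ n 1]) (auto simp: ap_step)

text \<open>The prism over an \<open>n\<close>-simplex contains, for \<open>i \<le> n\<close>, the \<open>(n+1)\<close>-simplex with components
  \<open>codegeneracy n i\<close> and \<open>step (n + 1) (i + 1)\<close>, whose faces \<open>i\<close> and \<open>i + 1\<close> are the sections
  \<open>step n i\<close> and \<open>step n (i + 1)\<close> of the prism.\<close>

lemma codegeneracy_coface:
  assumes "i \<le> n" "j = i \<or> j = Suc i"
  shows "dcomp (codegeneracy n i) (coface n j) = did n"
  by (rule dhom_eqI[of _ n n])
    (use assms in \<open>auto intro!: dcomp_dhom[OF codegeneracy_dhom coface_dhom]
      simp: ap_dcomp[OF coface_dhom] ap_coface ap_codegeneracy\<close>)

lemma step_coface:
  assumes "i \<le> n" "j = i \<or> j = Suc i"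
  shows "dcomp (step (Suc n) (Suc i)) (coface n j) = step n j"
  by (rule dhom_eqI[of _ n 1])
    (use assms in \<open>auto intro!: dcomp_dhom[OF step_dhom coface_dhom]
      simp: ap_dcomp[OF coface_dhom] ap_coface ap_step\<close>)

text \<open>The codegeneracy identifies only \<open>i\<close> and \<open>i + 1\<close>, and the step
  separates these two; so the prism simplex is injective on vertices.\<close>

lemma codegeneracy_step_inject:
  assumes f: "f \<in> dhom m (Suc n)" and g: "g \<in> dhom m (Suc n)" and i: "i \<le> n"
    and eq: "dcomp (codegeneracy n i) f = dcomp (codegeneracy n i) g"
      "dcomp (step (Suc n) (Suc i)) f = dcomp (step (Suc n) (Suc i)) g"
  shows "f = g"
proof (rule dhom_eqI[OF f g])
  fix l assume l: "l \<le> m"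
  have "(if ap f l \<le> i then ap f l else ap f l - 1) = (if ap g l \<le> i then ap g l else ap g l - 1)"
    using arg_cong[OF eq(1), of "\<lambda>h. ap h l"] ap_le[OF f l] ap_le[OF g l] l
    by (simp add: ap_dcomp[OF f] ap_dcomp[OF g] ap_codegeneracy)
  moreover have "(if Suc i \<le> ap f l then 1 else 0 :: nat) = (if Suc i \<le> ap g l then 1 else 0)"
    using arg_cong[OF eq(2), of "\<lambda>h. ap h l"] ap_le[OF f l] ap_le[OF g l] l
    by (simp only: ap_dcomp[OF f] ap_dcomp[OF g] ap_step)
  ultimately show "ap f l = ap g l"
    by (cases "Suc i \<le> ap f l"; cases "Suc i \<le> ap g l") simp_all
qed

text \<open>\<open>g\<close> agrees with \<open>f\<close> away from the vertices \<open>i\<close>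
  and \<open>i + 1\<close>, between which \<open>s\<close> now chooses. The point \<open>l0\<close>
  where the second comparison fails pins down \<open>s\<close> on one side of this pair by
  monotonicity; on the other side closeness to \<open>f\<close> does.\<close>

lemma closer_step:
  assumes f: "f \<in> dhom m (Suc n)" and i: "i \<le> n" and e: "e \<le> 1" and s: "s \<in> dhom m 1"
    and cl: "closer e s (dcomp (step (Suc n) (Suc i)) f)"
    and no: "\<not> closer e s (dcomp (step n (i + 1 - e)) (dcomp (codegeneracy n i) f))"
  obtains g where "g \<in> dhom m (Suc n)" "dcomp (codegeneracy n i) g = dcomp (codegeneracy n i) f"
    "dcomp (step (Suc n) (Suc i)) g = s"
proof
  let ?v = "\<lambda>l. if ap f l = i \<or> ap f l = Suc i then i + ap s l else ap f l"
  define g where "g = mk_dmap m (Suc n) ?v"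
  have cf: "dcomp (codegeneracy n i) f \<in> dhom m n" using dcomp_dhom[OF codegeneracy_dhom f] i by simp
  have sl: "ap s l = 0 \<or> ap s l = 1" if "l \<le> m" for l using ap_dhom_1[OF s that] .
  have cl': "ap s l = (if Suc i \<le> ap f l then 1 else 0) \<or> ap s l = e" if "l \<le> m" for l
    using cl that ap_le[OF f that] dhomD(2)[OF f]
    by (auto simp: closer_def ap_dcomp[OF f] ap_step)
  obtain l0 where l0: "l0 \<le> m" "ap s l0 \<noteq> e"
    "ap s l0 \<noteq> (if i + 1 - e \<le> (if ap f l0 \<le> i then ap f l0 else ap f l0 - 1) then 1 else 0)"
    using no ap_le[OF f] ap_le[OF cf] dhomD(2)[OF f]
    by (auto simp: closer_def ap_dcomp[OF f] ap_dcomp[OF cf] ap_codegeneracy ap_step)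
  have g_dhom: "g \<in> dhom m (Suc n)"
    unfolding g_def
  proof (rule mk_dmap_dhom)
    fix l assume l: "l \<le> m"
    show "?v l \<le> Suc n" using ap_le[OF f l] sl[OF l] i by auto
    fix l' assume ll: "l' \<le> l"
    then show "?v l' \<le> ?v l"
      using ap_mono[OF f ll l] ap_mono[OF s ll l] sl[OF l] sl[of l'] l by auto
  qed
  then show "g \<in> dhom m (Suc n)" .
  have apg: "ap g l = ?v l" if "l \<le> m" for l using that by (simp add: g_def)
  show "dcomp (codegeneracy n i) g = dcomp (codegeneracy n i) f"
  proof (rule dhom_eqI[OF dcomp_dhom[OF codegeneracy_dhom[OF i] g_dhom] cf])
    fix l assume l: "l \<le> m"
    then show "ap (dcomp (codegeneracy n i) g) l = ap (dcomp (codegeneracy n i) f) l"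
      using ap_le[OF f l] sl[OF l] i
      by (auto simp: ap_dcomp[OF f] ap_dcomp[OF g_dhom] ap_codegeneracy apg)
  qed
  show "dcomp (step (Suc n) (Suc i)) g = s"
  proof (rule dhom_eqI[OF dcomp_dhom[OF step_dhom g_dhom] s])
    fix l assume l: "l \<le> m"
    have gl: "ap g l \<le> Suc n" using ap_le[OF g_dhom l] .
    have "(Suc i \<le> ap g l) = (ap s l = 1)"
    proof (cases "ap f l = i \<or> ap f l = Suc i")
      case True
      then show ?thesis using apg[OF l] sl[OF l] by auto
    next
      case False
      then consider "ap f l < i" | "Suc i < ap f l" by linarith
      then show ?thesis
      proof cases
        case 1
        have "ap s l = 0"
        proof (cases "e = 1")
          case True
          then have "ap s l0 = 0" "i \<le> ap f l0" using l0 sl[of l0] by (auto split: if_splits)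
          then have "l \<le> l0" using 1 ap_mono[OF f, of l0 l] l by (cases "l \<le> l0") auto
          then show ?thesis using ap_mono[OF s _ l0(1)] \<open>ap s l0 = 0\<close> by fastforce
        next
          case False
          then show ?thesis using e cl'[OF l] 1 by auto
        qed
        then show ?thesis using apg[OF l] 1 by auto
      next
        case 2
        have "ap s l = 1"
        proof (cases "e = 0")
          case True
          then have "ap s l0 = 1" "ap f l0 \<le> Suc i" using l0 sl[of l0] by (auto split: if_splits)
          then have "l0 \<le> l" using 2 ap_mono[OF f, of l l0] l0 by (cases "l0 \<le> l") auto
          then have "1 \<le> ap s l" using ap_mono[OF s _ l] \<open>ap s l0 = 1\<close> by fastforce
          then show ?thesis using sl[OF l] by auto
        next
          case False
          then show ?thesis using e cl'[OF l] 2 by auto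
        qed
        then show ?thesis using apg[OF l] 2 by auto
      qed
    qed
    then show "ap (dcomp (step (Suc n) (Suc i)) g) l = ap s l"
      using gl l sl[OF l] by (auto simp: ap_dcomp[OF g_dhom] ap_step)
  qed
qed

text \<open>A discrete intermediate value argument. It starts from the threshold whose section is
  constant \<open>e\<close>, that is \<open>n + 1\<close> for \<open>e = 0\<close> and
  \<open>0\<close> for \<open>e = 1\<close>; the indices \<open>i + 1 - e\<close> and
  \<open>i + e\<close> treat both directions of travel at once.\<close>

lemma crossing:
  fixes P :: "nat \<Rightarrow> bool"
  assumes "e \<le> 1" "P (if e = 0 then Suc n else 0)" "\<not> P j" "j \<le> Suc n"
  obtains i where "i \<le> n" "P (i + 1 - e)" "\<not> P (i + e)"
proof (cases "e = 0")
  case True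
  have "\<exists>i. j \<le> i \<and> i \<le> n \<and> \<not> P i \<and> P (Suc i)"
  proof (rule ccontr)
    assume no: "\<not> ?thesis"
    have "\<not> P (j + d)" if "j + d \<le> Suc n" for d
      using that
    proof (induction d)
      case (Suc d)
      then show ?case using no[simplified, rule_format, of "j + d"] by auto
    qed (use assms in simp)
    from this[of "Suc n - j"] show False using assms True by auto
  qed
  then obtain i where "i \<le> n" "\<not> P i" "P (Suc i)" by blast
  then show thesis using that[of i] True by (simp flip: Suc_eq_plus1)
next
  case False
  then have e: "e = 1" using assms by simp
  have "\<exists>i. i < j \<and> P i \<and> \<not> P (Suc i)"
  proof (rule ccontr)
    assume no: "\<not> ?thesis"
    have "P d" if "d \<le> j" for d
      using that by (induction d) (use assms no e in auto)
    then show False using assms by auto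
  qed
  then obtain i where "i < j" "P i" "\<not> P (Suc i)" by blast
  then show thesis using that[of i] e assms by (simp flip: Suc_eq_plus1)
qed

definition closer_closed :: "nat \<Rightarrow> (nat \<times> ('s \<times> dmap) \<times> 'e) set \<Rightarrow> bool" where
  "closer_closed e G \<longleftrightarrow> (\<forall>n x t s y. (n, (x, t), y) \<in> G \<and> s \<in> dhom n 1 \<and> closer e s t \<longrightarrow>
     (\<exists>y'. (n, (x, s), y') \<in> G))"

text \<open>The missing simplices of least dimension in the \<open>S\<close>-direction are attached along horns,
  working through the prism away from the end \<open>e\<close>.\<close>

lemma prism_step:
  fixes S :: "'s sset" and E :: "'e sset"
  assumes S: "is_sset S" and E: "is_sset E" and R: "closed_over (sprod S (std 1)) E R"
    and fill: "horn_fill (sprod S (std 1)) E R" and e: "e \<le> 1"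
    and G: "lift_graph (sprod S (std 1)) E R G" and cc: "closer_closed e G"
    and base: "\<And>n x. x \<in> splx S n \<Longrightarrow> \<exists>y. (n, (x, dconst n 1 e), y) \<in> G"
    and ex: "x0 \<in> splx S n0" "t0 \<in> dhom n0 1" "\<And>y. (n0, (x0, t0), y) \<notin> G"
  shows "\<exists>G'. lift_graph (sprod S (std 1)) E R G' \<and> closer_closed e G' \<and> G \<subset> G'"
proof -
  let ?K = "sprod S (std 1)"
  have K: "is_sset ?K" using S is_sset_std by (rule is_sset_sprod)
  define D where "D n x t \<longleftrightarrow> (\<exists>y. (n, (x, t), y) \<in> G)" for n x t
  have D_act: "D m (act S f x) (dcomp t f)" if "D n x t" "f \<in> dhom m n" for m n f x t
    using that lift_graphD(5)[OF G _ that(2)] unfolding D_def by fastforce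
  let ?P = "\<lambda>n. \<exists>x\<in>splx S n. \<exists>t\<in>dhom n 1. \<not> D n x t"
  \<comment> \<open>Minimality concerns the \<open>S\<close>-component: below dimension
    \<open>n\<close> every pair is in the domain, whatever its second component.\<close>
  define n where "n = (LEAST n. ?P n)"
  have "?P n" unfolding n_def by (rule LeastI_ex) (use ex in \<open>auto simp: D_def\<close>)
  then obtain x t where x: "x \<in> splx S n" and t: "t \<in> dhom n 1" "\<not> D n x t" by blast
  have less: "D m a t" if "m < n" "a \<in> splx S m" "t \<in> dhom m 1" for m a t
    using not_less_Least[of m ?P] that unfolding n_def by blast
  have G_closer: "D m a s" if "D m a u" "s \<in> dhom m 1" "closer e s u" for m a u s
    using that cc unfolding D_def closer_closed_def by metis
  \<comment> \<open>Every \<open>u\<close> is closer to \<open>e\<close> than the constant at the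
    opposite end, so one pair at that far end brings in all pairs over the images of the same
    simplex.\<close>
  have D_top: "D m (act S f a) u"
    if a: "D p a (dconst p 1 (1 - e))" and f: "f \<in> dhom m p" and u: "u \<in> dhom m 1" for m p a f u
  proof (rule G_closer[OF D_act[OF a f] u])
    show "closer e u (dcomp (dconst p 1 (1 - e)) f)"
      unfolding closer_def dcomp_dconst_left[OF f diff_le_self]
    proof (intro allI impI)
      fix l assume "l \<le> src (dconst m 1 (1 - e))"
      then have l: "l \<le> m" by simp
      show "ap u l = ap (dconst m 1 (1 - e)) l \<or> ap u l = e"
        using ap_dhom_1[OF u l] e l by (simp, linarith)
    qed
  qed
  have lowdim: "D m (act S f x) u" if f: "f \<in> boundary n m" and u: "u \<in> dhom m 1" for m f u
  proof -
    obtain l where l: "l \<le> n" "\<forall>j\<le>m. ap f j \<noteq> l" using f by (auto simp: boundary_def)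
    have "n \<noteq> 0" using l ap_le[OF boundary_dhom[OF f], of 0] by (metis le_0_eq le0)
    then obtain p where p: "n = Suc p" by (cases n) auto
    obtain g where g: "g \<in> dhom m p" "dcomp (coface p l) g = f"
      using coface_factor[of f m p l] l boundary_dhom[OF f] p by metis
    have "D p (act S (coface p l) x) (dconst p 1 (1 - e))"
      using less[of p] act_closed[OF S coface_dhom] x p by auto
    from D_top[OF this g(1) u] show ?thesis
      using act_dcomp[OF S g(1) coface_dhom, of x l] x p g by simp
  qed
  obtain j where j: "j \<le> Suc n" "t = step n j" using dhom_1_step[OF t(1)] .
  have "D n x (step n (if e = 0 then Suc n else 0))"
  proof (cases "e = 0")
    case False
    then have "e = 1" using e by simp
    then show ?thesis using base[OF x] by (simp add: D_def step_0)
  qed (use base[OF x] in \<open>simp add: D_def step_Suc\<close>)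
  \<comment> \<open>Sections \<open>i + 1 - e\<close> and \<open>i + e\<close> are two faces of
    prism simplex number \<open>i\<close>. The first is known and the second missing, so the second
    becomes the free face \<open>k\<close> of a horn.\<close>
  then obtain i where i: "i \<le> n" "D n x (step n (i + 1 - e))" "\<not> D n x (step n (i + e))"
    using crossing[of e "\<lambda>j. D n x (step n j)" n j] e t(2) j by blast
  define k where "k = i + e"
  define x' where "x' = act S (codegeneracy n i) x"
  define u where "u = step (Suc n) (Suc i)"
  have k: "k = i \<or> k = Suc i" using e by (auto simp: k_def le_Suc_eq)
  have \<sigma>: "codegeneracy n i \<in> dhom (Suc n) n" using i by simp
  have x': "x' \<in> splx S (Suc n)" unfolding x'_def by (rule act_closed[OF S \<sigma> x])
  have u: "u \<in> dhom (Suc n) 1" by (simp add: u_def)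
  have x'_act: "act S f x' = act S (dcomp (codegeneracy n i) f) x" if "f \<in> dhom m (Suc n)" for m f
    unfolding x'_def using act_dcomp[OF S that \<sigma> x] by simp
  have coface_x': "act S (coface n l) x' = x" "dcomp u (coface n l) = step n l"
    if "l = i \<or> l = Suc i" for l
    using x'_act[OF coface_dhom, of l] codegeneracy_coface[OF i(1) that] act_did[OF S x]
      step_coface[OF i(1) that] by (simp_all add: u_def)
  \<comment> \<open>Of the faces other than \<open>k\<close>, one is the known section; the others
    project into the boundary of \<open>x\<close>, where \<open>lowdim\<close> applies.\<close>
  have horn_D: "D m (act S f x') (dcomp u f)" if f: "f \<in> horn (Suc n) k m" for m f
  proof -
    obtain l where l: "l \<le> Suc n" "l \<noteq> k" "\<forall>j\<le>m. ap f j \<noteq> l" using f by (auto simp: horn_def)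
    show ?thesis
    proof (cases "l = i \<or> l = Suc i")
      case True
      then have l': "l = i + 1 - e" using l e by (auto simp: k_def le_Suc_eq)
      obtain g where g: "g \<in> dhom m n" "dcomp (coface n l) g = f"
        using coface_factor[OF horn_dhom[OF f] l(1,3)] .
      have "D m (act S g (act S (coface n l) x')) (dcomp (dcomp u (coface n l)) g)"
        using D_act[OF _ g(1)] coface_x'[OF True] i(2) l' by simp
      then show ?thesis
        using act_dcomp[OF S g(1) coface_dhom x', of l] dcomp_assoc[OF g(1) coface_dhom u, of l] g(2) by simp
    next
      case False
      have f': "f \<in> dhom m (Suc n)" using horn_dhom[OF f] .
      have "dcomp (codegeneracy n i) f \<in> boundary n m"
        unfolding boundary_def
      proof (intro CollectI conjI exI)
        show "dcomp (codegeneracy n i) f \<in> dhom m n" using dcomp_dhom[OF \<sigma> f'] .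
        let ?l = "if l < i then l else l - 1"
        show "?l \<le> n" using l i by auto
        show "\<forall>j\<le>m. ap (dcomp (codegeneracy n i) f) j \<noteq> ?l"
        proof (intro allI impI)
          fix j assume j: "j \<le> m"
          then have "ap f j \<noteq> l" "ap f j \<le> Suc n" using l ap_le[OF f'] by auto
          then show "ap (dcomp (codegeneracy n i) f) j \<noteq> ?l"
            using False j by (simp add: ap_dcomp[OF f'] ap_codegeneracy) linarith
        qed
      qed
      from lowdim[OF this dcomp_dhom[OF u f']] show ?thesis using x'_act[OF f'] by simp
    qed
  qed
  define h where "h m f = (SOME w. (m, (act S f x', dcomp u f), w) \<in> G)" for m f
  have h: "(m, (act S f x', dcomp u f), h m f) \<in> G" if "f \<in> horn (Suc n) k m" for m f
    using someI_ex[OF horn_D[OF that, unfolded D_def]] by (simp add: h_def)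
  have hs: "smap (sub (std (Suc n)) (horn (Suc n) k)) E h"
  proof (rule smapI)
    fix f l m g assume f: "f \<in> dhom l m" and "g \<in> splx (sub (std (Suc n)) (horn (Suc n) k)) m"
    then have g: "g \<in> horn (Suc n) k m" by simp
    have "(l, act ?K f (act S g x', dcomp u g), act E f (h m g)) \<in> G" using lift_graphD(5)[OF G h[OF g] f] .
    then have "(l, (act S (dcomp g f) x', dcomp u (dcomp g f)), act E f (h m g)) \<in> G"
      using act_dcomp[OF S f horn_dhom[OF g] x'] dcomp_assoc[OF f horn_dhom[OF g] u] by simp
    then show "h l (act (sub (std (Suc n)) (horn (Suc n) k)) f g) = act E f (h m g)"
      using lift_graphD(4)[OF G] h[OF horn_dcomp[OF g f]] by auto
  qed (use lift_graphD(2)[OF G h] in auto)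
  have y: "(x', u) \<in> splx ?K (Suc n)" using x' u by simp
  have kn: "k \<le> Suc n" using k i by auto
  have "\<And>m f. f \<in> horn (Suc n) k m \<Longrightarrow> R m (act ?K f (x', u)) (h m f)"
    using lift_graphD(3)[OF G h] by simp
  then obtain z where z: "z \<in> splx E (Suc n)" "R (Suc n) (x', u) z"
    "\<And>m f. f \<in> horn (Suc n) k m \<Longrightarrow> act E f z = h m f"
    using horn_fillD[OF fill _ kn y hs] by (metis le_add1 plus_1_eq_Suc)
  \<comment> \<open>An operator outside the horn hits every vertex except possibly \<open>k\<close>,
    so face \<open>k\<close> factors through it; a value there would supply the missing
    section.\<close>
  have in_horn: "f \<in> horn (Suc n) k m"
    if f: "f \<in> dhom m (Suc n)" and D: "D m (act S f x') (dcomp u f)" for m f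
  proof (rule ccontr)
    assume "f \<notin> horn (Suc n) k m"
    then have "\<exists>j\<le>m. ap f j = l" if "l \<le> Suc n" "l \<noteq> k" for l using f that by (auto simp: horn_def)
    then have "\<exists>j\<le>m. ap f j = ap (coface n k) l" if "l \<le> n" for l
      using that by (auto simp: ap_coface)
    then obtain s where s: "s \<in> dhom n m" "dcomp f s = coface n k" using dfactor[OF f coface_dhom] by blast
    have "D n (act S s (act S f x')) (dcomp (dcomp u f) s)" using D_act[OF D s(1)] .
    then show False
      using act_dcomp[OF S s(1) f x'] dcomp_assoc[OF s(1) f u] s(2) coface_x'[OF k] i(3)
      by (simp add: k_def)
  qed
  let ?G = "G \<union> attach ?K E (Suc n) (x', u) z"
  have "lift_graph ?K E R ?G"
  proof (rule attach_lift_graph[OF K E R G y z(1,2)])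
    show "w = act E f z" if f: "f \<in> dhom m (Suc n)" and w: "(m, act ?K f (x', u), w) \<in> G" for m f w
    proof -
      have w': "(m, (act S f x', dcomp u f), w) \<in> G" using w by simp
      have f': "f \<in> horn (Suc n) k m" using in_horn[OF f] w' by (auto simp: D_def)
      show ?thesis using z(3)[OF f'] lift_graphD(4)[OF G w' h[OF f']] by simp
    qed
    show "f = g" if f: "f \<in> dhom m (Suc n)" and g: "g \<in> dhom m (Suc n)"
      and eq: "act ?K f (x', u) = act ?K g (x', u)" and no: "\<And>w. (m, act ?K f (x', u), w) \<notin> G" for m f g
    proof -
      let ?f = "dcomp (codegeneracy n i) f" and ?g = "dcomp (codegeneracy n i) g"
      have f': "?f \<in> dhom m n" and g': "?g \<in> dhom m n" using dcomp_dhom[OF \<sigma>] f g by auto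
      have eq1: "act S ?f x = act S ?g x" and eq2: "dcomp u f = dcomp u g"
        using eq x'_act[OF f] x'_act[OF g] by simp_all
      have nD: "\<not> D m (act S ?f x) (dcomp u f)" using no x'_act[OF f] by (simp add: D_def)
      have "?f = ?g"
      proof (rule ccontr)
        assume ne: "?f \<noteq> ?g"
        have "?f \<notin> boundary n m" using lowdim dcomp_dhom[OF u f] nD by blast
        then have "\<And>i. i \<le> n \<Longrightarrow> \<exists>j\<le>m. ap ?f j = i" using f' by (auto simp: boundary_def)
        then obtain s where s: "s \<in> dhom n m" "dcomp ?f s = did n" "\<exists>i\<le>n. \<forall>j\<le>n. ap (dcomp ?g s) j \<noteq> i"
          using surjection_separation[OF f' g' ne] by metis
        have "dcomp ?g s \<in> boundary n n" using s dcomp_dhom[OF g' s(1)] by (auto simp: boundary_def)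
        moreover have "act S (dcomp ?g s) x = x"
          using act_dcomp[OF S s(1) f' x] act_dcomp[OF S s(1) g' x] eq1 s act_did[OF S x] by simp
        ultimately show False using lowdim t by metis
      qed
      then show ?thesis using codegeneracy_step_inject[OF f g i(1)] eq2 by (simp add: u_def)
    qed
  qed
  moreover have "closer_closed e ?G"
    unfolding closer_closed_def
  proof (intro allI impI, elim conjE)
    fix m a v s w
    assume w: "(m, (a, v), w) \<in> ?G" and s: "s \<in> dhom m 1" and cl: "closer e s v"
    show "\<exists>y'. (m, (a, s), y') \<in> ?G"
    proof (cases "(m, (a, v), w) \<in> G")
      case True
      then show ?thesis using G_closer[OF _ s cl] by (auto simp: D_def)
    next
      case False
      then obtain f where f: "f \<in> dhom m (Suc n)" "a = act S f x'" "v = dcomp u f"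
        using w by (auto simp: attach_def)
      let ?f = "dcomp (codegeneracy n i) f"
      have f': "?f \<in> dhom m n" using dcomp_dhom[OF \<sigma> f(1)] .
      \<comment> \<open>A pair moved towards \<open>e\<close> is either closer than the known
        section, hence old by the invariant of \<open>G\<close>, or it stays in the new prism
        simplex by \<open>closer_step\<close>.\<close>
      show ?thesis
      proof (cases "closer e s (dcomp (step n (i + 1 - e)) ?f)")
        case True
        then have "D m (act S ?f x) s" using G_closer[OF D_act[OF i(2) f'] s] by simp
        then show ?thesis using f x'_act by (auto simp: D_def)
      next
        case False
        then obtain g where g: "g \<in> dhom m (Suc n)" "dcomp (codegeneracy n i) g = ?f" "dcomp u g = s"
          using closer_step[OF f(1) i(1) e s] cl f(3) unfolding u_def by blast
        then have "act ?K g (x', u) = (a, s)" using f x'_act by simp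
        moreover have "(m, act ?K g (x', u), act E g z) \<in> attach ?K E (Suc n) (x', u) z"
          unfolding attach_def using g(1) by blast
        ultimately show ?thesis by auto
      qed
    qed
  qed
  moreover have "G \<subset> ?G"
  proof -
    have "(Suc n, (x', u), z) \<in> ?G"
      using act_did[OF K y] act_did[OF E z(1)] unfolding attach_def
      by (auto intro!: exI[of _ "did (Suc n)"] simp: dcomp_did_right[OF u] act_did[OF S x'])
    moreover have "(Suc n, (x', u), z) \<notin> G"
    proof
      assume "(Suc n, (x', u), z) \<in> G"
      then have "D (Suc n) x' u" by (auto simp: D_def)
      from D_act[OF this coface_dhom, of k] show False using coface_x'[OF k] i(3) by (simp add: k_def)
    qed
    ultimately show ?thesis by blast
  qed
  ultimately show ?thesis by blast
qed

text \<open>Classically, the inclusion of the end \<open>e\<close> together with \<open>A\<close>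
  times the interval is anodyne. Here the lift itself is extended, one prism simplex after another,
  under the invariant \<open>closer_closed\<close>.\<close>

theorem homotopy_extension:
  fixes S :: "'s sset" and E :: "'e sset"
  assumes S: "is_sset S" and E: "is_sset E" and R: "closed_over (sprod S (std 1)) E R"
    and fill: "horn_fill (sprod S (std 1)) E R" and e: "e \<le> 1" and A: "subcomplex S A"
    and c: "smap S E c" "\<And>n x. x \<in> splx S n \<Longrightarrow> R n (x, dconst n 1 e) (c n x)"
    and h: "smap (sprod (sub S A) (std 1)) E h"
      "\<And>n x t. x \<in> A n \<Longrightarrow> t \<in> dhom n 1 \<Longrightarrow> R n (x, t) (h n (x, t))"
    and ch: "\<And>n x. x \<in> A n \<Longrightarrow> h n (x, dconst n 1 e) = c n x"
  obtains H where "smap (sprod S (std 1)) E H"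
    "\<And>n x t. x \<in> splx S n \<Longrightarrow> t \<in> dhom n 1 \<Longrightarrow> R n (x, t) (H n (x, t))"
    "\<And>n x. x \<in> splx S n \<Longrightarrow> H n (x, dconst n 1 e) = c n x"
    "\<And>n x t. x \<in> A n \<Longrightarrow> t \<in> dhom n 1 \<Longrightarrow> H n (x, t) = h n (x, t)"
proof -
  let ?K = "sprod S (std 1)"
  define A' where "A' n = {(x, t). x \<in> splx S n \<and> t \<in> dhom n 1 \<and> (x \<in> A n \<or> t = dconst n 1 e)}" for n
  define F where "F n = (\<lambda>(x, t). if x \<in> A n then h n (x, t) else c n x)" for n
  have AS: "x \<in> splx S n" if "x \<in> A n" for x n using A that by (auto simp: subcomplex_def)
  have A_act: "act S f x \<in> A m" if "x \<in> A n" "f \<in> dhom m n" for f x m n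
    using A that by (auto simp: subcomplex_def)
  have A': "subcomplex ?K A'"
    unfolding subcomplex_def using A_act act_closed[OF S] e dcomp_dhom[of _ _ 1]
    by (auto simp: A'_def dcomp_dconst_left)
  have Fc: "F n (x, t) = c n x" if "(x, t) \<in> A' n" "t = dconst n 1 e" for n x t
    using that ch by (simp add: F_def)
  have F: "smap (sub ?K A') E F"
  proof (rule smapI)
    fix n p assume "p \<in> splx (sub ?K A') n"
    then obtain x t where p: "p = (x, t)" "(x, t) \<in> A' n" by (cases p) auto
    then show "F n p \<in> splx E n"
      using smap_closed[OF c(1), of x n] smap_closed[OF h(1), of "(x, t)" n] by (auto simp: F_def A'_def)
  next
    fix f m n p assume f: "f \<in> dhom m n" and "p \<in> splx (sub ?K A') n"
    then obtain x t where p: "p = (x, t)" "(x, t) \<in> A' n" by (cases p) auto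
    have fp: "act ?K f (x, t) \<in> A' m" using A' p(2) f unfolding subcomplex_def by blast
    show "F m (act (sub ?K A') f p) = act E f (F n p)"
    proof (cases "x \<in> A n")
      case True
      then show ?thesis
        using A_act[OF True f] smap_act[OF h(1) f, of "(x, t)"] p by (simp add: F_def A'_def)
    next
      case False
      then have t: "t = dconst n 1 e" and x: "x \<in> splx S n" using p by (auto simp: A'_def)
      have "F m (act ?K f (x, t)) = c m (act S f x)"
        using Fc fp t dcomp_dconst_left[OF f e] by simp
      then show ?thesis using smap_act[OF c(1) f x] Fc[OF p(2) t] p by simp
    qed
  qed
  have FR: "R n p (F n p)" if "p \<in> A' n" for n p
    using that c(2) h(2) by (auto simp: A'_def F_def)
  let ?G0 = "{(n, p, F n p) | n p. p \<in> A' n}"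
  have "lift_graph ?K E R ?G0" by (rule smap_lift_graph[OF F A']) (rule FR)
  moreover have "closer_closed e ?G0"
    unfolding closer_closed_def
  proof (intro allI impI, elim conjE)
    fix n x t s y assume "(n, (x, t), y) \<in> ?G0" and s: "s \<in> dhom n 1" "closer e s t"
    then have xt: "(x, t) \<in> A' n" by auto
    \<comment> \<open>Only the constant at \<open>e\<close> is closer to \<open>e\<close> than
      itself, and over \<open>A\<close> all second components are present; so the initial domain
      satisfies the invariant.\<close>
    have "s = dconst n 1 e" if "t = dconst n 1 e"
      by (rule dhom_eqI[OF s(1)]) (use s(2) e that in \<open>auto simp: closer_def\<close>)
    then have "(x, s) \<in> A' n" using xt s by (auto simp: A'_def)
    then show "\<exists>y'. (n, (x, s), y') \<in> ?G0" by auto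
  qed
  moreover have "closer_closed e (\<Union>C)" if "\<And>G. G \<in> C \<Longrightarrow> closer_closed e G"
    for C :: "(nat \<times> ('s \<times> dmap) \<times> 'e) set set"
    using that unfolding closer_closed_def by (meson UnionE UnionI)
  moreover have "\<exists>G'. lift_graph ?K E R G' \<and> closer_closed e G' \<and> G \<subset> G'"
    if G: "lift_graph ?K E R G" "closer_closed e G" "?G0 \<subseteq> G" and p: "p \<in> splx ?K n" "\<And>y. (n, p, y) \<notin> G"
    for G n p
  proof -
    obtain x t where xt: "p = (x, t)" "x \<in> splx S n" "t \<in> dhom n 1" using p by (cases p) auto
    show ?thesis
    proof (rule prism_step[OF S E R fill e G(1,2)])
      show "\<exists>y. (m, (a, dconst m 1 e), y) \<in> G" if "a \<in> splx S m" for m a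
      proof -
        have "(a, dconst m 1 e) \<in> A' m" using that e by (auto simp: A'_def)
        then show ?thesis using G(3) by blast
      qed
    qed (use xt p in auto)
  qed
  ultimately obtain H where H: "smap ?K E H" "\<And>n p. p \<in> splx ?K n \<Longrightarrow> R n p (H n p)"
    "\<And>n p y. (n, p, y) \<in> ?G0 \<Longrightarrow> H n p = y"
    by (rule lift_zorn[where P = "closer_closed e" and ?G0.0 = ?G0]) auto
  have H': "H n p = F n p" if "p \<in> A' n" for n p using H(3) that by blast
  show thesis
  proof (rule that[OF H(1)])
    show "R n (x, t) (H n (x, t))" if "x \<in> splx S n" "t \<in> dhom n 1" for n x t using H(2) that by simp
    show "H n (x, dconst n 1 e) = c n x" if "x \<in> splx S n" for n x
      using H'[of "(x, dconst n 1 e)" n] Fc[of x _ n] that e by (auto simp: A'_def)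
    show "H n (x, t) = h n (x, t)" if "x \<in> A n" "t \<in> dhom n 1" for n x t
      using H'[of "(x, t)" n] that AS by (auto simp: A'_def F_def)
  qed
qed

text \<open>A homotopy from the identity of the standard simplex to a map into the horn that preserves
  the horn throughout.\<close>

definition horn_retract :: "nat \<Rightarrow> nat \<Rightarrow> nat \<Rightarrow> dmap \<Rightarrow> dmap \<Rightarrow> dmap" where
  "horn_retract e n k f s = mk_dmap (src f) n
     (\<lambda>l. if ap s l = e then (if e = 0 then min (ap f l) k else max (ap f l) k) else ap f l)"

lemma horn_retract_dhom:
  assumes f: "f \<in> dhom m n" and s: "s \<in> dhom m 1" and "k \<le> n" "e \<le> 1"
  shows "horn_retract e n k f s \<in> dhom m n"
  unfolding horn_retract_def dhomD(2)[OF f]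
proof (rule mk_dmap_dhom)
  fix i j assume ij: "i \<le> j" "j \<le> m"
  have "ap s i = 0 \<or> ap s i = 1" "ap s j = 0 \<or> ap s j = 1" using ap_dhom_1[OF s] ij by auto
  moreover have "e = 0 \<or> e = 1" using assms by linarith
  ultimately show "(if ap s i = e then (if e = 0 then min (ap f i) k else max (ap f i) k) else ap f i)
    \<le> (if ap s j = e then (if e = 0 then min (ap f j) k else max (ap f j) k) else ap f j)"
    using ap_mono[OF f ij] ap_mono[OF s ij] by auto
qed (use ap_le[OF f] assms in auto)

lemma ap_horn_retract:
  assumes "f \<in> dhom m n" "l \<le> m"
  shows "ap (horn_retract e n k f s) l =
    (if ap s l = e then (if e = 0 then min (ap f l) k else max (ap f l) k) else ap f l)"
  using assms by (simp add: horn_retract_def dhomD)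

lemma horn_retract_dcomp:
  assumes f: "f \<in> dhom m n" and s: "s \<in> dhom m 1" and g: "g \<in> dhom l m" and "k \<le> n" "e \<le> 1"
  shows "dcomp (horn_retract e n k f s) g = horn_retract e n k (dcomp f g) (dcomp s g)"
  by (rule dhom_eqI[of _ l n])
    (use assms in \<open>auto intro: dcomp_dhom horn_retract_dhom
      simp: ap_dcomp[OF g] ap_horn_retract[OF f] ap_horn_retract[OF dcomp_dhom[OF f g]] ap_le[OF g]\<close>)

lemma horn_retract_other:
  assumes "f \<in> dhom m n" "k \<le> n" "e \<le> 1"
  shows "horn_retract e n k f (dconst m 1 (1 - e)) = f"
proof (rule dhom_eqI[OF horn_retract_dhom])
  have "1 - e \<noteq> e" by presburger
  then show "ap (horn_retract e n k f (dconst m 1 (1 - e))) i = ap f i" if "i \<le> m" for i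
    using that assms by (simp add: ap_horn_retract)
qed (use assms in auto)

lemma horn_retract_horn:
  assumes f: "f \<in> horn n k m" and s: "s \<in> dhom m 1" and "k \<le> n" "e \<le> 1"
  shows "horn_retract e n k f s \<in> horn n k m"
proof -
  obtain l where l: "l \<le> n" "l \<noteq> k" "\<forall>j\<le>m. ap f j \<noteq> l" using f by (auto simp: horn_def)
  then show ?thesis
    using horn_retract_dhom[OF horn_dhom[OF f] s assms(3,4)]
    by (auto simp: horn_def ap_horn_retract[OF horn_dhom[OF f]] min_def max_def intro!: exI[of _ l])
qed

lemma horn_retract_end:
  assumes f: "f \<in> dhom m n" and n: "1 \<le> n" and k: "k \<le> n" and e: "e = (if k < n then 0 else 1)"
  shows "horn_retract e n k f (dconst m 1 e) \<in> horn n k m"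
proof -
  have "horn_retract e n k f (dconst m 1 e) \<in> dhom m n"
    using horn_retract_dhom[OF f dconst_dhom k] e by simp
  then show ?thesis
    using assms by (auto simp: horn_def ap_horn_retract[OF f] intro!: exI[of _ "if k < n then n else 0"])
qed

text \<open>\<open>horn_retract\<close> deforms the identity of \<open>S\<close> times the simplex
  into \<open>B\<close>, keeping \<open>B\<close> inside itself. A lift over this deformation,
  prescribed at the end \<open>e\<close> and over \<open>B\<close>, is found by homotopy extension;
  its other end solves the original problem.\<close>

theorem horn_extension:
  fixes S :: "'s sset" and E :: "'e sset"
  assumes S: "is_sset S" and E: "is_sset E" and R: "closed_over (sprod S (std n)) E R"
    and fill: "horn_fill (sprod S (std n)) E R" and n: "1 \<le> n" and k: "k \<le> n" and A: "subcomplex S A"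
    and B: "\<And>m. B m = {(x, f). x \<in> splx S m \<and> f \<in> dhom m n \<and> (x \<in> A m \<or> f \<in> horn n k m)}"
    and F: "smap (sub (sprod S (std n)) B) E F"
      "\<And>m x f. (x, f) \<in> B m \<Longrightarrow> R m (x, f) (F m (x, f))"
  obtains F' where "smap (sprod S (std n)) E F'"
    "\<And>m x f. x \<in> splx S m \<Longrightarrow> f \<in> dhom m n \<Longrightarrow> R m (x, f) (F' m (x, f))"
    "\<And>m x f. (x, f) \<in> B m \<Longrightarrow> F' m (x, f) = F m (x, f)"
proof -
  \<comment> \<open>For \<open>k < n\<close> the deformation takes minima with \<open>k\<close> and
    ends up missing vertex \<open>n\<close>; for \<open>k = n\<close> it takes maxima and ends up
    missing vertex \<open>0\<close>, which differs from \<open>k\<close> because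
    \<open>1 \<le> n\<close>.\<close>
  define e :: nat where "e = (if k < n then 0 else 1)"
  have e1: "e \<le> 1" by (simp add: e_def)
  let ?K = "sprod S (std n)" and ?r = "horn_retract e n k"
  have K: "is_sset ?K" using S is_sset_std by (rule is_sset_sprod)
  have sB: "subcomplex ?K B"
    using A by (auto simp: subcomplex_def B act_closed[OF S] dcomp_dhom horn_dcomp)
  define \<phi> where "\<phi> = (\<lambda>m::nat. \<lambda>((x::'s, f), s). (x, ?r f s))"
  have \<phi>: "smap (sprod ?K (std 1)) ?K \<phi>"
    by (rule smapI) (auto simp: \<phi>_def act_closed[OF S] horn_retract_dcomp[OF _ _ _ k e1]
      intro: horn_retract_dhom[OF _ _ k e1])
  have \<phi>_B: "\<phi> m (p, s) \<in> B m" if "p \<in> B m" "s \<in> dhom m 1" for m p s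
    using that horn_retract_horn[OF _ that(2) k e1] horn_retract_dhom[OF _ that(2) k e1]
    by (auto simp: \<phi>_def B)
  have \<phi>_e: "\<phi> m (p, dconst m 1 e) \<in> B m" if "p \<in> splx ?K m" for m p
    using that horn_retract_end[OF _ n k e_def, THEN horn_dhom] horn_retract_end[OF _ n k e_def]
    by (auto simp: \<phi>_def B)
  have cst: "smap ?K (sprod ?K (std 1)) (\<lambda>m p. (p, dconst m 1 e))"
    by (rule smapI) (auto simp: e1 dcomp_dconst_left act_closed[OF S] dcomp_dhom)
  have \<phi>e: "smap ?K (sub ?K B) (\<lambda>m p. \<phi> m (p, dconst m 1 e))"
    by (rule smapI) (use \<phi>_e smap_act[OF smap_comp[OF cst \<phi>]] in auto)
  have \<phi>B: "smap (sprod (sub ?K B) (std 1)) (sub ?K B) \<phi>"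
  proof (rule smapI)
    show "\<phi> m p \<in> splx (sub ?K B) m" if "p \<in> splx (sprod (sub ?K B) (std 1)) m" for m p
      using that \<phi>_B by auto
    fix f l m p assume "f \<in> dhom l m" "p \<in> splx (sprod (sub ?K B) (std 1)) m"
    then show "\<phi> l (act (sprod (sub ?K B) (std 1)) f p) = act (sub ?K B) f (\<phi> m p)"
      using smap_act[OF \<phi>, of f l m p] by (auto simp: B)
  qed
  obtain H where H: "smap (sprod ?K (std 1)) E H"
    "\<And>m p s. p \<in> splx ?K m \<Longrightarrow> s \<in> dhom m 1 \<Longrightarrow> R m (\<phi> m (p, s)) (H m (p, s))"
    "\<And>m p. p \<in> splx ?K m \<Longrightarrow> H m (p, dconst m 1 e) = F m (\<phi> m (p, dconst m 1 e))"
    "\<And>m p s. p \<in> B m \<Longrightarrow> s \<in> dhom m 1 \<Longrightarrow> H m (p, s) = F m (\<phi> m (p, s))"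
  proof (rule homotopy_extension[OF K E, of "\<lambda>m p y. R m (\<phi> m p) y"])
    show "closed_over (sprod ?K (std 1)) E (\<lambda>m p. R m (\<phi> m p))"
      unfolding closed_over_def
    proof (intro allI ballI impI)
      fix l m f p y assume *: "f \<in> dhom l m" "p \<in> splx (sprod ?K (std 1)) m" "y \<in> splx E m" "R m (\<phi> m p) y"
      then show "R l (\<phi> l (act (sprod ?K (std 1)) f p)) (act E f y)"
        using R smap_closed[OF \<phi> *(2)] smap_act[OF \<phi> *(1,2)] unfolding closed_over_def by auto
    qed
    show "horn_fill (sprod ?K (std 1)) E (\<lambda>m p. R m (\<phi> m p))"
      by (rule horn_fill_pullback[OF fill \<phi>])
    show "smap ?K E (\<lambda>m p. F m (\<phi> m (p, dconst m 1 e)))"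
      by (rule smap_comp[OF \<phi>e F(1)])
    show "smap (sprod (sub ?K B) (std 1)) E (\<lambda>m p. F m (\<phi> m p))"
      by (rule smap_comp[OF \<phi>B F(1)])
    have FB: "R m p (F m p)" if "p \<in> B m" for m p using F(2) that by (cases p) auto
    show "R m (\<phi> m (p, dconst m 1 e)) (F m (\<phi> m (p, dconst m 1 e)))" if "p \<in> splx ?K m" for m p
      using FB[OF \<phi>_e[OF that]] .
    show "R m (\<phi> m (p, s)) (F m (\<phi> m (p, s)))" if "p \<in> B m" "s \<in> dhom m 1" for m p s
      using FB[OF \<phi>_B[OF that]] .
  qed (use e1 sB in auto)
  have id: "\<phi> m (p, dconst m 1 (1 - e)) = p" if "p \<in> splx ?K m" for m p
    using that horn_retract_other[OF _ k e1] by (auto simp: \<phi>_def)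
  have BK: "p \<in> splx ?K m" if "p \<in> B m" for p m using that by (auto simp: B)
  show thesis
  proof (rule that[of "\<lambda>m p. H m (p, dconst m 1 (1 - e))"])
    have "smap ?K (sprod ?K (std 1)) (\<lambda>m p. (p, dconst m 1 (1 - e)))"
      by (rule smapI) (auto simp: e1 dcomp_dconst_left act_closed[OF S] dcomp_dhom)
    from smap_comp[OF this H(1)] show "smap ?K E (\<lambda>m p. H m (p, dconst m 1 (1 - e)))" .
    show "R m (x, f) (H m ((x, f), dconst m 1 (1 - e)))" if "x \<in> splx S m" "f \<in> dhom m n" for m x f
      using H(2)[of "(x, f)" m "dconst m 1 (1 - e)"] id[of "(x, f)" m] that by simp
    show "H m ((x, f), dconst m 1 (1 - e)) = F m (x, f)" if "(x, f) \<in> B m" for m x f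
      using H(4)[OF that, of "dconst m 1 (1 - e)"] id[OF BK[OF that]] by simp
  qed
qed

section \<open>Path objects\<close>

lemma path_objI:
  assumes "smap (sprod (std n) (std 1)) L h"
  shows "path_restrict n h \<in> splx (path_obj L) n"
proof -
  have "smap (sprod (std n) (std 1)) L (path_restrict n h)"
    unfolding path_restrict_def
  proof (rule smapI)
    fix f l m p assume *: "f \<in> dhom l m" "p \<in> splx (sprod (std n) (std 1)) m"
    then have "act (sprod (std n) (std 1)) f p \<in> splx (sprod (std n) (std 1)) l"
      using act_closed[OF is_sset_sprod[OF is_sset_std is_sset_std]] by blast
    then show "restrict (h l) (splx (sprod (std n) (std 1)) l) (act (sprod (std n) (std 1)) f p) =
        act L f (restrict (h m) (splx (sprod (std n) (std 1)) m) p)"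
      using smap_act[OF assms *] *(2) by (simp only: restrict_apply' simp_thms)
  qed (use smap_closed[OF assms] in simp)
  moreover have "path_restrict n (path_restrict n h) = path_restrict n h"
    by (auto simp: path_restrict_def)
  ultimately show ?thesis by (simp add: path_obj_def)
qed

lemma path_smap: "\<alpha> \<in> splx (path_obj L) n \<Longrightarrow> smap (sprod (std n) (std 1)) L \<alpha>"
  by (simp add: path_obj_def)

lemma path_restrict_apply:
  "f \<in> dhom m n \<Longrightarrow> t \<in> dhom m 1 \<Longrightarrow> path_restrict n h m (f, t) = h m (f, t)"
  by (simp add: path_restrict_def)

lemma path_eqI:
  assumes "\<alpha> \<in> splx (path_obj L) n" "\<beta> \<in> splx (path_obj L) n"
    and "\<And>m f t. f \<in> dhom m n \<Longrightarrow> t \<in> dhom m 1 \<Longrightarrow> \<alpha> m (f, t) = \<beta> m (f, t)"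
  shows "\<alpha> = \<beta>"
proof -
  have "path_restrict n \<alpha> = path_restrict n \<beta>"
    using assms(3) by (auto simp: path_restrict_def fun_eq_iff restrict_def)
  then show ?thesis using assms(1,2) by (simp add: path_obj_def)
qed

lemma act_path:
  assumes "f \<in> dhom m n" "g \<in> dhom l m" "t \<in> dhom l 1"
  shows "act (path_obj L) f \<alpha> l (g, t) = \<alpha> l (dcomp f g, t)"
  using assms by (simp add: path_obj_def path_restrict_apply dhomD)

lemma act_path_closed:
  assumes "f \<in> dhom m n" "\<alpha> \<in> splx (path_obj L) n"
  shows "act (path_obj L) f \<alpha> \<in> splx (path_obj L) m"
proof -
  have "smap (sprod (std m) (std 1)) (sprod (std n) (std 1)) (\<lambda>k (g, t). (dcomp f g, t))"
    by (rule smapI) (use assms in \<open>auto intro: dcomp_dhom simp: dcomp_assoc[OF _ _ assms(1)]\<close>)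
  from smap_comp[OF this path_smap[OF assms(2)]]
  have "smap (sprod (std m) (std 1)) L (\<lambda>k (g, t). \<alpha> k (dcomp f g, t))"
    by (simp add: case_prod_unfold)
  from path_objI[OF this] show ?thesis using dhomD(2)[OF assms(1)] by (simp add: path_obj_def)
qed

lemma is_sset_path_obj: "is_sset (path_obj L)"
proof (rule is_ssetI)
  show "act (path_obj L) (did n) \<alpha> = \<alpha>" if "\<alpha> \<in> splx (path_obj L) n" for n \<alpha>
    by (rule path_eqI[OF act_path_closed]) (use that in \<open>auto simp: act_path[of _ n n] dcomp_did_left\<close>)
  show "act (path_obj L) (dcomp g f) \<alpha> = act (path_obj L) f (act (path_obj L) g \<alpha>)"
    if "f \<in> dhom l m" "g \<in> dhom m n" "\<alpha> \<in> splx (path_obj L) n" for f g l m n \<alpha>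
    by (rule path_eqI[of _ L l]) (use that in \<open>auto intro!: act_path_closed dcomp_dhom
        simp: act_path[OF that(1)] act_path[OF that(2)] act_path[OF dcomp_dhom[OF that(2,1)]]
          dcomp_dhom[OF that(1)] dcomp_assoc[OF _ that(1,2)]\<close>)
qed (rule act_path_closed)

lemma path_eval:
  assumes "\<alpha> \<in> splx (path_obj L) n" "f \<in> dhom m n" "t \<in> dhom m 1"
  shows "\<alpha> m (f, t) = act (path_obj L) f \<alpha> m (did m, t)"
  using assms by (simp add: act_path dcomp_did_right)

lemma smap_uncurry:
  assumes "smap S (path_obj L) G"
  shows "smap (sprod S (std 1)) L (\<lambda>n (x, t). G n x n (did n, t))"
proof (rule smapI)
  fix n p assume "p \<in> splx (sprod S (std 1)) n"
  then show "(case p of (x, t) \<Rightarrow> G n x n (did n, t)) \<in> splx L n"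
    using smap_closed[OF path_smap[OF smap_closed[OF assms]], of _ n "(did n, _)" n] by auto
next
  fix f m n p assume f: "f \<in> dhom m n" and "p \<in> splx (sprod S (std 1)) n"
  then obtain x t where p: "p = (x, t)" "x \<in> splx S n" "t \<in> dhom n 1" by auto
  have "G m (act S f x) m (did m, dcomp t f) = G n x m (f, dcomp t f)"
    using smap_act[OF assms f p(2)] f p by (simp add: act_path dcomp_did_right dcomp_dhom[OF p(3) f])
  also have "\<dots> = act L f (G n x n (did n, t))"
    using smap_act[OF path_smap[OF smap_closed[OF assms p(2)]] f, of "(did n, t)"] p f
    by (simp add: dcomp_did_left)
  finally show "(case act (sprod S (std 1)) f p of (x, t) \<Rightarrow> G m x m (did m, t)) =
      act L f (case p of (x, t) \<Rightarrow> G n x n (did n, t))"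
    by (simp add: p)
qed

lemma adjoint_path_smap:
  assumes "is_sset S" "smap (sprod S (std 1)) L H" "x \<in> splx S n"
  shows "smap (sprod (std n) (std 1)) L (\<lambda>k (f, t). H k (act S f x, t))"
proof -
  have "smap (sprod (std n) (std 1)) (sprod S (std 1)) (\<lambda>k (f, t). (act S f x, t))"
    by (rule smapI) (use assms in \<open>auto simp: act_closed act_dcomp\<close>)
  from smap_comp[OF this assms(2)] show ?thesis by (simp add: case_prod_unfold)
qed

lemma adjoint_path_apply:
  assumes "f \<in> dhom m n" "t \<in> dhom m 1"
  shows "adjoint_path S H n x m (f, t) = H m (act S f x, t)"
  using assms by (simp add: adjoint_path_def path_restrict_apply)

lemma adjoint_path_closed:
  "is_sset S \<Longrightarrow> smap (sprod S (std 1)) L H \<Longrightarrow> x \<in> splx S n \<Longrightarrow>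
   adjoint_path S H n x \<in> splx (path_obj L) n"
  unfolding adjoint_path_def by (intro path_objI adjoint_path_smap)

lemma smap_curry:
  assumes S: "is_sset S" and H: "smap (sprod S (std 1)) L H"
  shows "smap S (path_obj L) (adjoint_path S H)"
proof (rule smapI)
  fix f m n x assume f: "f \<in> dhom m n" and x: "x \<in> splx S n"
  show "adjoint_path S H m (act S f x) = act (path_obj L) f (adjoint_path S H n x)"
    by (rule path_eqI[OF adjoint_path_closed[OF S H act_closed[OF S f x]]
        act_path_closed[OF f adjoint_path_closed[OF S H x]]])
      (simp add: act_path[OF f] adjoint_path_apply dcomp_dhom[OF f] act_dcomp[OF S _ f x])
qed (rule adjoint_path_closed[OF assms])

lemma path_end_smap:
  assumes "j \<le> 1"
  shows "smap (path_obj L) L (path_end j)"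
proof (rule smapI)
  fix n \<alpha> assume "\<alpha> \<in> splx (path_obj L) n"
  then show "path_end j n \<alpha> \<in> splx L n"
    using smap_closed[OF path_smap, of \<alpha> L n "(did n, dconst n 1 j)" n] assms by (simp add: path_end_def)
next
  fix f m n \<alpha> assume f: "f \<in> dhom m n" and \<alpha>: "\<alpha> \<in> splx (path_obj L) n"
  show "path_end j m (act (path_obj L) f \<alpha>) = act L f (path_end j n \<alpha>)"
    using smap_act[OF path_smap[OF \<alpha>] f, of "(did n, dconst n 1 j)"] f assms
    by (simp add: path_end_def act_path dcomp_did_left dcomp_did_right dcomp_dconst_left)
qed

lemma path_end_adjoint:
  "is_sset S \<Longrightarrow> x \<in> splx S n \<Longrightarrow> j \<le> 1 \<Longrightarrow> path_end j n (adjoint_path S H n x) = H n (x, dconst n 1 j)"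
  by (simp add: path_end_def adjoint_path_apply act_did)

definition path_map :: "(nat \<Rightarrow> 'a \<Rightarrow> 'b) \<Rightarrow> nat \<Rightarrow> 'a path \<Rightarrow> 'b path" where
  "path_map \<pi> n \<alpha> = path_restrict n (\<lambda>k p. \<pi> k (\<alpha> k p))"

lemma path_map_apply:
  "f \<in> dhom m n \<Longrightarrow> t \<in> dhom m 1 \<Longrightarrow> path_map \<pi> n \<alpha> m (f, t) = \<pi> m (\<alpha> m (f, t))"
  by (simp add: path_map_def path_restrict_apply)

lemma path_map_closed:
  "smap K L \<pi> \<Longrightarrow> \<alpha> \<in> splx (path_obj K) n \<Longrightarrow> path_map \<pi> n \<alpha> \<in> splx (path_obj L) n"
  unfolding path_map_def by (intro path_objI smap_comp[OF path_smap])

lemma path_end_path_map: "j \<le> 1 \<Longrightarrow> path_end j n (path_map \<pi> n \<alpha>) = \<pi> n (path_end j n \<alpha>)"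
  by (simp add: path_end_def path_map_apply)

lemma path_map_act:
  assumes "smap K L \<pi>" "f \<in> dhom m n" "\<alpha> \<in> splx (path_obj K) n"
  shows "act (path_obj L) f (path_map \<pi> n \<alpha>) = path_map \<pi> m (act (path_obj K) f \<alpha>)"
  by (rule path_eqI[of _ L m]) (use assms in \<open>auto intro!: act_path_closed path_map_closed
      simp: act_path[OF assms(2)] path_map_apply dcomp_dhom[OF assms(2)]\<close>)

section \<open>Lifting along path objects\<close>

text \<open>Horns as maps instead of families of faces; \<open>is_kan_fill\<close> passes from
  \<open>std 0\<close> to any base. Homotopy pullbacks are shown to be Kan in this form.\<close>

definition is_kan :: "'a sset \<Rightarrow> bool" where
  "is_kan L \<longleftrightarrow> is_sset L \<and> horn_fill (std 0) L (\<lambda>_ _ _. True)"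

lemma is_kan_sset: "is_kan L \<Longrightarrow> is_sset L"
  by (simp add: is_kan_def)

lemma is_kan_horn:
  assumes "is_kan L" "1 \<le> n" "k \<le> n" "smap (sub (std n) (horn n k)) L F"
  obtains z where "z \<in> splx L n" "\<And>m f. f \<in> horn n k m \<Longrightarrow> act L f z = F m f"
proof -
  have fill: "horn_fill (std 0) L (\<lambda>_ _ _. True)" using assms(1) by (simp add: is_kan_def)
  have "\<exists>z\<in>splx L n. True \<and> (\<forall>m. \<forall>f\<in>horn n k m. act L f z = F m f)"
    by (rule fill[unfolded horn_fill_def, rule_format, OF assms(2,3), of "dconst n 0 0" F])
      (use assms(4) in auto)
  then obtain z where z: "z \<in> splx L n" "\<forall>m. \<forall>f\<in>horn n k m. act L f z = F m f" by auto
  show thesis by (rule that[of z]) (use z in auto)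
qed

lemma is_kan_fill:
  assumes "is_kan L"
  shows "horn_fill K L (\<lambda>_ _ _. True)"
  unfolding horn_fill_def
proof (intro allI ballI impI)
  fix n k x F
  assume n: "1 \<le> n" "k \<le> n" and "smap (sub (std n) (horn n k)) L F \<and> (\<forall>m. \<forall>f\<in>horn n k m. True)"
  then have F: "smap (sub (std n) (horn n k)) L F" by (elim conjE)
  obtain z where "z \<in> splx L n" "\<And>m f. f \<in> horn n k m \<Longrightarrow> act L f z = F m f"
    using is_kan_horn[OF assms n F] by blast
  then show "\<exists>z\<in>splx L n. True \<and> (\<forall>m. \<forall>f\<in>horn n k m. act L f z = F m f)" by auto
qed

lemma kan_is_kan: "kan L \<Longrightarrow> is_kan L"
  unfolding is_kan_def by (intro conjI kan_horn_fill) (auto simp only: kan_def)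

lemma is_kanI:
  assumes "is_sset L"
    and "\<And>n k F. 1 \<le> n \<Longrightarrow> k \<le> n \<Longrightarrow> smap (sub (std n) (horn n k)) L F \<Longrightarrow>
      \<exists>z\<in>splx L n. \<forall>m. \<forall>f\<in>horn n k m. act L f z = F m f"
  shows "is_kan L"
  using assms unfolding is_kan_def horn_fill_def by auto

lemma closed_over_True: "closed_over K L (\<lambda>_ _ _. True)"
  by (simp add: closed_over_def)

lemma is_kan_std_0: "is_kan (std 0)"
proof (rule is_kanI[OF is_sset_std])
  fix n k F assume F: "smap (sub (std n) (horn n k)) (std 0) F"
  have "act (std 0) f (dconst n 0 0) = F m f" if f: "f \<in> horn n k m" for m f
  proof -
    have "F m f \<in> dhom m 0" using smap_closed[OF F, of f m] f by simp
    then have "F m f = dconst m 0 0" by (rule dhom_0)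
    then show ?thesis using dcomp_dconst_left[OF horn_dhom[OF f], of 0 0] by simp
  qed
  then show "\<exists>z\<in>splx (std 0) n. \<forall>m. \<forall>f\<in>horn n k m. act (std 0) f z = F m f"
    by (intro bexI[of _ "dconst n 0 0"]) auto
qed

lemma path_restrict_boundary:
  assumes H: "smap (sprod (std n) (std 1)) L H" and G: "smap (sub (std n) A) (path_obj L) F"
    and A: "subcomplex (std n) A"
    and eq: "\<And>m f t. f \<in> A m \<Longrightarrow> t \<in> dhom m 1 \<Longrightarrow> H m (f, t) = F m f m (did m, t)"
    and f: "f \<in> A m"
  shows "act (path_obj L) f (path_restrict n H) = F m f"
proof (rule path_eqI[of _ L m])
  have f': "f \<in> dhom m n" using A f by (auto simp: subcomplex_def)
  show "act (path_obj L) f (path_restrict n H) \<in> splx (path_obj L) m"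
    by (rule act_path_closed[OF f' path_objI[OF H]])
  show Ff: "F m f \<in> splx (path_obj L) m" using smap_closed[OF G, of f m] f by simp
  fix l g t assume g: "g \<in> dhom l m" and t: "t \<in> dhom l 1"
  have fg: "dcomp f g \<in> A l" using A f g by (auto simp: subcomplex_def)
  have "act (path_obj L) f (path_restrict n H) l (g, t) = F l (dcomp f g) l (did l, t)"
    using eq[OF fg t] by (simp add: act_path[OF f' g t] path_restrict_apply dcomp_dhom[OF f' g] t)
  also have "F l (dcomp f g) = act (path_obj L) g (F m f)"
    using smap_act[OF G g, of f] f by simp
  also have "\<dots> l (did l, t) = F m f l (g, t)" using path_eval[OF Ff g t] by simp
  finally show "act (path_obj L) f (path_restrict n H) l (g, t) = F m f l (g, t)" .
qed

text \<open>Evaluation at one end of a path is a trivial fibration: this is homotopy extension from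
  the end \<open>j\<close>, transposed. The other end is left free, in contrast to
  \<open>path_horn\<close>.\<close>

lemma path_extend:
  assumes L: "is_kan L" and A: "subcomplex (std n) A" and j: "j \<le> 1" and d: "d \<in> splx L n"
    and F: "smap (sub (std n) A) (path_obj L) F"
    and Fd: "\<And>m f. f \<in> A m \<Longrightarrow> path_end j m (F m f) = act L f d"
  obtains \<alpha> where "\<alpha> \<in> splx (path_obj L) n" "path_end j n \<alpha> = d"
    "\<And>m f. f \<in> A m \<Longrightarrow> act (path_obj L) f \<alpha> = F m f"
proof -
  have L': "is_sset L" using L by (rule is_kan_sset)
  obtain H where H: "smap (sprod (std n) (std 1)) L H"
    "\<And>m f. f \<in> dhom m n \<Longrightarrow> H m (f, dconst m 1 j) = act L f d"
    "\<And>m f t. f \<in> A m \<Longrightarrow> t \<in> dhom m 1 \<Longrightarrow> H m (f, t) = F m f m (did m, t)"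
    by (rule homotopy_extension[OF is_sset_std L' closed_over_True is_kan_fill[OF L] j A
          smap_simplex[OF L' d] _ smap_uncurry[OF F]]) (use Fd in \<open>auto simp: path_end_def\<close>)
  show thesis
  proof (rule that[OF path_objI[OF H(1)]])
    show "path_end j n (path_restrict n H) = d"
      using H(2)[OF did_dhom] j act_did[OF L' d] by (simp add: path_end_def path_restrict_apply)
    show "act (path_obj L) f (path_restrict n H) = F m f" if "f \<in> A m" for m f
      by (rule path_restrict_boundary[OF H(1) F A H(3) that])
  qed
qed

text \<open>Evaluation at both ends is a fibration: horn extension over the interval relative to its
  two end-points, with the factors exchanged.\<close>

lemma path_horn:
  assumes L: "is_kan L" and n: "1 \<le> n" and k: "k \<le> n" and c: "c \<in> splx L n" and d: "d \<in> splx L n"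
    and F: "smap (sub (std n) (horn n k)) (path_obj L) F"
    and Fc: "\<And>m f. f \<in> horn n k m \<Longrightarrow> path_end 0 m (F m f) = act L f c"
    and Fd: "\<And>m f. f \<in> horn n k m \<Longrightarrow> path_end 1 m (F m f) = act L f d"
  obtains \<alpha> where "\<alpha> \<in> splx (path_obj L) n" "path_end 0 n \<alpha> = c" "path_end 1 n \<alpha> = d"
    "\<And>m f. f \<in> horn n k m \<Longrightarrow> act (path_obj L) f \<alpha> = F m f"
proof -
  have L': "is_sset L" using L by (rule is_kan_sset)
  define A where "A m = {dconst m 1 0, dconst m 1 1}" for m
  define B where "B m = {(t, f). t \<in> splx (std 1) m \<and> f \<in> dhom m n \<and> (t \<in> A m \<or> f \<in> horn n k m)}" for m
  \<comment> \<open>The prescriptions overlap where an end-point of the interval meets the horn;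
    \<open>Fc\<close> and \<open>Fd\<close> make them agree there, which is
    \<open>G_horn\<close>.\<close>
  define G where "G m = (\<lambda>(t, f). if t = dconst m 1 0 then act L f c else if t = dconst m 1 1 then act L f d
    else F m f m (did m, t))" for m
  have A: "subcomplex (std 1) A"
    by (auto simp: subcomplex_def A_def dcomp_dconst_left)
  have ne: "dconst m 1 0 \<noteq> dconst m 1 1" for m
    using ap_dconst[of 0 m 1 0] ap_dconst[of 0 m 1 1] by (metis le0 zero_neq_one)
  have G_horn: "G m (t, f) = F m f m (did m, t)" if "f \<in> horn n k m" "t \<in> dhom m 1" for m t f
    using Fc[OF that(1)] Fd[OF that(1)] by (auto simp: G_def path_end_def)
  have G_0: "G m (dconst m 1 0, f) = act L f c" and G_1: "G m (dconst m 1 1, f) = act L f d" for m f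
    using ne[of m] by (auto simp: G_def)
  note U = smap_uncurry[OF F]
  have G: "smap (sub (sprod (std 1) (std n)) B) L G"
  proof (rule smapI)
    fix m p assume "p \<in> splx (sub (sprod (std 1) (std n)) B) m"
    then obtain t f where p: "p = (t, f)" "t \<in> dhom m 1" "f \<in> dhom m n" "t \<in> A m \<or> f \<in> horn n k m"
      by (auto simp: B_def)
    show "G m p \<in> splx L m"
    proof (cases "f \<in> horn n k m")
      case True
      then show ?thesis using G_horn[OF True p(2)] smap_closed[OF U, of "(f, t)" m] p by simp
    next
      case False
      then show ?thesis using p G_0 G_1 act_closed[OF L'] c d by (auto simp: A_def)
    qed
  next
    fix g l m p assume g: "g \<in> dhom l m" and "p \<in> splx (sub (sprod (std 1) (std n)) B) m"
    then obtain t f where p: "p = (t, f)" "t \<in> dhom m 1" "f \<in> dhom m n" "t \<in> A m \<or> f \<in> horn n k m"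
      by (auto simp: B_def)
    show "G l (act (sub (sprod (std 1) (std n)) B) g p) = act L g (G m p)"
    proof (cases "f \<in> horn n k m")
      case True
      have "G l (dcomp t g, dcomp f g) = F l (dcomp f g) l (did l, dcomp t g)"
        by (rule G_horn[OF horn_dcomp[OF True g] dcomp_dhom[OF p(2) g]])
      then show ?thesis using G_horn[OF True p(2)] smap_act[OF U g, of "(f, t)"] p True by simp
    next
      case False
      then show ?thesis
        using p G_0 G_1 c d g by (auto simp: A_def dcomp_dconst_left act_dcomp[OF L'])
    qed
  qed
  obtain H where H: "smap (sprod (std 1) (std n)) L H"
    "\<And>m t f. (t, f) \<in> B m \<Longrightarrow> H m (t, f) = G m (t, f)"
    by (rule horn_extension[OF is_sset_std L' closed_over_True is_kan_fill[OF L] n k A B_def G]) auto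
  define H' where "H' m = (\<lambda>(f, t). H m (t, f))" for m
  have "smap (sprod (std n) (std 1)) (sprod (std 1) (std n)) (\<lambda>m (f, t). (t, f))"
    by (rule smapI) auto
  from smap_comp[OF this H(1)] have H': "smap (sprod (std n) (std 1)) L H'"
    unfolding H'_def[abs_def] by (simp add: case_prod_unfold)
  show thesis
  proof (rule that[OF path_objI[OF H']])
    show "path_end 0 n (path_restrict n H') = c"
      using H(2)[of "dconst n 1 0" "did n" n] G_0 act_did[OF L' c]
      by (simp add: path_end_def path_restrict_apply H'_def B_def A_def)
    show "path_end 1 n (path_restrict n H') = d"
      using H(2)[of "dconst n 1 1" "did n" n] G_1 act_did[OF L' d]
      by (simp add: path_end_def path_restrict_apply H'_def B_def A_def)
    show "act (path_obj L) f (path_restrict n H') = F m f" if "f \<in> horn n k m" for m f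
    proof (rule path_restrict_boundary[OF H' F subcomplex_horn _ that])
      show "H' m (f, t) = F m f m (did m, t)" if "f \<in> horn n k m" "t \<in> dhom m 1" for m f t
        using H(2)[of t f m] G_horn[OF that] that horn_dhom[OF that(1)] by (simp add: H'_def B_def)
    qed
  qed
qed

section \<open>Homotopy pullbacks\<close>

locale homotopy_pullback =
  fixes A :: "'a sset" and B :: "'b sset" and C :: "'c sset"
    and f :: "nat \<Rightarrow> 'a \<Rightarrow> 'c" and g :: "nat \<Rightarrow> 'b \<Rightarrow> 'c"
  assumes A: "is_kan A" and B: "is_kan B" and C: "is_kan C"
    and f: "smap A C f" and g: "smap B C g"
begin

abbreviation "Q \<equiv> hpullback A B C f g"

lemma mem_Q: "(a, \<alpha>, \<beta>, b) \<in> splx Q n \<longleftrightarrow> a \<in> splx A n \<and> b \<in> splx B n \<and>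
    \<alpha> \<in> splx (path_obj C) n \<and> \<beta> \<in> splx (path_obj C) n \<and> path_end 0 n \<alpha> = path_end 0 n \<beta> \<and>
    path_end 1 n \<alpha> = f n a \<and> path_end 1 n \<beta> = g n b"
  by (simp add: hpullback_def)

lemma act_Q: "act Q \<phi> (a, \<alpha>, \<beta>, b) =
    (act A \<phi> a, act (path_obj C) \<phi> \<alpha>, act (path_obj C) \<phi> \<beta>, act B \<phi> b)"
  by (simp add: hpullback_def)

lemma is_sset_Q: "is_sset Q"
proof (rule is_ssetI)
  fix \<phi> m n q assume \<phi>: "\<phi> \<in> dhom m n" and "q \<in> splx Q n"
  then obtain a \<alpha> \<beta> b where q: "q = (a, \<alpha>, \<beta>, b)" "(a, \<alpha>, \<beta>, b) \<in> splx Q n" by (cases q) auto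
  then show "act Q \<phi> q \<in> splx Q m"
    using act_closed[OF is_kan_sset[OF A] \<phi>] act_closed[OF is_kan_sset[OF B] \<phi>] act_path_closed[OF \<phi>, where L = C]
      smap_act[OF path_end_smap[where L = C] \<phi>] smap_act[OF f \<phi>] smap_act[OF g \<phi>]
    by (simp add: mem_Q act_Q)
next
  fix n q assume "q \<in> splx Q n"
  then show "act Q (did n) q = q"
    using act_did[OF is_kan_sset[OF A]] act_did[OF is_kan_sset[OF B]] act_did[OF is_sset_path_obj[of C]]
    by (cases q) (simp add: mem_Q act_Q)
next
  fix \<phi> \<psi> l m n q assume *: "\<phi> \<in> dhom l m" "\<psi> \<in> dhom m n" "q \<in> splx Q n"
  then show "act Q (dcomp \<psi> \<phi>) q = act Q \<phi> (act Q \<psi> q)"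
    using act_dcomp[OF is_kan_sset[OF A] *(1,2)] act_dcomp[OF is_kan_sset[OF B] *(1,2)]
      act_dcomp[OF is_sset_path_obj[of C] *(1,2)]
    by (cases q) (simp add: mem_Q act_Q)
qed

lemma smap_into_Q:
  assumes "smap S A a" "smap S (path_obj C) \<alpha>" "smap S (path_obj C) \<beta>" "smap S B b"
    and "\<And>n x. x \<in> splx S n \<Longrightarrow> path_end 0 n (\<alpha> n x) = path_end 0 n (\<beta> n x)"
    and "\<And>n x. x \<in> splx S n \<Longrightarrow> path_end 1 n (\<alpha> n x) = f n (a n x)"
    and "\<And>n x. x \<in> splx S n \<Longrightarrow> path_end 1 n (\<beta> n x) = g n (b n x)"
  shows "smap S Q (\<lambda>n x. (a n x, \<alpha> n x, \<beta> n x, b n x))"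
  using assms by (intro smapI) (simp_all add: mem_Q act_Q smap_closed[of S] smap_act[of S])

definition pa :: "nat \<Rightarrow> 'a \<times> 'c path \<times> 'c path \<times> 'b \<Rightarrow> 'a" where "pa n q = fst q"
definition p\<alpha> :: "nat \<Rightarrow> 'a \<times> 'c path \<times> 'c path \<times> 'b \<Rightarrow> 'c path" where "p\<alpha> n q = fst (snd q)"
definition p\<beta> :: "nat \<Rightarrow> 'a \<times> 'c path \<times> 'c path \<times> 'b \<Rightarrow> 'c path" where "p\<beta> n q = fst (snd (snd q))"
definition pb :: "nat \<Rightarrow> 'a \<times> 'c path \<times> 'c path \<times> 'b \<Rightarrow> 'b" where "pb n q = snd (snd (snd q))"

lemma proj_simps [simp]:
  "pa n (a, \<alpha>, \<beta>, b) = a" "p\<alpha> n (a, \<alpha>, \<beta>, b) = \<alpha>" "p\<beta> n (a, \<alpha>, \<beta>, b) = \<beta>" "pb n (a, \<alpha>, \<beta>, b) = b"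
  by (simp_all add: pa_def p\<alpha>_def p\<beta>_def pb_def)

lemma proj_collapse: "q = (pa n q, p\<alpha> n q, p\<beta> n q, pb n q)"
  by (cases q) simp

lemma proj_smap: "smap Q A pa" "smap Q (path_obj C) p\<alpha>" "smap Q (path_obj C) p\<beta>" "smap Q B pb"
  by (rule smapI; case_tac x; simp add: mem_Q act_Q)+

lemma proj_ends:
  assumes "q \<in> splx Q n"
  shows "path_end 0 n (p\<alpha> n q) = path_end 0 n (p\<beta> n q)" "path_end 1 n (p\<alpha> n q) = f n (pa n q)"
    "path_end 1 n (p\<beta> n q) = g n (pb n q)"
  using assms by (cases q; simp add: mem_Q)+

lemma closed_over_pb: "closed_over B Q (\<lambda>n b q. pb n q = b)"
  unfolding closed_over_def using smap_act[OF proj_smap(4)] by auto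

text \<open>The order of lifting matters: \<open>a\<close> first, then \<open>\<alpha>\<close> with
  its end at \<open>f n a\<close>, which fixes the common start, and last \<open>\<beta>\<close>,
  both of whose ends are now prescribed. Only this last step calls for a horn instead of an
  arbitrary subcomplex of the simplex in the path object.\<close>

lemma fibration: "horn_fill B Q (\<lambda>n b q. pb n q = b)"
  unfolding horn_fill_def
proof (intro allI ballI impI, elim conjE)
  fix n k b F
  assume n: "1 \<le> n" and k: "k \<le> n" and b: "b \<in> splx B n"
    and F: "smap (sub (std n) (horn n k)) Q F"
    and Fb: "\<forall>m. \<forall>h\<in>horn n k m. pb m (F m h) = act B h b"
  have Fm: "F m h \<in> splx Q m" if "h \<in> horn n k m" for m h using smap_closed[OF F, of h m] that by simp
  obtain a where a: "a \<in> splx A n" "\<And>m h. h \<in> horn n k m \<Longrightarrow> act A h a = pa m (F m h)"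
    using is_kan_horn[OF A n k smap_comp[OF F proj_smap(1)]] by blast
  have fa: "f n a \<in> splx C n" using smap_closed[OF f a(1)] .
  obtain \<alpha> where \<alpha>: "\<alpha> \<in> splx (path_obj C) n" "path_end 1 n \<alpha> = f n a"
    "\<And>m h. h \<in> horn n k m \<Longrightarrow> act (path_obj C) h \<alpha> = p\<alpha> m (F m h)"
  proof (rule path_extend[OF C subcomplex_horn _ fa smap_comp[OF F proj_smap(2)]])
    show "path_end 1 m (p\<alpha> m (F m h)) = act C h (f n a)" if "h \<in> horn n k m" for m h
      using proj_ends(2)[OF Fm[OF that]] a(2)[OF that] smap_act[OF f horn_dhom[OF that] a(1)] by simp
  qed auto
  have c: "path_end 0 n \<alpha> \<in> splx C n" using smap_closed[OF path_end_smap \<alpha>(1)] by simp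
  obtain \<beta> where \<beta>: "\<beta> \<in> splx (path_obj C) n" "path_end 0 n \<beta> = path_end 0 n \<alpha>" "path_end 1 n \<beta> = g n b"
    "\<And>m h. h \<in> horn n k m \<Longrightarrow> act (path_obj C) h \<beta> = p\<beta> m (F m h)"
  proof (rule path_horn[OF C n k c smap_closed[OF g b] smap_comp[OF F proj_smap(3)]])
    show "path_end 0 m (p\<beta> m (F m h)) = act C h (path_end 0 n \<alpha>)" if "h \<in> horn n k m" for m h
      using proj_ends(1)[OF Fm[OF that]] \<alpha>(3)[OF that] smap_act[OF path_end_smap horn_dhom[OF that] \<alpha>(1), of 0]
      by simp
    show "path_end 1 m (p\<beta> m (F m h)) = act C h (g n b)" if "h \<in> horn n k m" for m h
      using proj_ends(3)[OF Fm[OF that]] Fb that smap_act[OF g horn_dhom[OF that] b] by simp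
  qed auto
  have "(a, \<alpha>, \<beta>, b) \<in> splx Q n" using a(1) b \<alpha>(1,2) \<beta>(1-3) by (simp add: mem_Q)
  moreover have "act Q h (a, \<alpha>, \<beta>, b) = F m h" if "h \<in> horn n k m" for m h
    using a(2)[OF that] \<alpha>(3)[OF that] \<beta>(4)[OF that] Fb that proj_collapse[of "F m h" m] by (simp add: act_Q)
  ultimately show "\<exists>z\<in>splx Q n. pb n z = b \<and> (\<forall>m. \<forall>h\<in>horn n k m. act Q h z = F m h)"
    by (intro bexI[of _ "(a, \<alpha>, \<beta>, b)"]) auto
qed

lemma is_kan_Q: "is_kan Q"
proof (rule is_kanI[OF is_sset_Q])
  fix n k F
  assume n: "1 \<le> n" and k: "k \<le> n" and F: "smap (sub (std n) (horn n k)) Q F"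
  obtain b where b: "b \<in> splx B n" "\<And>m h. h \<in> horn n k m \<Longrightarrow> act B h b = pb m (F m h)"
    using is_kan_horn[OF B n k smap_comp[OF F proj_smap(4)]] by blast
  then obtain z where "z \<in> splx Q n" "\<And>m h. h \<in> horn n k m \<Longrightarrow> act Q h z = F m h"
    using horn_fillD[OF fibration n k b(1) F] by metis
  then show "\<exists>z\<in>splx Q n. \<forall>m. \<forall>h\<in>horn n k m. act Q h z = F m h" by blast
qed

end

text \<open>The case \<open>g = id\<close> is the mapping path space of \<open>w\<close>, as a replacement of its source.\<close>

lemma mapping_path_space_trivial:
  assumes P: "is_kan P" and Q: "is_kan Q" and w: "smap P Q w"
  shows "sphere_fill P (hpullback P Q Q w (\<lambda>n x. x)) (\<lambda>n p e. fst e = p)"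
proof -
  interpret E: homotopy_pullback P Q Q w "\<lambda>n x. x"
    using assms smap_id by unfold_locales
  show ?thesis
    unfolding sphere_fill_def
  proof (intro allI ballI impI, elim conjE)
    fix n p F
    assume p: "p \<in> splx P n" and F: "smap (sub (std n) (boundary n)) E.Q F"
      and Fp: "\<forall>m. \<forall>h\<in>boundary n m. fst (F m h) = act P h p"
    have Fm: "F m h \<in> splx E.Q m" if "h \<in> boundary n m" for m h
      using smap_closed[OF F, of h m] that by simp
    have wp: "w n p \<in> splx Q n" using smap_closed[OF w p] .
    obtain \<alpha> where \<alpha>: "\<alpha> \<in> splx (path_obj Q) n" "path_end 1 n \<alpha> = w n p"
      "\<And>m h. h \<in> boundary n m \<Longrightarrow> act (path_obj Q) h \<alpha> = E.p\<alpha> m (F m h)"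
    proof (rule path_extend[OF Q subcomplex_boundary _ wp smap_comp[OF F E.proj_smap(2)]])
      show "path_end 1 m (E.p\<alpha> m (F m h)) = act Q h (w n p)" if "h \<in> boundary n m" for m h
        using E.proj_ends(2)[OF Fm[OF that]] Fp that smap_act[OF w boundary_dhom[OF that] p]
        by (simp add: E.pa_def)
    qed auto
    have c: "path_end 0 n \<alpha> \<in> splx Q n" using smap_closed[OF path_end_smap \<alpha>(1)] by simp
    \<comment> \<open>The second map being the identity, the end of \<open>\<beta>\<close> is free
      and becomes the last component; so \<open>path_extend\<close> applies and spheres can be
      filled, not just horns.\<close>
    obtain \<beta> where \<beta>: "\<beta> \<in> splx (path_obj Q) n" "path_end 0 n \<beta> = path_end 0 n \<alpha>"
      "\<And>m h. h \<in> boundary n m \<Longrightarrow> act (path_obj Q) h \<beta> = E.p\<beta> m (F m h)"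
    proof (rule path_extend[OF Q subcomplex_boundary _ c smap_comp[OF F E.proj_smap(3)]])
      show "path_end 0 m (E.p\<beta> m (F m h)) = act Q h (path_end 0 n \<alpha>)" if "h \<in> boundary n m" for m h
        using E.proj_ends(1)[OF Fm[OF that]] \<alpha>(3)[OF that]
          smap_act[OF path_end_smap boundary_dhom[OF that] \<alpha>(1), of 0] by simp
    qed auto
    let ?z = "(p, \<alpha>, \<beta>, path_end 1 n \<beta>)"
    have "path_end 1 n \<beta> \<in> splx Q n" using smap_closed[OF path_end_smap \<beta>(1)] by simp
    then have "?z \<in> splx E.Q n" using p \<alpha>(1,2) \<beta>(1,2) by (simp add: E.mem_Q)
    moreover have "act E.Q h ?z = F m h" if h: "h \<in> boundary n m" for m h
    proof -
      have "act Q h (path_end 1 n \<beta>) = E.pb m (F m h)"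
        using smap_act[OF path_end_smap boundary_dhom[OF h] \<beta>(1), of 1] \<beta>(3)[OF h]
          E.proj_ends(3)[OF Fm[OF h]] by simp
      then show ?thesis
        using Fp h \<alpha>(3)[OF h] \<beta>(3)[OF h] E.proj_collapse[of "F m h" m] by (simp add: E.act_Q E.pa_def)
    qed
    ultimately show "\<exists>z\<in>splx E.Q n. fst z = p \<and> (\<forall>m. \<forall>h\<in>boundary n m. act E.Q h z = F m h)"
      by (intro bexI[of _ ?z]) auto
  qed
qed

section \<open>Homotopies\<close>

definition homotopic :: "'a sset \<Rightarrow> 'b sset \<Rightarrow> (nat \<Rightarrow> 'a \<Rightarrow> 'b) \<Rightarrow> (nat \<Rightarrow> 'a \<Rightarrow> 'b) \<Rightarrow> bool" where
  "homotopic K L a b \<longleftrightarrow> (\<exists>H. homotopy K L a b H)"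

lemma homotopicI:
  assumes "smap (sprod K (std 1)) L H" "\<And>n x. x \<in> splx K n \<Longrightarrow> H n (x, dconst n 1 0) = a n x"
    "\<And>n x. x \<in> splx K n \<Longrightarrow> H n (x, dconst n 1 1) = b n x"
  shows "homotopic K L a b"
  using assms unfolding homotopic_def homotopy_def by auto

definition edge :: "nat \<Rightarrow> nat \<Rightarrow> dmap" where
  "edge i j = mk_dmap 1 2 (\<lambda>l. if l = 0 then i else j)"

definition fold_edge :: dmap where
  "fold_edge = mk_dmap 2 1 (\<lambda>l. if l = 0 then 0 else 1)"

lemma edge_dhom [simp]: "i \<le> j \<Longrightarrow> j \<le> 2 \<Longrightarrow> edge i j \<in> dhom 1 2"
  unfolding edge_def by (rule mk_dmap_dhom) auto

lemma fold_edge_dhom [simp]: "fold_edge \<in> dhom 2 1"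
  unfolding fold_edge_def by (rule mk_dmap_dhom) auto

lemma ap_edge: "l \<le> 1 \<Longrightarrow> ap (edge i j) l = (if l = 0 then i else j)"
  by (simp add: edge_def)

lemma ap_fold_edge: "l \<le> 2 \<Longrightarrow> ap fold_edge l = (if l = 0 then 0 else 1)"
  by (simp add: fold_edge_def)

text \<open>The two homotopies form a horn \<open>\<Lambda>\<^sup>2\<^sub>0\<close>; its filler lies over the degenerate triangle
  \<open>fold_edge\<close>, so the third edge is fibrewise.\<close>

lemma glue_homotopies:
  fixes S :: "'s sset" and E :: "'e sset"
  assumes S: "is_sset S" and E: "is_sset E"
    and R: "closed_over (sprod S (std 1)) E R"  "horn_fill (sprod S (std 1)) E R"
    and H: "smap (sprod S (std 1)) E H" "\<And>n x t. x \<in> splx S n \<Longrightarrow> t \<in> dhom n 1 \<Longrightarrow> R n (x, t) (H n (x, t))"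
    and H': "smap (sprod S (std 1)) E H'" "\<And>n x t. x \<in> splx S n \<Longrightarrow> t \<in> dhom n 1 \<Longrightarrow> R n (x, t) (H' n (x, t))"
    and HH': "\<And>n x. x \<in> splx S n \<Longrightarrow> H n (x, dconst n 1 0) = H' n (x, dconst n 1 0)"
  obtains K where "smap (sprod S (std 1)) E K"
    "\<And>n x t. x \<in> splx S n \<Longrightarrow> t \<in> dhom n 1 \<Longrightarrow> R n (x, dconst n 1 1) (K n (x, t))"
    "\<And>n x. x \<in> splx S n \<Longrightarrow> K n (x, dconst n 1 0) = H n (x, dconst n 1 1)"
    "\<And>n x. x \<in> splx S n \<Longrightarrow> K n (x, dconst n 1 1) = H' n (x, dconst n 1 1)"
proof -
  define B where "B m = {(x, f). x \<in> splx S m \<and> f \<in> dhom m 2 \<and> (x \<in> {} \<or> f \<in> horn 2 0 m)}" for m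
  define F where "F m = (\<lambda>(x, f). if \<forall>j\<le>m. ap f j \<noteq> 2 then H m (x, dcomp fold_edge f)
    else H' m (x, dcomp fold_edge f))" for m
  have FH': "F m (x, f) = H' m (x, dcomp fold_edge f)"
    if "x \<in> splx S m" "f \<in> dhom m 2" "\<forall>j\<le>m. ap f j \<noteq> 1" for m x f
  proof (cases "\<forall>j\<le>m. ap f j \<noteq> 2")
    case True
    have "ap f j = 0" if "j \<le> m" for j
      using True ap_le[OF \<open>f \<in> dhom m 2\<close> that] \<open>\<forall>j\<le>m. ap f j \<noteq> 1\<close> that
      by (metis One_nat_def le_Suc_eq le_zero_eq numeral_2_eq_2)
    then have "dcomp fold_edge f = dconst m 1 0"
      by (intro dhom_eqI[OF dcomp_dhom[OF fold_edge_dhom that(2)] dconst_dhom])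
        (auto simp: ap_dcomp[OF that(2)] ap_fold_edge)
    then show ?thesis using HH'[OF that(1)] by (simp add: F_def)
  qed (auto simp: F_def)
  have FH: "F m (x, f) = H m (x, dcomp fold_edge f)" if "\<forall>j\<le>m. ap f j \<noteq> 2" for m x f
    using that by (simp add: F_def)
  have horn: "f \<in> dhom m 2 \<and> ((\<forall>j\<le>m. ap f j \<noteq> 2) \<or> (\<forall>j\<le>m. ap f j \<noteq> 1))" if "f \<in> horn 2 0 m" for f m
  proof -
    obtain l where l: "l \<le> 2" "l \<noteq> 0" "\<forall>j\<le>m. ap f j \<noteq> l" using \<open>f \<in> horn 2 0 m\<close> by (auto simp: horn_def)
    then have "l = 1 \<or> l = 2" by linarith
    then show ?thesis using l horn_dhom[OF that] by auto
  qed
  define \<phi> where "\<phi> = (\<lambda>m::nat. \<lambda>(x::'s, f). (x, dcomp fold_edge f))"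
  have \<phi>: "smap (sprod S (std 2)) (sprod S (std 1)) \<phi>"
    by (rule smapI) (auto simp: \<phi>_def act_closed[OF S] intro: dcomp_dhom[OF fold_edge_dhom]
        dcomp_assoc[OF _ _ fold_edge_dhom, symmetric])
  have F: "smap (sub (sprod S (std 2)) B) E F"
  proof (rule smapI)
    fix m p assume "p \<in> splx (sub (sprod S (std 2)) B) m"
    then obtain x f where p: "p = (x, f)" "x \<in> splx S m" "f \<in> horn 2 0 m" by (auto simp: B_def)
    show "F m p \<in> splx E m"
      using smap_closed[OF H(1), of "(x, _)" m] smap_closed[OF H'(1), of "(x, _)" m]
        dcomp_dhom[OF fold_edge_dhom horn_dhom[OF p(3)]] p by (auto simp: F_def)
  next
    fix g l m p assume g: "g \<in> dhom l m" and "p \<in> splx (sub (sprod S (std 2)) B) m"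
    then obtain x f where p: "p = (x, f)" "x \<in> splx S m" "f \<in> horn 2 0 m" by (auto simp: B_def)
    have f: "f \<in> dhom m 2" using horn_dhom[OF p(3)] .
    have fg: "dcomp f g \<in> dhom l 2" using dcomp_dhom[OF f g] .
    have xg: "act S g x \<in> splx S l" using act_closed[OF S g p(2)] .
    have eq: "dcomp fold_edge (dcomp f g) = dcomp (dcomp fold_edge f) g"
      using dcomp_assoc[OF g f fold_edge_dhom] by simp
    have in1: "(x, dcomp fold_edge f) \<in> splx (sprod S (std 1)) m"
      using p(2) dcomp_dhom[OF fold_edge_dhom f] by simp
    from horn[OF p(3)] consider "\<forall>j\<le>m. ap f j \<noteq> 2" | "\<forall>j\<le>m. ap f j \<noteq> 1" by blast
    then have "F l (act S g x, dcomp f g) = act E g (F m (x, f))"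
    proof cases
      case 1
      then have "\<forall>j\<le>l. ap (dcomp f g) j \<noteq> 2" using ap_le[OF g] by (simp add: ap_dcomp[OF g])
      then show ?thesis using FH[OF 1] FH smap_act[OF H(1) g in1] eq by simp
    next
      case 2
      then have "\<forall>j\<le>l. ap (dcomp f g) j \<noteq> 1" using ap_le[OF g] by (simp add: ap_dcomp[OF g])
      then show ?thesis using FH'[OF p(2) f 2] FH'[OF xg fg] smap_act[OF H'(1) g in1] eq by simp
    qed
    then show "F l (act (sub (sprod S (std 2)) B) g p) = act E g (F m p)" using p by simp
  qed
  obtain T where T: "smap (sprod S (std 2)) E T"
    "\<And>m x f. x \<in> splx S m \<Longrightarrow> f \<in> dhom m 2 \<Longrightarrow> R m (\<phi> m (x, f)) (T m (x, f))"
    "\<And>m x f. (x, f) \<in> B m \<Longrightarrow> T m (x, f) = F m (x, f)"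
  proof (rule horn_extension[OF S E _ horn_fill_pullback[OF R(2) \<phi>] _ _ _ B_def F])
    show "closed_over (sprod S (std 2)) E (\<lambda>m p. R m (\<phi> m p))"
      unfolding closed_over_def
    proof (intro allI ballI impI)
      fix l m f p y assume *: "f \<in> dhom l m" "p \<in> splx (sprod S (std 2)) m" "y \<in> splx E m" "R m (\<phi> m p) y"
      then show "R l (\<phi> l (act (sprod S (std 2)) f p)) (act E f y)"
        using R(1) smap_closed[OF \<phi> *(2)] smap_act[OF \<phi> *(1,2)] unfolding closed_over_def by auto
    qed
    show "subcomplex S (\<lambda>_. {})" by (simp add: subcomplex_def)
    show "R m (\<phi> m (x, f)) (F m (x, f))" if "(x, f) \<in> B m" for m x f
      using that H(2) H'(2) dcomp_dhom[OF fold_edge_dhom] by (auto simp: B_def F_def \<phi>_def)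
  qed auto
  let ?d = "edge 1 2"
  have d: "?d \<in> dhom 1 2" by simp
  have fd: "dcomp fold_edge (dcomp ?d t) = dconst m 1 1" if t: "t \<in> dhom m 1" for m t
    by (rule dhom_eqI[OF dcomp_dhom[OF fold_edge_dhom dcomp_dhom[OF d t]] dconst_dhom])
      (use ap_le[OF t] in \<open>auto simp: ap_dcomp[OF dcomp_dhom[OF d t]] ap_dcomp[OF t] ap_edge ap_fold_edge\<close>)
  have \<psi>: "smap (sprod S (std 1)) (sprod S (std 2)) (\<lambda>m p. (fst p, dcomp ?d (snd p)))"
    by (rule smapI) (auto simp: act_closed[OF S] dcomp_dhom[OF d] dcomp_assoc[OF _ _ d])
  have Tc: "T m (x, dconst m 2 i) = F m (x, dconst m 2 i)" and
    Fc: "F m (x, dconst m 2 i) = (if i = 2 then H' m (x, dconst m 1 1) else H m (x, dconst m 1 1))"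
    if "x \<in> splx S m" "i = 1 \<or> i = 2" for m x i
  proof -
    have "dconst m 2 i \<in> horn 2 0 m"
      using that(2) by (auto simp: horn_def intro!: exI[of _ "if i = 1 then 2 else 1"])
    then show "T m (x, dconst m 2 i) = F m (x, dconst m 2 i)"
      using T(3) that by (auto simp: B_def)
    have "dcomp fold_edge (dconst m 2 i) = dconst m 1 1"
      using that(2) dcomp_dconst_right[OF fold_edge_dhom, of i m] by (auto simp: ap_fold_edge)
    then show "F m (x, dconst m 2 i) = (if i = 2 then H' m (x, dconst m 1 1) else H m (x, dconst m 1 1))"
      using that(2) by (auto simp: F_def)
  qed
  show thesis
  proof (rule that[of "\<lambda>m p. T m (fst p, dcomp ?d (snd p))"])
    show "smap (sprod S (std 1)) E (\<lambda>m p. T m (fst p, dcomp ?d (snd p)))"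
      using smap_comp[OF \<psi> T(1)] .
    show "R m (x, dconst m 1 1) (T m (fst (x, t), dcomp ?d (snd (x, t))))"
      if "x \<in> splx S m" "t \<in> dhom m 1" for m x t
      using T(2)[OF that(1) dcomp_dhom[OF d that(2)]] fd[OF that(2)] by (simp add: \<phi>_def)
    fix m x assume x: "x \<in> splx S m"
    have "dcomp ?d (dconst m 1 0) = dconst m 2 1" "dcomp ?d (dconst m 1 1) = dconst m 2 2"
      using dcomp_dconst_right[OF d] by (simp_all add: ap_edge)
    then show "T m (fst (x, dconst m 1 0), dcomp ?d (snd (x, dconst m 1 0))) = H m (x, dconst m 1 1)"
      "T m (fst (x, dconst m 1 1), dcomp ?d (snd (x, dconst m 1 1))) = H' m (x, dconst m 1 1)"
      using Tc[OF x] Fc[OF x] by simp_all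
  qed
qed

lemma homotopic_cong:
  assumes "homotopic K L a b" "\<And>n x. x \<in> splx K n \<Longrightarrow> a n x = a' n x" "\<And>n x. x \<in> splx K n \<Longrightarrow> b n x = b' n x"
  shows "homotopic K L a' b'"
  using assms unfolding homotopic_def homotopy_def by auto

lemma homotopicE:
  assumes "homotopic K L a b"
  obtains H where "smap (sprod K (std 1)) L H" "\<And>n x. x \<in> splx K n \<Longrightarrow> H n (x, dconst n 1 0) = a n x"
    "\<And>n x. x \<in> splx K n \<Longrightarrow> H n (x, dconst n 1 1) = b n x"
  using assms unfolding homotopic_def homotopy_def by blast

lemma smap_fst: "smap (sprod K L) K (\<lambda>n. fst)"
  by (rule smapI) auto

lemma smap_const_homotopy: "smap K L a \<Longrightarrow> smap (sprod K (std 1)) L (\<lambda>n p. a n (fst p))"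
  by (rule smap_comp[OF smap_fst])

lemma homotopic_refl: "smap K L a \<Longrightarrow> homotopic K L a a"
  by (rule homotopicI[OF smap_const_homotopy]) auto

text \<open>Stated for a common source because, with reflexivity, this one form gives both symmetry
  and transitivity.\<close>

lemma homotopic_glue:
  assumes K: "is_sset K" and L: "is_kan L" and "homotopic K L a b" "homotopic K L a c"
  shows "homotopic K L b c"
proof -
  obtain H where H: "smap (sprod K (std 1)) L H" "\<And>n x. x \<in> splx K n \<Longrightarrow> H n (x, dconst n 1 0) = a n x"
    "\<And>n x. x \<in> splx K n \<Longrightarrow> H n (x, dconst n 1 1) = b n x" using homotopicE[OF assms(3)] by blast
  obtain H' where H': "smap (sprod K (std 1)) L H'" "\<And>n x. x \<in> splx K n \<Longrightarrow> H' n (x, dconst n 1 0) = a n x"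
    "\<And>n x. x \<in> splx K n \<Longrightarrow> H' n (x, dconst n 1 1) = c n x" using homotopicE[OF assms(4)] by blast
  obtain G where "smap (sprod K (std 1)) L G"
    "\<And>n x. x \<in> splx K n \<Longrightarrow> G n (x, dconst n 1 0) = H n (x, dconst n 1 1)"
    "\<And>n x. x \<in> splx K n \<Longrightarrow> G n (x, dconst n 1 1) = H' n (x, dconst n 1 1)"
    by (rule glue_homotopies[OF K is_kan_sset[OF L] closed_over_True is_kan_fill[OF L] H(1) TrueI H'(1) TrueI])
      (use H(2) H'(2) in auto)
  then show ?thesis using H(3) H'(3) by (intro homotopicI) auto
qed

lemma homotopic_sym:
  "is_sset K \<Longrightarrow> is_kan L \<Longrightarrow> smap K L a \<Longrightarrow> homotopic K L a b \<Longrightarrow> homotopic K L b a"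
  using homotopic_glue homotopic_refl by blast

lemma homotopic_trans:
  "is_sset K \<Longrightarrow> is_kan L \<Longrightarrow> smap K L a \<Longrightarrow> homotopic K L a b \<Longrightarrow> homotopic K L b c \<Longrightarrow> homotopic K L a c"
  using homotopic_glue homotopic_sym by blast

lemma homotopic_post:
  assumes "homotopic K L a b" "smap L M p"
  shows "homotopic K M (\<lambda>n x. p n (a n x)) (\<lambda>n x. p n (b n x))"
proof -
  obtain H where H: "smap (sprod K (std 1)) L H" "\<And>n x. x \<in> splx K n \<Longrightarrow> H n (x, dconst n 1 0) = a n x"
    "\<And>n x. x \<in> splx K n \<Longrightarrow> H n (x, dconst n 1 1) = b n x" using homotopicE[OF assms(1)] by blast
  show ?thesis by (rule homotopicI[OF smap_comp[OF H(1) assms(2)]]) (use H in auto)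
qed

lemma homotopic_pre:
  assumes "homotopic K L a b" "smap J K p"
  shows "homotopic J L (\<lambda>n x. a n (p n x)) (\<lambda>n x. b n (p n x))"
proof -
  obtain H where H: "smap (sprod K (std 1)) L H" "\<And>n x. x \<in> splx K n \<Longrightarrow> H n (x, dconst n 1 0) = a n x"
    "\<And>n x. x \<in> splx K n \<Longrightarrow> H n (x, dconst n 1 1) = b n x" using homotopicE[OF assms(1)] by blast
  have "smap (sprod J (std 1)) (sprod K (std 1)) (\<lambda>n q. (p n (fst q), snd q))"
    by (rule smapI) (auto simp: smap_closed[OF assms(2)] smap_act[OF assms(2)])
  from smap_comp[OF this H(1)] show ?thesis
    by (rule homotopicI) (use H smap_closed[OF assms(2)] in auto)
qed

lemma homotopic_path:
  assumes "smap S (path_obj L) G"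
  shows "homotopic S L (\<lambda>n x. path_end 0 n (G n x)) (\<lambda>n x. path_end 1 n (G n x))"
  by (rule homotopicI[OF smap_uncurry[OF assms]]) (auto simp: path_end_def)

section \<open>Homotopies and trivial fibrations\<close>

lemma sphere_fill_pullback:
  assumes "sphere_fill K E R" "smap K' K \<phi>"
  shows "sphere_fill K' E (\<lambda>n x y. R n (\<phi> n x) y)"
  unfolding sphere_fill_def
proof (intro allI ballI impI, elim conjE)
  fix n x F
  assume x: "x \<in> splx K' n" and F: "smap (sub (std n) (boundary n)) E F"
    and FR: "\<forall>m. \<forall>f\<in>boundary n m. R m (\<phi> m (act K' f x)) (F m f)"
  have "R m (act K f (\<phi> n x)) (F m f)" if "f \<in> boundary n m" for m f
    using FR that smap_act[OF assms(2) boundary_dhom x] by metis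
  then show "\<exists>z\<in>splx E n. R n (\<phi> n x) z \<and> (\<forall>m. \<forall>f\<in>boundary n m. act E f z = F m f)"
    using sphere_fillD[OF assms(1) smap_closed[OF assms(2) x] F] by metis
qed

lemma closed_over_pullback:
  assumes "closed_over K E R" "smap K' K \<phi>"
  shows "closed_over K' E (\<lambda>n x y. R n (\<phi> n x) y)"
  unfolding closed_over_def
proof (intro allI ballI impI)
  fix l m f p y assume *: "f \<in> dhom l m" "p \<in> splx K' m" "y \<in> splx E m" "R m (\<phi> m p) y"
  then show "R l (\<phi> l (act K' f p)) (act E f y)"
    using assms(1) smap_closed[OF assms(2) *(2)] smap_act[OF assms(2) *(1,2)]
    unfolding closed_over_def by auto
qed

lemma closed_over_map: "smap E K p \<Longrightarrow> closed_over K E (\<lambda>n x y. p n y = x)"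
  unfolding closed_over_def using smap_act[of E K p] by auto

lemma dconst_1_neq: "dconst m 1 0 \<noteq> dconst m 1 1"
  using ap_dconst[of 0 m 1 0] ap_dconst[of 0 m 1 1] by (metis le0 zero_neq_one)

text \<open>The two ends of the cylinder on \<open>S\<close> form a subcomplex on which
  \<open>a\<close> and \<open>b\<close> prescribe the lift; \<open>sphere_fill_extension\<close>
  lifts the rest of the homotopy.\<close>

lemma homotopic_lift:
  assumes S: "is_sset S" and E: "is_sset E" and r: "smap E P r"
    and fill: "sphere_fill P E (\<lambda>n p e. r n e = p)"
    and a: "smap S E a" and b: "smap S E b"
    and ab: "homotopic S P (\<lambda>n x. r n (a n x)) (\<lambda>n x. r n (b n x))"
  shows "homotopic S E a b"
proof -
  let ?K = "sprod S (std 1)"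
  have K: "is_sset ?K" using S is_sset_std by (rule is_sset_sprod)
  obtain H where H: "smap ?K P H" "\<And>n x. x \<in> splx S n \<Longrightarrow> H n (x, dconst n 1 0) = r n (a n x)"
    "\<And>n x. x \<in> splx S n \<Longrightarrow> H n (x, dconst n 1 1) = r n (b n x)" using homotopicE[OF ab] by blast
  define A where "A n = {(x, t). x \<in> splx S n \<and> (t = dconst n 1 0 \<or> t = dconst n 1 1)}" for n
  define F where "F n = (\<lambda>(x, t). if t = dconst n 1 0 then a n x else b n x)" for n
  have F0: "F n (x, dconst n 1 0) = a n x" and F1: "F n (x, dconst n 1 1) = b n x" for n x
    using dconst_1_neq[of n] by (auto simp: F_def)
  have A: "subcomplex ?K A"
    by (auto simp: subcomplex_def A_def act_closed[OF S] dcomp_dconst_left)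
  have F: "smap (sub ?K A) E F"
    by (rule smapI) (auto simp: A_def F0 F1 smap_closed[OF a] smap_closed[OF b] dcomp_dconst_left
        smap_act[OF a] smap_act[OF b])
  obtain G where G: "smap ?K E G" "\<And>n x. x \<in> A n \<Longrightarrow> G n x = F n x"
    by (rule sphere_fill_extension[OF K E closed_over_pullback[OF closed_over_map[OF r] H(1)]
          sphere_fill_pullback[OF fill H(1)] A F]) (use H(2,3) in \<open>auto simp: A_def F0 F1\<close>)
  show ?thesis
    by (rule homotopicI[OF G(1)]) (use G(2) in \<open>auto simp: A_def F0 F1\<close>)
qed

text \<open>A fibration with a strict section that is a homotopy inverse: the homotopy is made fibrewise
  by gluing it to its own image under the idempotent, which lies over the same homotopy of the
  base.\<close>

lemma fibration_equivalence_trivial: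
  assumes E: "is_sset E" and B: "is_sset B" and p: "smap E B p"
    and fib: "horn_fill B E (\<lambda>n b e. p n e = b)"
    and g: "smap B E g" and pg: "\<And>n b. b \<in> splx B n \<Longrightarrow> p n (g n b) = b"
    and gp: "homotopic E E (\<lambda>n x. g n (p n x)) (\<lambda>n x. x)"
  shows "sphere_fill B E (\<lambda>n b e. p n e = b)"
proof -
  obtain H where H: "smap (sprod E (std 1)) E H"
    "\<And>n x. x \<in> splx E n \<Longrightarrow> H n (x, dconst n 1 0) = g n (p n x)"
    "\<And>n x. x \<in> splx E n \<Longrightarrow> H n (x, dconst n 1 1) = x" using homotopicE[OF gp] by blast
  have pH: "smap (sprod E (std 1)) B (\<lambda>n q. p n (H n q))" by (rule smap_comp[OF H(1) p])
  have gpH: "smap (sprod E (std 1)) E (\<lambda>n q. g n (p n (H n q)))" by (rule smap_comp[OF pH g])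
  have pc: "p n x \<in> splx B n" if "x \<in> splx E n" for n x using smap_closed[OF p that] .
  have Hc: "H n (x, t) \<in> splx E n" if "x \<in> splx E n" "t \<in> dhom n 1" for n x t
    using smap_closed[OF H(1), of "(x, t)" n] that by simp
  \<comment> \<open>\<open>H\<close> and its image under \<open>p\<close> followed by
    \<open>g\<close> both start at \<open>g n (p n x)\<close> and lie over the same homotopy of
    \<open>B\<close>. Gluing them gives a homotopy from the identity to the idempotent that is
    constant in \<open>B\<close>.\<close>
  obtain K where K: "smap (sprod E (std 1)) E K"
    "\<And>n x t. x \<in> splx E n \<Longrightarrow> t \<in> dhom n 1 \<Longrightarrow> p n (K n (x, t)) = p n (H n (x, dconst n 1 1))"
    "\<And>n x. x \<in> splx E n \<Longrightarrow> K n (x, dconst n 1 0) = H n (x, dconst n 1 1)"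
    "\<And>n x. x \<in> splx E n \<Longrightarrow> K n (x, dconst n 1 1) = g n (p n (H n (x, dconst n 1 1)))"
    by (rule glue_homotopies[OF E E closed_over_pullback[OF closed_over_map[OF p] pH]
          horn_fill_pullback[OF fib pH] H(1) refl gpH])
      (use H(2) pg pc Hc smap_closed[OF g] in auto)
  show ?thesis
    unfolding sphere_fill_def
  proof (intro allI ballI impI, elim conjE)
    fix n b F
    assume b: "b \<in> splx B n" and F: "smap (sub (std n) (boundary n)) E F"
      and Fb: "\<forall>m. \<forall>f\<in>boundary n m. p m (F m f) = act B f b"
    have Fc: "F m f \<in> splx E m" if "f \<in> boundary n m" for m f using smap_closed[OF F, of f m] that by simp
    note sb = smap_simplex[OF B b]
    have \<phi>: "smap (sprod (std n) (std 1)) B (\<lambda>m q. act B (fst q) b)"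
      by (rule smap_const_homotopy[OF sb])
    have "smap (sprod (sub (std n) (boundary n)) (std 1)) (sprod E (std 1)) (\<lambda>m q. (F m (fst q), snd q))"
      by (rule smapI) (use Fc smap_act[OF F] in \<open>auto simp: dcomp_dhom\<close>)
    from smap_comp[OF this K(1)]
    have h: "smap (sprod (sub (std n) (boundary n)) (std 1)) E (\<lambda>m q. K m (F m (fst q), snd q))" .
    \<comment> \<open>\<open>K\<close> moves the sphere into the image of the section, where
      \<open>g\<close> applied to \<open>b\<close> fills it; homotopy extension from the end
      \<open>1\<close> carries this filler back to the original sphere at the end
      \<open>0\<close>.\<close>
    obtain G where G: "smap (sprod (std n) (std 1)) E G"
      "\<And>m f t. f \<in> dhom m n \<Longrightarrow> t \<in> dhom m 1 \<Longrightarrow> p m (G m (f, t)) = act B f b"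
      "\<And>m f t. f \<in> boundary n m \<Longrightarrow> t \<in> dhom m 1 \<Longrightarrow> G m (f, t) = K m (F m f, t)"
      by (rule homotopy_extension[OF is_sset_std E closed_over_pullback[OF closed_over_map[OF p] \<phi>]
            horn_fill_pullback[OF fib \<phi>] order_refl subcomplex_boundary smap_comp[OF sb g] _ h])
        (use pg act_closed[OF B _ b] K(2,4) H(3) Fc Fb in auto)
    let ?z = "G n (did n, dconst n 1 0)"
    have "act E f ?z = F m f" if f: "f \<in> boundary n m" for m f
    proof -
      have "act E f ?z = G m (f, dconst m 1 0)"
        using smap_act[OF G(1) boundary_dhom[OF f], of "(did n, dconst n 1 0)"] boundary_dhom[OF f]
        by (simp add: dcomp_did_left dcomp_dconst_left)
      then show ?thesis using G(3)[OF f] K(3)[OF Fc[OF f]] H(3)[OF Fc[OF f]] by simp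
    qed
    moreover have "?z \<in> splx E n" using smap_closed[OF G(1), of "(did n, dconst n 1 0)" n] by simp
    moreover have "p n ?z = b" using G(2)[OF did_dhom] act_did[OF B b] by simp
    ultimately show "\<exists>z\<in>splx E n. p n z = b \<and> (\<forall>m. \<forall>f\<in>boundary n m. act E f z = F m f)" by blast
  qed
qed

text \<open>The projection to \<open>P\<close> is a trivial fibration, so homotopies in the mapping
  path space may be checked in \<open>P\<close>. A strict section over \<open>Q\<close> pairs a
  constant path with the homotopy from \<open>w\<close> after \<open>\<gamma>\<close> to the
  identity; both start at the same point, as the two-path model demands.\<close>

theorem hequiv_trivial_fibration:
  assumes P: "is_kan P" and Q: "is_kan Q" and w: "hequiv P Q w"
  shows "sphere_fill Q (hpullback P Q Q w (\<lambda>n x. x)) (\<lambda>n q e. snd (snd (snd e)) = q)"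
proof -
  obtain \<gamma> where ws: "smap P Q w" and \<gamma>: "smap Q P \<gamma>"
    and \<gamma>w: "homotopic P P (\<lambda>n x. \<gamma> n (w n x)) (\<lambda>n x. x)"
    and w\<gamma>: "homotopic Q Q (\<lambda>n x. w n (\<gamma> n x)) (\<lambda>n x. x)"
    using w unfolding hequiv_def homotopic_def by blast
  interpret E: homotopy_pullback P Q Q w "\<lambda>n x. x"
    using P Q ws smap_id by unfold_locales
  have Q': "is_sset Q" using Q by (rule is_kan_sset)
  obtain H where H: "smap (sprod Q (std 1)) Q H" "\<And>n x. x \<in> splx Q n \<Longrightarrow> H n (x, dconst n 1 0) = w n (\<gamma> n x)"
    "\<And>n x. x \<in> splx Q n \<Longrightarrow> H n (x, dconst n 1 1) = x" using homotopicE[OF w\<gamma>] by blast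
  have c: "smap (sprod Q (std 1)) Q (\<lambda>n q. w n (\<gamma> n (fst q)))"
    by (rule smap_const_homotopy[OF smap_comp[OF \<gamma> ws]])
  define g where "g n q = (\<gamma> n q, adjoint_path Q (\<lambda>n q. w n (\<gamma> n (fst q))) n q, adjoint_path Q H n q, q)" for n q
  have g: "smap Q E.Q g"
    unfolding g_def[abs_def]
    by (rule E.smap_into_Q[OF \<gamma> smap_curry[OF Q' c] smap_curry[OF Q' H(1)] smap_id])
      (use H(2,3) in \<open>auto simp: path_end_adjoint[OF Q']\<close>)
  note E' = E.is_sset_Q
  have c_pb: "homotopic E.Q Q (\<lambda>n e. path_end 0 n (E.p\<alpha> n e)) E.pb"
    by (rule homotopic_cong[OF homotopic_path[OF E.proj_smap(3)]]) (auto simp: E.proj_ends)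
  have c_wpa: "homotopic E.Q Q (\<lambda>n e. path_end 0 n (E.p\<alpha> n e)) (\<lambda>n e. w n (E.pa n e))"
    by (rule homotopic_cong[OF homotopic_path[OF E.proj_smap(2)]]) (auto simp: E.proj_ends)
  \<comment> \<open>The common start of the two paths relates \<open>E.pb\<close> to
    \<open>w\<close> after \<open>E.pa\<close>; applying \<open>\<gamma>\<close> and then the
    homotopy \<open>\<gamma>w\<close> leads to \<open>E.pa\<close>.\<close>
  have "homotopic E.Q P (\<lambda>n e. \<gamma> n (E.pb n e)) (\<lambda>n e. \<gamma> n (w n (E.pa n e)))"
    by (rule homotopic_post[OF homotopic_glue[OF E' Q c_pb c_wpa] \<gamma>])
  moreover have "homotopic E.Q P (\<lambda>n e. \<gamma> n (w n (E.pa n e))) E.pa"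
    by (rule homotopic_pre[OF \<gamma>w E.proj_smap(1)])
  ultimately have "homotopic E.Q P (\<lambda>n e. \<gamma> n (E.pb n e)) E.pa"
    by (rule homotopic_trans[OF E' P smap_comp[OF E.proj_smap(4) \<gamma>]])
  then have "homotopic E.Q P (\<lambda>n e. E.pa n (g n (E.pb n e))) (\<lambda>n e. E.pa n e)"
    by (simp add: g_def)
  moreover have "sphere_fill P E.Q (\<lambda>n p e. E.pa n e = p)"
    using mapping_path_space_trivial[OF P Q ws] by (simp add: E.pa_def)
  ultimately have "homotopic E.Q E.Q (\<lambda>n e. g n (E.pb n e)) (\<lambda>n e. e)"
    using homotopic_lift[OF E' E' E.proj_smap(1) _ smap_comp[OF E.proj_smap(4) g] smap_id] by blast
  then have "sphere_fill Q E.Q (\<lambda>n q e. E.pb n e = q)"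
    by (intro fibration_equivalence_trivial[OF E' Q' E.proj_smap(4) E.fibration g]) (simp_all add: g_def)
  then show ?thesis by (simp add: E.pb_def)
qed

section \<open>Contractibility and monomorphisms\<close>

lemma smap_to_point: "smap K (std 0) (\<lambda>n _. dconst n 0 0)"
  by (rule smapI) (auto simp: dcomp_dconst_left)

text \<open>Filling the empty sphere gives a vertex \<open>v\<close>; the identity and the constant
  map at \<open>v\<close> are then homotopic by lifting along the map to the point.\<close>

lemma sphere_fill_contractible:
  assumes K: "is_sset K" and fill: "sphere_fill (std 0) K (\<lambda>_ _ _. True)"
  shows "contractible K"
proof -
  have no_bd: "boundary 0 m = {}" for m
    using ap_le by (fastforce simp: boundary_def)
  \<comment> \<open>The boundary of the point is empty, so any function is a sphere there.\<close>
  have "smap (sub (std 0) (boundary 0)) K undefined"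
    by (rule smapI) (auto simp: no_bd)
  then have "\<exists>z\<in>splx K 0. True \<and> (\<forall>m. \<forall>f\<in>boundary 0 m. act K f z = undefined m f)"
    by (intro fill[unfolded sphere_fill_def, rule_format, of "dconst 0 0 0"]) (simp_all add: no_bd)
  then obtain v where v: "v \<in> splx K 0" by blast
  have eq: "\<sigma> = dconst n 0 0" if "\<sigma> \<in> splx (std 0) n" for n \<sigma> using that dhom_0 by simp
  have g: "smap (std 0) K (\<lambda>n \<sigma>. act K \<sigma> v)" using smap_simplex[OF K v] .
  have fill': "sphere_fill (std 0) K (\<lambda>n p e. dconst n 0 0 = p)"
    unfolding sphere_fill_def
  proof (intro allI ballI impI, elim conjE)
    fix n x F assume x: "x \<in> splx (std 0) n" and F: "smap (sub (std n) (boundary n)) K F"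
    have "\<exists>z\<in>splx K n. True \<and> (\<forall>m. \<forall>f\<in>boundary n m. act K f z = F m f)"
      by (rule fill[unfolded sphere_fill_def, rule_format, OF x]) (use F in auto)
    then show "\<exists>z\<in>splx K n. dconst n 0 0 = x \<and> (\<forall>m. \<forall>f\<in>boundary n m. act K f z = F m f)"
      by (simp add: eq[OF x])
  qed
  have "homotopic K K (\<lambda>n x. act K (dconst n 0 0) v) (\<lambda>n x. x)"
    by (rule homotopic_lift[OF K K smap_to_point fill' smap_comp[OF smap_to_point g] smap_id
          homotopic_refl[OF smap_to_point]])
  moreover have "homotopic (std 0) (std 0) (\<lambda>n x. dconst n 0 0) (\<lambda>n x. x)"
    by (rule homotopic_cong[OF homotopic_refl[OF smap_to_point]]) (use eq in auto)
  ultimately show ?thesis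
    unfolding contractible_def hequiv_def homotopic_def using smap_to_point g by blast
qed

text \<open>The contraction runs from a constant map to the identity: homotopy extension from the
  constant simplex at the end \<open>0\<close> yields a filler of the sphere at the end
  \<open>1\<close>.\<close>

lemma contractible_sphere_fill:
  assumes K: "is_kan K" and "contractible K"
  shows "sphere_fill (std 0) K (\<lambda>_ _ _. True)"
  unfolding sphere_fill_def
proof (intro allI ballI impI, elim conjE)
  fix n F assume F: "smap (sub (std n) (boundary n)) K F"
  note K' = is_kan_sset[OF K]
  obtain g where g: "smap (std 0) K g" and gH: "homotopic K K (\<lambda>n x. g n (dconst n 0 0)) (\<lambda>n x. x)"
    using assms(2) unfolding contractible_def hequiv_def homotopic_def by blast
  obtain H where H: "smap (sprod K (std 1)) K H" "\<And>n x. x \<in> splx K n \<Longrightarrow> H n (x, dconst n 1 0) = g n (dconst n 0 0)"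
    "\<And>n x. x \<in> splx K n \<Longrightarrow> H n (x, dconst n 1 1) = x" using homotopicE[OF gH] by blast
  have Fc: "F m f \<in> splx K m" if "f \<in> boundary n m" for m f using smap_closed[OF F, of f m] that by simp
  have "smap (sprod (sub (std n) (boundary n)) (std 1)) (sprod K (std 1)) (\<lambda>m q. (F m (fst q), snd q))"
    by (rule smapI) (use Fc smap_act[OF F] in \<open>auto simp: dcomp_dhom\<close>)
  from smap_comp[OF this H(1)]
  have h: "smap (sprod (sub (std n) (boundary n)) (std 1)) K (\<lambda>m q. H m (F m (fst q), snd q))" .
  obtain G where G: "smap (sprod (std n) (std 1)) K G"
    "\<And>m f t. f \<in> boundary n m \<Longrightarrow> t \<in> dhom m 1 \<Longrightarrow> G m (f, t) = H m (F m f, t)"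
    by (rule homotopy_extension[OF is_sset_std K' closed_over_True is_kan_fill[OF K] le0 subcomplex_boundary
          smap_comp[OF smap_to_point g] _ h]) (use H(2) Fc in auto)
  let ?z = "G n (did n, dconst n 1 1)"
  have "act K f ?z = F m f" if f: "f \<in> boundary n m" for m f
  proof -
    have "act K f ?z = G m (f, dconst m 1 1)"
      using smap_act[OF G(1) boundary_dhom[OF f], of "(did n, dconst n 1 1)"] boundary_dhom[OF f]
      by (simp add: dcomp_did_left dcomp_dconst_left)
    then show ?thesis using G(2)[OF f] H(3)[OF Fc[OF f]] by simp
  qed
  moreover have "?z \<in> splx K n" using smap_closed[OF G(1), of "(did n, dconst n 1 1)" n] by simp
  ultimately show "\<exists>z\<in>splx K n. True \<and> (\<forall>m. \<forall>f\<in>boundary n m. act K f z = F m f)" by blast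
qed

section \<open>Fibres of a map equivalent to a homotopy base change\<close>

context homotopy_pullback
begin

lemma lift_homotopy:
  assumes S: "is_sset S" and c: "smap S Q c" and \<gamma>: "smap (sprod S (std 1)) B \<gamma>" and e: "e \<le> 1"
    and eq: "\<And>n x. x \<in> splx S n \<Longrightarrow> \<gamma> n (x, dconst n 1 e) = pb n (c n x)"
  obtains \<omega> where "smap (sprod S (std 1)) Q \<omega>" "\<And>n x. x \<in> splx S n \<Longrightarrow> \<omega> n (x, dconst n 1 e) = c n x"
    "\<And>n x t. x \<in> splx S n \<Longrightarrow> t \<in> dhom n 1 \<Longrightarrow> pb n (\<omega> n (x, t)) = \<gamma> n (x, t)"
proof -
  have em: "smap (sprod (sub S (\<lambda>_. {})) (std 1)) Q undefined" by (rule smapI) auto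
  obtain H where "smap (sprod S (std 1)) Q H" "\<And>n x. x \<in> splx S n \<Longrightarrow> H n (x, dconst n 1 e) = c n x"
    "\<And>n x t. x \<in> splx S n \<Longrightarrow> t \<in> dhom n 1 \<Longrightarrow> pb n (H n (x, t)) = \<gamma> n (x, t)"
    by (rule homotopy_extension[OF S is_sset_Q closed_over_pullback[OF closed_over_pb \<gamma>]
          horn_fill_pullback[OF fibration \<gamma>] e _ c _ em]) (use eq in \<open>auto simp: subcomplex_def\<close>)
  then show thesis using that by blast
qed

text \<open>A sphere in the fibre of \<open>v\<close> is carried along the lifts of its two families of paths to a
  sphere in the fibre of \<open>pb\<close> over \<open>b\<close>, which is the fibre of \<open>f\<close> over \<open>g b\<close>.  A filler there is
  pulled back along the trivial fibration onto \<open>Q\<close>; as the lifted paths are part of the data of the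
  mapping path space, no paths have to be composed.\<close>

lemma hfibre_pullback:
  assumes P: "is_kan P" and w: "hequiv P Q w" and v: "smap P B v"
    and vw: "\<And>n x. x \<in> splx P n \<Longrightarrow> v n x = pb n (w n x)"
    and b: "b \<in> splx B 0"
    and mono: "empty_sset (hfibre A C f (g 0 b)) \<or> contractible (hfibre A C f (g 0 b))"
  shows "empty_sset (hfibre P B v b) \<or> contractible (hfibre P B v b)"
proof -
  have ws: "smap P Q w" using w by (simp add: hequiv_def)
  have B': "is_sset B" and C': "is_sset C" using B C by (auto intro: is_kan_sset)
  have pt: "smap (std 0) B (point_map B b)" "smap (std 0) C (point_map C (g 0 b))"
    unfolding point_map_def[abs_def]
    by (rule smap_simplex[OF B' b], rule smap_simplex[OF C' smap_closed[OF g b]])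
  interpret Z: homotopy_pullback P "std 0" B v "point_map B b"
    using P B v pt is_kan_std_0 by unfold_locales
  interpret Y: homotopy_pullback A "std 0" C f "point_map C (g 0 b)"
    using A C f pt is_kan_std_0 by unfold_locales
  interpret E: homotopy_pullback P Q Q w "\<lambda>n x. x"
    using P is_kan_Q ws smap_id by unfold_locales
  define bn where "bn n = act B (dconst n 0 0) b" for n
  have bn: "bn n \<in> splx B n" for n unfolding bn_def by (rule act_closed[OF B' dconst_dhom b]) simp
  have g_bn: "point_map C (g 0 b) n (dconst n 0 0) = g n (bn n)" for n
    using smap_act[OF g dconst_dhom[of 0 0 n] b] by (simp add: bn_def point_map_def)
  have act_bn: "act B h (bn n) = bn m" if h: "h \<in> dhom m n" for h m n
    using act_dcomp[OF B' h dconst_dhom b] dcomp_dconst_left[OF h, of 0 0] by (simp add: bn_def)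
  \<comment> \<open>Over the degeneracies of \<open>b\<close> the last component is determined, so
    the strict fibre of \<open>pb\<close> over \<open>b\<close> and the homotopy fibre of
    \<open>f\<close> over \<open>g 0 b\<close> have corresponding simplices.\<close>
  have to_Y: "(pa n q, p\<alpha> n q, p\<beta> n q, dconst n 0 0) \<in> splx Y.Q n"
    if "q \<in> splx Q n" "pb n q = bn n" for n q
    using that g_bn[of n] by (cases q) (simp add: mem_Q Y.mem_Q)
  have from_Y: "(Y.pa n y, Y.p\<alpha> n y, Y.p\<beta> n y, bn n) \<in> splx Q n" if "y \<in> splx Y.Q n" for n y
  proof -
    obtain a \<alpha> \<beta> \<sigma> where y: "y = (a, \<alpha>, \<beta>, \<sigma>)" by (cases y)
    moreover have "\<sigma> = dconst n 0 0" using that y dhom_0 by (simp add: Y.mem_Q)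
    ultimately show ?thesis using that bn[of n] g_bn[of n] by (simp add: mem_Q Y.mem_Q)
  qed
  \<comment> \<open>A simplex of the fibre of \<open>v\<close> contains two paths in
    \<open>B\<close> with a common start, one to \<open>v n p\<close> and one to
    \<open>bn n\<close>. The first is lifted backwards from \<open>w n p\<close>, giving
    \<open>\<omega>\<close>; the second is lifted forwards from the start of
    \<open>\<omega>\<close>, giving \<open>\<omega>'\<close>.\<close>
  have transport: "\<exists>\<omega> \<omega>'. smap (sprod S (std 1)) Q \<omega> \<and> smap (sprod S (std 1)) Q \<omega>' \<and>
      (\<forall>n. \<forall>x\<in>splx S n. \<omega> n (x, dconst n 1 1) = w n (Z.pa n (F n x)) \<and>
         \<omega> n (x, dconst n 1 0) = \<omega>' n (x, dconst n 1 0) \<and>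
         pb n (\<omega>' n (x, dconst n 1 1)) = bn n \<and>
         (\<forall>t\<in>dhom n 1. pb n (\<omega> n (x, t)) = Z.p\<alpha> n (F n x) n (did n, t) \<and>
            pb n (\<omega>' n (x, t)) = Z.p\<beta> n (F n x) n (did n, t)))"
    if S: "is_sset S" and F: "smap S Z.Q F" for S :: "dmap sset" and F
  proof -
    have Fc: "F n x \<in> splx Z.Q n" if "x \<in> splx S n" for n x using smap_closed[OF F that] .
    have c: "smap S Q (\<lambda>n x. w n (Z.pa n (F n x)))"
      by (rule smap_comp[OF smap_comp[OF F Z.proj_smap(1)] ws])
    note \<gamma> = smap_uncurry[OF smap_comp[OF F Z.proj_smap(2)]]
    note \<delta> = smap_uncurry[OF smap_comp[OF F Z.proj_smap(3)]]
    obtain \<omega> where \<omega>: "smap (sprod S (std 1)) Q \<omega>"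
      "\<And>n x. x \<in> splx S n \<Longrightarrow> \<omega> n (x, dconst n 1 1) = w n (Z.pa n (F n x))"
      "\<And>n x t. x \<in> splx S n \<Longrightarrow> t \<in> dhom n 1 \<Longrightarrow> pb n (\<omega> n (x, t)) = Z.p\<alpha> n (F n x) n (did n, t)"
    proof (rule lift_homotopy[OF S c \<gamma> order_refl])
      show "(case (x, dconst n 1 1) of (x, t) \<Rightarrow> Z.p\<alpha> n (F n x) n (did n, t)) = pb n (w n (Z.pa n (F n x)))"
        if "x \<in> splx S n" for n x
        using Z.proj_ends(2)[OF Fc[OF that]] vw[OF smap_closed[OF Z.proj_smap(1) Fc[OF that]]]
        by (simp add: path_end_def)
    qed simp
    have c': "smap S Q (\<lambda>n x. \<omega> n (x, dconst n 1 0))"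
    proof -
      have "smap S (sprod S (std 1)) (\<lambda>n x. (x, dconst n 1 0))"
        by (rule smapI) (auto simp: dcomp_dconst_left)
      from smap_comp[OF this \<omega>(1)] show ?thesis .
    qed
    obtain \<omega>' where \<omega>': "smap (sprod S (std 1)) Q \<omega>'"
      "\<And>n x. x \<in> splx S n \<Longrightarrow> \<omega>' n (x, dconst n 1 0) = \<omega> n (x, dconst n 1 0)"
      "\<And>n x t. x \<in> splx S n \<Longrightarrow> t \<in> dhom n 1 \<Longrightarrow> pb n (\<omega>' n (x, t)) = Z.p\<beta> n (F n x) n (did n, t)"
    proof (rule lift_homotopy[OF S c' \<delta> le0])
      show "(case (x, dconst n 1 0) of (x, t) \<Rightarrow> Z.p\<beta> n (F n x) n (did n, t)) = pb n (\<omega> n (x, dconst n 1 0))"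
        if "x \<in> splx S n" for n x
        using Z.proj_ends(1)[OF Fc[OF that]] \<omega>(3)[OF that, of "dconst n 1 0"] by (simp add: path_end_def)
    qed simp
    have "pb n (\<omega>' n (x, dconst n 1 1)) = bn n" if x: "x \<in> splx S n" for n x
    proof -
      have "Z.pb n (F n x) = dconst n 0 0"
        using smap_closed[OF Z.proj_smap(4) Fc[OF x]] dhom_0 by simp
      then show ?thesis
        using Z.proj_ends(3)[OF Fc[OF x]] \<omega>'(3)[OF x, of "dconst n 1 1"]
        by (simp add: path_end_def point_map_def bn_def)
    qed
    then show ?thesis using \<omega> \<omega>' by (intro exI[of _ \<omega>] exI[of _ \<omega>']) auto
  qed
  show ?thesis
  proof (cases "empty_sset Z.Q")
    case False
    then obtain n z where z: "z \<in> splx Z.Q n" by (auto simp: empty_sset_def)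
    obtain \<omega>' where \<omega>': "smap (sprod (std n) (std 1)) Q \<omega>'"
      "\<forall>m. \<forall>x\<in>splx (std n) m. pb m (\<omega>' m (x, dconst m 1 1)) = bn m"
      using transport[OF is_sset_std smap_simplex[OF Z.is_sset_Q z]] by blast
    \<comment> \<open>A single simplex in the fibre of \<open>v\<close> is transported to one in the
      fibre of \<open>f\<close>, which excludes the empty alternative of
      \<open>mono\<close>.\<close>
    have "\<omega>' n (did n, dconst n 1 1) \<in> splx Q n"
      using smap_closed[OF \<omega>'(1), of "(did n, dconst n 1 1)" n] by simp
    then have "splx Y.Q n \<noteq> {}" using to_Y \<omega>'(2) by (metis did_dhom empty_iff splx_std)
    then have "contractible Y.Q" using mono by (auto simp: hfibre_def empty_sset_def)
    then have Y_fill: "sphere_fill (std 0) Y.Q (\<lambda>_ _ _. True)"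
      by (rule contractible_sphere_fill[OF Y.is_kan_Q])
    have "sphere_fill (std 0) Z.Q (\<lambda>_ _ _. True)"
      unfolding sphere_fill_def
    proof (intro allI ballI impI, elim conjE)
      fix n F assume F: "smap (sub (std n) (boundary n)) Z.Q F"
      let ?S = "sub (std n) (boundary n)"
      have S: "is_sset ?S" by (rule is_sset_sub[OF is_sset_std subcomplex_boundary])
      have Fc: "F m h \<in> splx Z.Q m" if "h \<in> boundary n m" for m h
        using smap_closed[OF F, of h m] that by simp
      obtain \<omega> \<omega>' where \<omega>: "smap (sprod ?S (std 1)) Q \<omega>" and \<omega>': "smap (sprod ?S (std 1)) Q \<omega>'"
        and \<omega>1: "\<And>m h. h \<in> boundary n m \<Longrightarrow> \<omega> m (h, dconst m 1 1) = w m (Z.pa m (F m h))"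
        and \<omega>0: "\<And>m h. h \<in> boundary n m \<Longrightarrow> \<omega> m (h, dconst m 1 0) = \<omega>' m (h, dconst m 1 0)"
        and \<omega>'1: "\<And>m h. h \<in> boundary n m \<Longrightarrow> pb m (\<omega>' m (h, dconst m 1 1)) = bn m"
        and \<omega>B: "\<And>m h t. h \<in> boundary n m \<Longrightarrow> t \<in> dhom m 1 \<Longrightarrow>
          pb m (\<omega> m (h, t)) = Z.p\<alpha> m (F m h) m (did m, t)"
        and \<omega>'B: "\<And>m h t. h \<in> boundary n m \<Longrightarrow> t \<in> dhom m 1 \<Longrightarrow>
          pb m (\<omega>' m (h, t)) = Z.p\<beta> m (F m h) m (did m, t)"
        using transport[OF S F] unfolding sub_simps by blast
      define q where "q m h = \<omega>' m (h, dconst m 1 1)" for m h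
      have cst: "smap ?S (sprod ?S (std 1)) (\<lambda>m h. (h, dconst m 1 1))"
        by (rule smapI) (auto simp: dcomp_dconst_left)
      have q: "smap ?S Q q" unfolding q_def[abs_def] by (rule smap_comp[OF cst \<omega>'])
      have qY: "smap ?S Y.Q (\<lambda>m h. (pa m (q m h), p\<alpha> m (q m h), p\<beta> m (q m h), dconst m 0 0))"
      proof (rule smapI)
        show "(pa m (q m h), p\<alpha> m (q m h), p\<beta> m (q m h), dconst m 0 0) \<in> splx Y.Q m"
          if "h \<in> splx ?S m" for m h
          using to_Y[OF smap_closed[OF q that]] \<omega>'1 that by (simp add: q_def)
      qed (use smap_act[OF smap_comp[OF q proj_smap(1)]] smap_act[OF smap_comp[OF q proj_smap(2)]]
          smap_act[OF smap_comp[OF q proj_smap(3)]] in \<open>auto simp: Y.act_Q dcomp_dconst_left\<close>)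
      have "dconst n 0 0 \<in> splx (std 0) n" by simp
      then obtain y where y: "y \<in> splx Y.Q n" "\<And>m h. h \<in> boundary n m \<Longrightarrow>
          act Y.Q h y = (pa m (q m h), p\<alpha> m (q m h), p\<beta> m (q m h), dconst m 0 0)"
        using sphere_fillD[OF Y_fill _ qY] by blast
      define qn where "qn = (Y.pa n y, Y.p\<alpha> n y, Y.p\<beta> n y, bn n)"
      have qn: "qn \<in> splx Q n" unfolding qn_def by (rule from_Y[OF y(1)])
      have qn_act: "act Q h qn = q m h" if h: "h \<in> boundary n m" for m h
      proof -
        have "act Y.Q h (Y.pa n y, Y.p\<alpha> n y, Y.p\<beta> n y, Y.pb n y) =
            (pa m (q m h), p\<alpha> m (q m h), p\<beta> m (q m h), dconst m 0 0)"
          using y(2)[OF h] Y.proj_collapse[of y n] by simp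
        moreover have "pb m (q m h) = bn m" using \<omega>'1[OF h] by (simp add: q_def)
        ultimately show ?thesis
          using act_bn[OF boundary_dhom[OF h]] proj_collapse[of "q m h" m] by (simp add: qn_def act_Q Y.act_Q)
      qed
      \<comment> \<open>The two lifted paths and the end \<open>q\<close> of the transport form a
        sphere in the mapping path space of \<open>w\<close>, lying over \<open>qn\<close>.\<close>
      define e where "e m h = (Z.pa m (F m h), adjoint_path ?S \<omega> m h, adjoint_path ?S \<omega>' m h, q m h)" for m h
      have e: "smap ?S E.Q e"
        unfolding e_def[abs_def]
        by (rule E.smap_into_Q[OF smap_comp[OF F Z.proj_smap(1)] smap_curry[OF S \<omega>] smap_curry[OF S \<omega>'] q])
          (use \<omega>0 \<omega>1 in \<open>auto simp: path_end_adjoint[OF S] q_def\<close>)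
      have e_pb: "snd (snd (snd (e m h))) = act Q h qn" if "h \<in> boundary n m" for m h
        using qn_act[OF that] by (simp add: e_def)
      obtain z where z: "z \<in> splx E.Q n" "snd (snd (snd z)) = qn"
        "\<And>m h. h \<in> boundary n m \<Longrightarrow> act E.Q h z = e m h"
        using sphere_fillD[OF hequiv_trivial_fibration[OF P is_kan_Q w] qn e e_pb] by blast
      obtain p \<alpha> \<beta> where zz: "z = (p, \<alpha>, \<beta>, qn)" using z(2) by (cases z) auto
      have zE: "p \<in> splx P n" "\<alpha> \<in> splx (path_obj Q) n" "\<beta> \<in> splx (path_obj Q) n"
        "path_end 0 n \<alpha> = path_end 0 n \<beta>" "path_end 1 n \<alpha> = w n p" "path_end 1 n \<beta> = qn"
        using z(1) by (simp_all add: zz E.mem_Q)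
      \<comment> \<open>Projected to \<open>B\<close>, the paths of the filler lead from a common
        start to \<open>v n p\<close> and to \<open>bn n\<close>, as a simplex of the fibre of
        \<open>v\<close> requires. On the boundary they return the original paths, over which the
        lifts were taken.\<close>
      let ?x = "(p, path_map pb n \<alpha>, path_map pb n \<beta>, dconst n 0 0)"
      have x: "?x \<in> splx Z.Q n"
        using zE path_map_closed[OF proj_smap(4) zE(2)] path_map_closed[OF proj_smap(4) zE(3)]
        by (simp add: Z.mem_Q path_end_path_map vw qn_def point_map_def bn_def)
      have "act Z.Q h ?x = F m h" if h: "h \<in> boundary n m" for m h
      proof -
        have h': "h \<in> dhom m n" using boundary_dhom[OF h] .
        have zh: "act P h p = Z.pa m (F m h)" "act (path_obj Q) h \<alpha> = adjoint_path ?S \<omega> m h"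
          "act (path_obj Q) h \<beta> = adjoint_path ?S \<omega>' m h"
          using z(3)[OF h] by (simp_all add: zz E.act_Q e_def)
        have adj: "path_map pb m (adjoint_path ?S \<theta> m h) = \<xi> m (F m h)"
          if \<theta>: "smap (sprod ?S (std 1)) Q \<theta>" and \<xi>: "smap Z.Q (path_obj B) \<xi>"
            and eq: "\<And>m h t. h \<in> boundary n m \<Longrightarrow> t \<in> dhom m 1 \<Longrightarrow> pb m (\<theta> m (h, t)) = \<xi> m (F m h) m (did m, t)"
          for \<theta> \<xi>
        proof (rule path_eqI)
          note F\<xi> = smap_comp[OF F \<xi>]
          show c: "\<xi> m (F m h) \<in> splx (path_obj B) m" using smap_closed[OF F\<xi>, of h m] h by simp
          show "path_map pb m (adjoint_path ?S \<theta> m h) \<in> splx (path_obj B) m"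
            by (rule path_map_closed[OF proj_smap(4) adjoint_path_closed[OF S \<theta>]]) (use h in simp)
          fix l k t assume k: "k \<in> dhom l m" and t: "t \<in> dhom l 1"
          have "path_map pb m (adjoint_path ?S \<theta> m h) l (k, t) = pb l (\<theta> l (dcomp h k, t))"
            using k t by (simp add: path_map_apply adjoint_path_apply)
          also have "\<dots> = \<xi> l (F l (dcomp h k)) l (did l, t)" by (rule eq[OF boundary_dcomp[OF h k] t])
          also have "\<xi> l (F l (dcomp h k)) = act (path_obj B) k (\<xi> m (F m h))"
            using smap_act[OF F\<xi> k, of h] h by simp
          also have "\<dots> l (did l, t) = \<xi> m (F m h) l (k, t)" using path_eval[OF c k t] by simp
          finally show "path_map pb m (adjoint_path ?S \<theta> m h) l (k, t) = \<xi> m (F m h) l (k, t)" .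
        qed
        have "Z.pb m (F m h) = dconst m 0 0"
          using smap_closed[OF Z.proj_smap(4) Fc[OF h]] dhom_0 by simp
        then show ?thesis
          using zh path_map_act[OF proj_smap(4) h' zE(2)] path_map_act[OF proj_smap(4) h' zE(3)]
            adj[OF \<omega> Z.proj_smap(2) \<omega>B] adj[OF \<omega>' Z.proj_smap(3) \<omega>'B] Z.proj_collapse[of "F m h" m]
          by (simp add: Z.act_Q dcomp_dconst_left[OF h'])
      qed
      then show "\<exists>z\<in>splx Z.Q n. True \<and> (\<forall>m. \<forall>h\<in>boundary n m. act Z.Q h z = F m h)"
        using x by (intro bexI[of _ ?x]) auto
    qed
    then show ?thesis using sphere_fill_contractible[OF Z.is_sset_Q] by (simp add: hfibre_def)
  qed (simp add: hfibre_def)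
qed

end

section \<open>Path components\<close>

lemma homotopic_vertex:
  assumes K: "is_sset K" and "homotopic K L a b" and x: "x \<in> splx K 0"
  shows "path_connected L (a 0 x) (b 0 x)"
proof -
  obtain H where H: "smap (sprod K (std 1)) L H" "\<And>n x. x \<in> splx K n \<Longrightarrow> H n (x, dconst n 1 0) = a n x"
    "\<And>n x. x \<in> splx K n \<Longrightarrow> H n (x, dconst n 1 1) = b n x" using homotopicE[OF assms(2)] by blast
  let ?x = "act K (dconst 1 0 0) x"
  have x': "?x \<in> splx K 1" using act_closed[OF K dconst_dhom x] by simp
  have "act K (dconst 0 1 j) ?x = x" if "j \<le> 1" for j
  proof -
    have "dcomp (dconst 1 0 0) (dconst 0 1 j) = did 0"
      by (rule dhom_eqI[OF dcomp_dhom[OF dconst_dhom dconst_dhom] did_dhom])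
        (use that in \<open>auto simp: ap_dcomp[OF dconst_dhom[OF that]]\<close>)
    then show ?thesis
      using act_dcomp[OF K dconst_dhom[OF that, of 0] dconst_dhom[of 0 0 1] x] act_did[OF K x] by simp
  qed
  then have "act L (dconst 0 1 j) (H 1 (?x, did 1)) = H 0 (x, dconst 0 1 j)" if "j \<le> 1" for j
    using smap_act[OF H(1) dconst_dhom[OF that], of "(?x, did 1)" 0] x' that
    by (simp add: dcomp_did_left[OF dconst_dhom])
  moreover have "H 1 (?x, did 1) \<in> splx L 1" using smap_closed[OF H(1), of "(?x, did 1)" 1] x' by simp
  ultimately show ?thesis using H(2,3)[OF x] unfolding path_connected_def
    by (intro bexI[of _ "H 1 (?x, did 1)"]) auto
qed

lemma path_connected_homotopic:
  assumes L: "is_sset L" and "path_connected L x y"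
  shows "homotopic (std 0) L (\<lambda>n \<sigma>. act L \<sigma> x) (\<lambda>n \<sigma>. act L \<sigma> y)"
proof -
  obtain e where e: "e \<in> splx L 1" "act L (dconst 0 1 0) e = x" "act L (dconst 0 1 1) e = y"
    using assms(2) by (auto simp: path_connected_def)
  have *: "act L (dconst n 1 j) e = act L \<sigma> (act L (dconst 0 1 j) e)" if "\<sigma> \<in> dhom n 0" "j \<le> 1" for n \<sigma> j
    using act_dcomp[OF L that(1) dconst_dhom[OF that(2)] e(1)] dcomp_dconst_left[OF that] by simp
  have "smap (sprod (std 0) (std 1)) (std 1) (\<lambda>n. snd)" by (rule smapI) auto
  from smap_comp[OF this smap_simplex[OF L e(1)]] show ?thesis
    by (rule homotopicI) (use * e in auto)
qed

text \<open>Seen as maps from \<open>std 0\<close>, points inherit the equivalence relation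
  properties from \<open>homotopic\<close>.\<close>

lemma path_connected_iff:
  assumes L: "is_sset L" and x: "x \<in> splx L 0" and y: "y \<in> splx L 0"
  shows "path_connected L x y \<longleftrightarrow> homotopic (std 0) L (\<lambda>n \<sigma>. act L \<sigma> x) (\<lambda>n \<sigma>. act L \<sigma> y)"
proof
  assume "homotopic (std 0) L (\<lambda>n \<sigma>. act L \<sigma> x) (\<lambda>n \<sigma>. act L \<sigma> y)"
  from homotopic_vertex[OF is_sset_std this, of "did 0"] show "path_connected L x y"
    using act_did[OF L x] act_did[OF L y] by simp
qed (rule path_connected_homotopic[OF L])

lemma path_connected_refl: "is_kan L \<Longrightarrow> x \<in> splx L 0 \<Longrightarrow> path_connected L x x"
  by (simp add: path_connected_iff is_kan_sset homotopic_refl smap_simplex)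

lemma path_connected_sym:
  assumes L: "is_kan L" and "x \<in> splx L 0" "y \<in> splx L 0" "path_connected L x y"
  shows "path_connected L y x"
  using assms homotopic_sym[OF is_sset_std L smap_simplex[OF is_kan_sset[OF L]]]
  by (simp add: path_connected_iff is_kan_sset)

lemma path_connected_trans:
  assumes L: "is_kan L" and "x \<in> splx L 0" "y \<in> splx L 0" "z \<in> splx L 0"
    and xy: "path_connected L x y" and yz: "path_connected L y z"
  shows "path_connected L x z"
proof -
  note L' = is_kan_sset[OF L]
  have "homotopic (std 0) L (\<lambda>n \<sigma>. act L \<sigma> x) (\<lambda>n \<sigma>. act L \<sigma> z)"
    by (rule homotopic_trans[OF is_sset_std L smap_simplex[OF L' assms(2)]
          path_connected_homotopic[OF L' xy] path_connected_homotopic[OF L' yz]])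
  then show ?thesis using path_connected_iff[OF L' assms(2,4)] by simp
qed

lemma path_connected_smap:
  assumes "smap K L f" "path_connected K x y"
  shows "path_connected L (f 0 x) (f 0 y)"
proof -
  obtain e where e: "e \<in> splx K 1" "act K (dconst 0 1 0) e = x" "act K (dconst 0 1 1) e = y"
    using assms(2) by (auto simp: path_connected_def)
  have "act L (dconst 0 1 j) (f 1 e) = f 0 (act K (dconst 0 1 j) e)" if "j \<le> 1" for j
    using smap_act[OF assms(1) dconst_dhom[OF that] e(1)] by simp
  then show ?thesis
    using e smap_closed[OF assms(1) e(1)] unfolding path_connected_def by (intro bexI[of _ "f 1 e"]) auto
qed

text \<open>One edge serves for both paths: the first is constant at \<open>f 0 a\<close>, the
  second is the edge.\<close>

lemma hpullback_vertex:
  assumes C: "is_sset C" and "a \<in> splx A 0" "b \<in> splx B 0" and fa: "f 0 a \<in> splx C 0"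
    and "path_connected C (f 0 a) (g 0 b)"
  obtains \<alpha> \<beta> where "(a, \<alpha>, \<beta>, b) \<in> splx (hpullback A B C f g) 0"
proof -
  obtain e where e: "e \<in> splx C 1" "act C (dconst 0 1 0) e = f 0 a" "act C (dconst 0 1 1) e = g 0 b"
    using assms(5) by (auto simp: path_connected_def)
  have "smap (sprod (std 0) (std 1)) (std 1) (\<lambda>n. snd)" by (rule smapI) auto
  note s1 = smap_comp[OF this smap_simplex[OF C e(1)]]
  note s2 = smap_const_homotopy[OF smap_simplex[OF C fa]]
  have d: "dconst 0 1 0 \<in> dhom 0 1" "dconst 0 1 1 \<in> dhom 0 1" by simp_all
  show thesis
  proof (rule that)
    show "(a, path_restrict 0 (\<lambda>n p. act C (fst p) (f 0 a)), path_restrict 0 (\<lambda>n p. act C (snd p) e), b)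
      \<in> splx (hpullback A B C f g) 0"
      using assms e act_did[OF C fa] path_objI[OF s1] path_objI[OF s2] d
      by (simp add: hpullback_def path_end_def path_restrict_apply)
  qed
qed

text \<open>The data give a vertex of the homotopy pullback, and the inverse of the comparison map
  joins it to the image of some \<open>p\<close>; the projections preserve the joining path.\<close>

lemma pullback_square_vertex:
  assumes P: "is_sset P" and kan: "is_kan A" "is_kan B" "is_kan C" and f: "smap A C f" and g: "smap B C g"
    and sq: "pullback_square P A B C u v f g H H'"
    and a: "a \<in> splx A 0" and b: "b \<in> splx B 0" and ab: "path_connected C (f 0 a) (g 0 b)"
  obtains p where "p \<in> splx P 0" "path_connected A (u 0 p) a" "path_connected B (v 0 p) b"
proof -
  interpret homotopy_pullback A B C f g using kan f g by unfold_locales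
  obtain \<alpha> \<beta> where q: "(a, \<alpha>, \<beta>, b) \<in> splx Q 0"
    using hpullback_vertex[of C a A b B f g, OF is_kan_sset[OF kan(3)] a b smap_closed[OF f a] ab] by blast
  let ?w = "\<lambda>n x. (u n x, adjoint_path P H n x, adjoint_path P H' n x, v n x)"
  obtain \<gamma> where \<gamma>: "smap Q P \<gamma>" "homotopic Q Q (\<lambda>n x. ?w n (\<gamma> n x)) (\<lambda>n x. x)"
    using sq unfolding pullback_square_def hequiv_def homotopic_def by blast
  let ?p = "\<gamma> 0 (a, \<alpha>, \<beta>, b)"
  have "path_connected Q (?w 0 ?p) (a, \<alpha>, \<beta>, b)"
    using homotopic_vertex[OF is_sset_Q \<gamma>(2) q] by simp
  from path_connected_smap[OF proj_smap(1) this] path_connected_smap[OF proj_smap(4) this]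
  show thesis using that smap_closed[OF \<gamma>(1) q] by simp
qed

section \<open>Pushout squares in the category of ordinals\<close>

lemma principal_edge_dhom [simp]: "i < r \<Longrightarrow> principal_edge r i \<in> dhom 1 r"
  unfolding principal_edge_def by (rule mk_dmap_dhom) auto

lemma ap_principal_edge: "l \<le> 1 \<Longrightarrow> ap (principal_edge r i) l = i + l"
  by (simp add: principal_edge_def)

lemma long_edge_dhom [simp]: "long_edge r \<in> dhom 1 r"
  unfolding long_edge_def by (rule mk_dmap_dhom) auto

lemma ap_long_edge: "l \<le> 1 \<Longrightarrow> ap (long_edge r) l = (if l = 0 then 0 else r)"
  by (simp add: long_edge_def)

lemma le_1_cases: "l \<le> 1 \<Longrightarrow> (l = 0 \<Longrightarrow> P) \<Longrightarrow> (l = 1 \<Longrightarrow> P) \<Longrightarrow> P" for l :: nat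
  by linarith

lemma is_free_principal_edge: "i < r \<Longrightarrow> is_free (principal_edge r i)"
  using principal_edge_dhom[of i r]
  by (simp add: is_free_def dhom_def principal_edge_def)

lemma is_generic_codegeneracy: "is_generic (codegeneracy 0 0)"
  using codegeneracy_dhom[of 0 0]
  by (simp add: is_generic_def dhom_def ap_codegeneracy)

lemma is_generic_long_edge: "is_generic (long_edge r)"
  using long_edge_dhom[of r] by (simp add: is_generic_def dhom_def ap_long_edge)

lemma commuting_squareI:
  assumes "f \<in> dhom a b" "g \<in> dhom a c" "f' \<in> dhom b d" "g' \<in> dhom c d" "dcomp f' f = dcomp g' g"
  shows "commuting_square f g f' g'"
  using assms by (auto simp: commuting_square_def dhom_def)

text \<open>Joint surjectivity of \<open>f'\<close> and \<open>g'\<close> on vertices accounts for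
  the uniqueness of the mediating map.\<close>

lemma pushout_squareI:
  assumes dh: "f \<in> dhom a b" "g \<in> dhom a c" "f' \<in> dhom b d" "g' \<in> dhom c d"
    and comm: "dcomp f' f = dcomp g' g"
    and ex: "\<And>t h k. h \<in> dhom b t \<Longrightarrow> k \<in> dhom c t \<Longrightarrow> dcomp h f = dcomp k g \<Longrightarrow>
      \<exists>l\<in>dhom d t. dcomp l f' = h \<and> dcomp l g' = k"
    and surj: "\<And>j. j \<le> d \<Longrightarrow> (\<exists>i\<le>b. ap f' i = j) \<or> (\<exists>i\<le>c. ap g' i = j)"
  shows "pushout_square f g f' g'"
  unfolding pushout_square_def
proof (intro conjI allI impI commuting_squareI[OF dh comm])
  fix h k assume c: "commuting_square f g h k"
  define t where "t = tgt h"
  have hk: "h \<in> dhom b t" "k \<in> dhom c t" "dcomp h f = dcomp k g"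
    using c dh by (auto simp: commuting_square_def dhom_def t_def)
  obtain l where l: "l \<in> dhom d t" "dcomp l f' = h" "dcomp l g' = k" using ex[OF hk] by blast
  show "\<exists>!l. is_dmap l \<and> src l = tgt f' \<and> tgt l = tgt h \<and> dcomp l f' = h \<and> dcomp l g' = k"
  proof (rule ex1I[of _ l])
    show "is_dmap l \<and> src l = tgt f' \<and> tgt l = tgt h \<and> dcomp l f' = h \<and> dcomp l g' = k"
      using l dh by (auto simp: dhom_def t_def)
    fix l' assume "is_dmap l' \<and> src l' = tgt f' \<and> tgt l' = tgt h \<and> dcomp l' f' = h \<and> dcomp l' g' = k"
    then have l': "l' \<in> dhom d t" "dcomp l' f' = h" "dcomp l' g' = k"
      using dh by (auto simp: dhom_def t_def)
    show "l' = l"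
    proof (rule dhom_eqI[OF l'(1) l(1)])
      fix j assume "j \<le> d"
      from surj[OF this] show "ap l' j = ap l j"
        using ap_dcomp[OF dh(3), of _ l] ap_dcomp[OF dh(3), of _ l'] ap_dcomp[OF dh(4), of _ l]
          ap_dcomp[OF dh(4), of _ l'] l l' by metis
    qed
  qed
qed

lemma degeneracy_pushout:
  assumes i: "i \<le> n"
  shows "pushout_square (codegeneracy 0 0) (principal_edge (Suc n) i) (dconst 0 n i) (codegeneracy n i)"
proof (rule pushout_squareI)
  have pe: "principal_edge (Suc n) i \<in> dhom 1 (Suc n)" using i by simp
  show c0: "codegeneracy 0 0 \<in> dhom 1 0" using codegeneracy_dhom[of 0 0] by (simp add: One_nat_def)
  show "principal_edge (Suc n) i \<in> dhom 1 (Suc n)" "dconst 0 n i \<in> dhom 0 n" "codegeneracy n i \<in> dhom (Suc n) n"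
    using i by simp_all
  show "dcomp (dconst 0 n i) (codegeneracy 0 0) = dcomp (codegeneracy n i) (principal_edge (Suc n) i)"
    by (rule dhom_eqI[OF dcomp_dhom[OF dconst_dhom[OF i] c0] dcomp_dhom[OF codegeneracy_dhom[OF i] pe]])
      (use i in \<open>auto simp: ap_dcomp[OF c0] ap_dcomp[OF pe] ap_principal_edge ap_codegeneracy ap_le[OF c0]
        elim: le_1_cases\<close>)
  show "\<exists>l\<in>dhom n t. dcomp l (dconst 0 n i) = h \<and> dcomp l (codegeneracy n i) = k"
    if h: "h \<in> dhom 0 t" and k: "k \<in> dhom (Suc n) t"
      and eq: "dcomp h (codegeneracy 0 0) = dcomp k (principal_edge (Suc n) i)" for t h k
  proof (intro bexI conjI)
    have hk: "ap h 0 = ap k (i + l)" if "l \<le> 1" for l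
    proof -
      from that have "l = 0 \<or> l = 1" by linarith
      then show ?thesis
        using arg_cong[OF eq, of "\<lambda>f. ap f l"]
        by (elim disjE) (simp_all add: ap_dcomp[OF c0] ap_dcomp[OF pe] ap_principal_edge ap_codegeneracy)
    qed
    have hki: "ap k i = ap h 0" "ap k (Suc i) = ap h 0" using hk[of 0] hk[of 1] by (simp_all add: One_nat_def)
    \<comment> \<open>The coface is a section of the codegeneracy; since \<open>k\<close> takes
      equal values at \<open>i\<close> and \<open>i + 1\<close>, composing back recovers
      \<open>k\<close>.\<close>
    let ?l = "dcomp k (coface n i)"
    show l: "?l \<in> dhom n t" using dcomp_dhom[OF k coface_dhom] .
    have apl: "ap ?l j = ap k (if j < i then j else Suc j)" if "j \<le> n" for j
      using that by (simp add: ap_dcomp[OF coface_dhom] ap_coface)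
    show "dcomp ?l (dconst 0 n i) = h"
      by (rule dhom_eqI[OF dcomp_dhom[OF l dconst_dhom[OF i]] h])
        (use i hki in \<open>simp add: ap_dcomp[OF dconst_dhom[OF i]] apl\<close>)
    show "dcomp ?l (codegeneracy n i) = k"
    proof (rule dhom_eqI[OF dcomp_dhom[OF l codegeneracy_dhom[OF i]] k])
      fix j assume j: "j \<le> Suc n"
      consider "j < i" | "j = i" | j' where "i \<le> j'" "j = Suc j'" by (cases j) force+
      then show "ap (dcomp ?l (codegeneracy n i)) j = ap k j"
        by cases (use i j hki in \<open>simp_all add: ap_dcomp[OF codegeneracy_dhom[OF i]] ap_codegeneracy apl\<close>)
    qed
  qed
  show "(\<exists>a\<le>0. ap (dconst 0 n i) a = j) \<or> (\<exists>a\<le>Suc n. ap (codegeneracy n i) a = j)" if "j \<le> n" for j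
    using that by (intro disjI2 exI[of _ "if j \<le> i then j else Suc j"]) (auto simp: ap_codegeneracy)
qed

definition last_triangle :: "nat \<Rightarrow> dmap" where
  "last_triangle r = mk_dmap 2 (Suc (Suc r)) (\<lambda>i. r + i)"

lemma last_triangle_dhom [simp]: "last_triangle r \<in> dhom 2 (Suc (Suc r))"
  unfolding last_triangle_def by (rule mk_dmap_dhom) auto

lemma ap_last_triangle: "l \<le> 2 \<Longrightarrow> ap (last_triangle r) l = r + l"
  by (simp add: last_triangle_def)

text \<open>The last edge of \<open>[r + 1]\<close> is subdivided: the inserted vertex has number
  \<open>r + 1\<close>, the one that the coface omits.\<close>

lemma subdivision_pushout:
  "pushout_square (long_edge 2) (principal_edge (Suc r) r) (last_triangle r) (coface (Suc r) (Suc r))"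
proof (rule pushout_squareI)
  have pe: "principal_edge (Suc r) r \<in> dhom 1 (Suc r)" by simp
  show "long_edge 2 \<in> dhom 1 2" "principal_edge (Suc r) r \<in> dhom 1 (Suc r)"
    "last_triangle r \<in> dhom 2 (Suc (Suc r))" "coface (Suc r) (Suc r) \<in> dhom (Suc r) (Suc (Suc r))"
    by simp_all
  show "dcomp (last_triangle r) (long_edge 2) = dcomp (coface (Suc r) (Suc r)) (principal_edge (Suc r) r)"
    by (rule dhom_eqI[OF dcomp_dhom[OF last_triangle_dhom long_edge_dhom] dcomp_dhom[OF coface_dhom pe]])
      (auto simp: ap_dcomp[OF long_edge_dhom] ap_dcomp[OF pe] ap_principal_edge ap_long_edge
        ap_last_triangle ap_coface elim!: le_1_cases)
  show "\<exists>l\<in>dhom (Suc (Suc r)) t. dcomp l (last_triangle r) = h \<and> dcomp l (coface (Suc r) (Suc r)) = k"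
    if h: "h \<in> dhom 2 t" and k: "k \<in> dhom (Suc r) t"
      and eq: "dcomp h (long_edge 2) = dcomp k (principal_edge (Suc r) r)" for t h k
  proof (intro bexI conjI)
    have e0: "ap k r = ap h 0" and e1: "ap k (Suc r) = ap h 2"
      using arg_cong[OF eq, of "\<lambda>f. ap f 0"] arg_cong[OF eq, of "\<lambda>f. ap f 1"]
      by (auto simp: ap_dcomp[OF long_edge_dhom] ap_dcomp[OF pe] ap_principal_edge ap_long_edge
          simp flip: Suc_eq_plus1)
    let ?f = "\<lambda>j. if j \<le> r then ap k j else ap h (j - r)"
    define l where "l = mk_dmap (Suc (Suc r)) t ?f"
    have l: "l \<in> dhom (Suc (Suc r)) t"
      unfolding l_def
    proof (rule mk_dmap_dhom)
      show "?f i \<le> t" if "i \<le> Suc (Suc r)" for i using that ap_le[OF k] ap_le[OF h] by auto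
      fix i j :: nat assume ij: "i \<le> j" "j \<le> Suc (Suc r)"
      show "?f i \<le> ?f j"
      proof (cases "i \<le> r \<and> r < j")
        case True
        then have "ap k i \<le> ap k r" "ap h 0 \<le> ap h (j - r)"
          using ap_mono[OF k, of i r] ap_mono[OF h, of 0 "j - r"] ij by auto
        then show ?thesis using True e0 by auto
      next
        case False
        then show ?thesis using ij ap_mono[OF k, of i j] ap_mono[OF h, of "i - r" "j - r"] by auto
      qed
    qed
    have apl: "ap l j = ?f j" if "j \<le> Suc (Suc r)" for j using that by (simp add: l_def)
    show "l \<in> dhom (Suc (Suc r)) t" by (rule l)
    show "dcomp l (last_triangle r) = h"
      by (rule dhom_eqI[OF dcomp_dhom[OF l last_triangle_dhom] h])
        (auto simp: ap_dcomp[OF last_triangle_dhom] ap_last_triangle apl e0)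
    show "dcomp l (coface (Suc r) (Suc r)) = k"
    proof (rule dhom_eqI[OF dcomp_dhom[OF l coface_dhom] k])
      fix j assume "j \<le> Suc r"
      then consider "j \<le> r" | "j = Suc r" by linarith
      then show "ap (dcomp l (coface (Suc r) (Suc r))) j = ap k j"
        by cases (simp_all add: ap_dcomp[OF coface_dhom] ap_coface apl e1 flip: numeral_2_eq_2)
    qed
  qed
  show "(\<exists>i\<le>2. ap (last_triangle r) i = j) \<or> (\<exists>i\<le>Suc r. ap (coface (Suc r) (Suc r)) i = j)"
    if "j \<le> Suc (Suc r)" for j
  proof (cases "j \<le> r")
    case True
    then show ?thesis by (intro disjI2 exI[of _ j]) (simp add: ap_coface)
  next
    case False
    then show ?thesis using that by (intro disjI1 exI[of _ "j - r"]) (simp add: ap_last_triangle)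
  qed
qed

section \<open>Functors to Kan complexes\<close>

locale simplicial_diagram =
  fixes X :: "'a cdiag"
  assumes X: "simplicial_space X"
begin

lemma is_kan_ob: "is_kan (ob X k)"
  by (rule kan_is_kan) (rule X[unfolded simplicial_space_def, THEN conjunct1, rule_format])

lemmas is_sset_ob = is_kan_sset[OF is_kan_ob]

lemma cell_smap: "chain c \<Longrightarrow>
    smap (sprod (cube (length c - 1)) (ob X (tgt (last c)))) (ob X (src (hd c))) (cell X c)"
  by (rule X[unfolded simplicial_space_def, THEN conjunct2, THEN conjunct1, rule_format])

lemma cell_inner: "chain [f, g] \<Longrightarrow> x \<in> splx (ob X (tgt g)) m \<Longrightarrow>
    cell X [f, g] m ([dconst m 1 0], x) = cell X [dcomp g f] m ([], x)"
proof -
  assume c: "chain [f, g]" and x: "x \<in> splx (ob X (tgt g)) m"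
  from X[unfolded simplicial_space_def, THEN conjunct2, THEN conjunct2, THEN conjunct1, rule_format, of "[]" f g "[]" "[]" m "[]" x] show ?thesis using c x by (simp add: cube_def)
qed

lemma cell_comp: "chain [f, g] \<Longrightarrow> x \<in> splx (ob X (tgt g)) m \<Longrightarrow>
    cell X [f, g] m ([dconst m 1 1], x) = cell X [f] m ([], cell X [g] m ([], x))"
proof -
  assume c: "chain [f, g]" and x: "x \<in> splx (ob X (tgt g)) m"
  from X[unfolded simplicial_space_def, THEN conjunct2, THEN conjunct2, THEN conjunct2, THEN conjunct1, rule_format, of "[f]" "[g]" "[]" m "[]" x] show ?thesis using c x by (simp add: cube_def)
qed

lemma ind_did: "x \<in> splx (ob X k) m \<Longrightarrow> ind X (did k) m x = x"
  unfolding ind_def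
  by (rule X[unfolded simplicial_space_def, THEN conjunct2, THEN conjunct2, THEN conjunct2, THEN conjunct2,
        THEN conjunct1, rule_format])

lemma ind_smap:
  assumes "f \<in> dhom m n"
  shows "smap (ob X n) (ob X m) (ind X f)"
proof -
  have "chain [f]" using assms by (simp add: chain_def dhom_def)
  from cell_smap[OF this] have c: "smap (sprod (cube 0) (ob X n)) (ob X m) (cell X [f])"
    using assms by (simp add: dhom_def)
  have "smap (ob X n) (sprod (cube 0) (ob X n)) (\<lambda>k x. ([], x))"
    by (rule smapI) (simp_all add: cube_def)
  from smap_comp[OF this c] show ?thesis by (simp add: ind_def[abs_def])
qed

lemma ind_comp_homotopic:
  assumes f: "f \<in> dhom l m" and g: "g \<in> dhom m n"
  shows "homotopic (ob X n) (ob X l) (ind X (dcomp g f)) (\<lambda>k x. ind X f k (ind X g k x))"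
proof -
  have ch: "chain [f, g]" using assms by (simp add: chain_def dhom_def)
  from cell_smap[OF this] have c: "smap (sprod (cube 1) (ob X n)) (ob X l) (cell X [f, g])"
    using assms by (simp add: dhom_def One_nat_def)
  have "smap (sprod (ob X n) (std 1)) (sprod (cube 1) (ob X n)) (\<lambda>k q. ([snd q], fst q))"
    by (rule smapI) (auto simp: cube_def)
  from smap_comp[OF this c] show ?thesis
    by (rule homotopicI) (use cell_inner[OF ch] cell_comp[OF ch] g in \<open>auto simp: ind_def dhom_def\<close>)
qed

section \<open>Vertices up to paths\<close>

abbreviation "pts k \<equiv> splx (ob X k) 0"

definition sim :: "nat \<Rightarrow> 'a \<Rightarrow> 'a \<Rightarrow> bool" where
  "sim k x y \<longleftrightarrow> x \<in> pts k \<and> y \<in> pts k \<and> path_connected (ob X k) x y"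

lemma sim_refl: "x \<in> pts k \<Longrightarrow> sim k x x"
  by (simp add: sim_def path_connected_refl[OF is_kan_ob])

lemma sim_sym: "sim k x y \<Longrightarrow> sim k y x"
  using path_connected_sym[OF is_kan_ob] by (simp add: sim_def)

lemma sim_trans [trans]: "sim k x y \<Longrightarrow> sim k y z \<Longrightarrow> sim k x z"
  using path_connected_trans[OF is_kan_ob, of x k y z] by (simp add: sim_def)

lemma ind_pts: "f \<in> dhom m n \<Longrightarrow> x \<in> pts n \<Longrightarrow> ind X f 0 x \<in> pts m"
  using smap_closed[OF ind_smap] .

lemma sim_ind: "f \<in> dhom m n \<Longrightarrow> sim n x y \<Longrightarrow> sim m (ind X f 0 x) (ind X f 0 y)"
  using path_connected_smap[OF ind_smap] ind_pts by (simp add: sim_def)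

lemma sim_comp:
  assumes f: "f \<in> dhom l m" and g: "g \<in> dhom m n" and x: "x \<in> pts n"
  shows "sim l (ind X f 0 (ind X g 0 x)) (ind X (dcomp g f) 0 x)"
proof (rule sim_sym)
  show "sim l (ind X (dcomp g f) 0 x) (ind X f 0 (ind X g 0 x))"
    using homotopic_vertex[OF is_sset_ob ind_comp_homotopic[OF f g] x] f g x
    by (simp add: sim_def ind_pts[OF dcomp_dhom[OF g f]] ind_pts)
qed

lemma sim_square:
  assumes "f \<in> dhom l m" "g \<in> dhom m n" "f' \<in> dhom l m'" "g' \<in> dhom m' n" "dcomp g f = dcomp g' f'"
    and x: "x \<in> pts n"
  shows "sim l (ind X f 0 (ind X g 0 x)) (ind X f' 0 (ind X g' 0 x))"
  using sim_trans[OF sim_comp[OF assms(1,2) x]] sim_sym[OF sim_comp[OF assms(3,4) x]] assms(5) by simp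

lemma ess_image_iff:
  assumes "f \<in> dhom m n"
  shows "x \<in> ess_image (ob X n) (ob X m) (ind X f) \<longleftrightarrow> (\<exists>y\<in>pts n. sim m (ind X f 0 y) x)"
  using ind_pts[OF assms] by (auto simp: ess_image_def sim_def)

lemma codegeneracy_0_dhom: "codegeneracy 0 0 \<in> dhom 1 0"
  using codegeneracy_dhom[of 0 0] by (simp add: One_nat_def)

lemma degenerate_edge_iff:
  "x \<in> nondegenerate_edges X \<longleftrightarrow> x \<in> pts 1 \<and> \<not> (\<exists>y\<in>pts 0. sim 1 (ind X (codegeneracy 0 0) 0 y) x)"
  using ess_image_iff[OF codegeneracy_0_dhom] by (simp add: nondegenerate_edges_def)

lemma nondegenerate_edges_sim:
  "x \<in> nondegenerate_edges X \<Longrightarrow> sim 1 x y \<Longrightarrow> y \<in> nondegenerate_edges X"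
  unfolding degenerate_edge_iff using sim_trans[OF _ sim_sym] by (metis sim_def)

end

locale decomposition_diagram = simplicial_diagram +
  assumes dec: "decomposition_space X"
begin

text \<open>The gluing principle for vertices. The restrictions of \<open>p\<close> match up to
  paths only, which is why nondegeneracy is always transferred along \<open>sim\<close>.\<close>

lemma pushout_vertex:
  assumes g: "g \<in> dhom a b" "is_generic g" and f: "f \<in> dhom a c" "is_free f"
    and g': "g' \<in> dhom b d" and f': "f' \<in> dhom c d" and po: "pushout_square g f g' f'"
    and x: "x \<in> pts b" and y: "y \<in> pts c" and xy: "sim a (ind X g 0 x) (ind X f 0 y)"
  obtains p where "p \<in> pts d" "sim b (ind X g' 0 p) x" "sim c (ind X f' 0 p) y"
proof -
  have "sends_to_pullback X g f g' f'"
    using dec g(2) f(2) po unfolding decomposition_space_def by blast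
  then have sq: "pullback_square (ob X d) (ob X b) (ob X c) (ob X a)
       (ind X g') (ind X f') (ind X g) (ind X f) (ind2 X g g') (ind2 X f f')"
    using dhomD[OF g(1)] dhomD[OF f(1)] dhomD[OF g'] by (simp add: sends_to_pullback_def)
  have "path_connected (ob X a) (ind X g 0 x) (ind X f 0 y)" using xy by (simp add: sim_def)
  from pullback_square_vertex[OF is_sset_ob is_kan_ob is_kan_ob is_kan_ob ind_smap[OF g(1)] ind_smap[OF f(1)] sq x y this]
  obtain p where p: "p \<in> pts d" "path_connected (ob X b) (ind X g' 0 p) x" "path_connected (ob X c) (ind X f' 0 p) y"
    by blast
  show thesis by (rule that[of p]) (use p x y ind_pts[OF g'] ind_pts[OF f'] in \<open>simp_all add: sim_def\<close>)
qed

text \<open>One direction is naturality. Conversely, a degenerate principal edge supplies the point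
  \<open>y\<close> with which the pullback square reconstructs \<open>x\<close> from an
  \<open>n\<close>-simplex.\<close>

lemma degenerate_iff_principal_edge:
  assumes i: "i \<le> n" and x: "x \<in> pts (Suc n)"
  shows "x \<in> ess_image (ob X n) (ob X (Suc n)) (degen X n i) \<longleftrightarrow>
    ind X (principal_edge (Suc n) i) 0 x \<notin> nondegenerate_edges X"
proof -
  have pe: "principal_edge (Suc n) i \<in> dhom 1 (Suc n)" using i by simp
  have c: "codegeneracy n i \<in> dhom (Suc n) n" using i by simp
  have d: "dconst 0 n i \<in> dhom 0 n" using i by simp
  have sq: "dcomp (codegeneracy n i) (principal_edge (Suc n) i) = dcomp (dconst 0 n i) (codegeneracy 0 0)"
    using degeneracy_pushout[OF i] by (simp add: pushout_square_def commuting_square_def)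
  show ?thesis
  proof
    assume "x \<in> ess_image (ob X n) (ob X (Suc n)) (degen X n i)"
    then obtain y where y: "y \<in> pts n" "sim (Suc n) (ind X (codegeneracy n i) 0 y) x"
      using ess_image_iff[OF c] by blast
    have "sim 1 (ind X (codegeneracy 0 0) 0 (ind X (dconst 0 n i) 0 y)) (ind X (principal_edge (Suc n) i) 0 x)"
      using sim_square[OF codegeneracy_0_dhom d pe c sq[symmetric] y(1)] sim_ind[OF pe y(2)] by (rule sim_trans)
    then show "ind X (principal_edge (Suc n) i) 0 x \<notin> nondegenerate_edges X"
      using degenerate_edge_iff ind_pts[OF d y(1)] by blast
  next
    assume "ind X (principal_edge (Suc n) i) 0 x \<notin> nondegenerate_edges X"
    then obtain y where y: "y \<in> pts 0" "sim 1 (ind X (codegeneracy 0 0) 0 y) (ind X (principal_edge (Suc n) i) 0 x)"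
      using degenerate_edge_iff ind_pts[OF pe x] by blast
    obtain p where "p \<in> pts n" "sim (Suc n) (ind X (codegeneracy n i) 0 p) x"
      using pushout_vertex[OF codegeneracy_0_dhom is_generic_codegeneracy pe
          is_free_principal_edge d c degeneracy_pushout[OF i] y(1) x y(2)] i by auto
    then show "x \<in> ess_image (ob X n) (ob X (Suc n)) (degen X n i)"
      using ess_image_iff[OF c] by blast
  qed
qed

lemma nondegenerate_iff:
  "x \<in> nondegenerate X n \<longleftrightarrow> x \<in> pts n \<and> (\<forall>i<n. ind X (principal_edge n i) 0 x \<in> nondegenerate_edges X)"
proof (cases n)
  case (Suc m)
  then show ?thesis
    using degenerate_iff_principal_edge[of _ m x] by (auto simp: nondegenerate_def less_Suc_eq_le)
qed (simp add: nondegenerate_def)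

text \<open>If the long edge of \<open>\<sigma>\<close> is degenerate at \<open>y\<^sub>0\<close>, then \<open>\<sigma>\<close> can be glued to a degenerate last edge of
  any simplex ending at \<open>y\<^sub>0\<close>, which prolongs it by the principal edges of \<open>\<sigma>\<close> and keeps the long edge.\<close>

lemma iterated_gluing:
  assumes \<sigma>: "\<sigma> \<in> pts 2" "\<And>t. t < 2 \<Longrightarrow> ind X (principal_edge 2 t) 0 \<sigma> \<in> nondegenerate_edges X"
    and y0: "y0 \<in> pts 0" "sim 1 (ind X (codegeneracy 0 0) 0 y0) (ind X (long_edge 2) 0 \<sigma>)"
  shows "\<exists>y\<in>pts (2 * k). (\<forall>i<2 * k. ind X (principal_edge (2 * k) i) 0 y \<in> nondegenerate_edges X) \<and>
    sim 1 (ind X (long_edge (2 * k)) 0 y) (ind X (long_edge 2) 0 \<sigma>) \<and>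
    sim 0 (ind X (dconst 0 (2 * k) (2 * k)) 0 y) y0"
proof (induction k)
  case 0
  \<comment> \<open>The \<open>0\<close>-simplex \<open>y0\<close> starts the induction: its long
    edge is its degeneracy, which \<open>y0(2)\<close> joins to the long edge of
    \<open>\<sigma>\<close>.\<close>
  have "long_edge 0 = codegeneracy 0 0"
    by (rule dhom_eqI[OF long_edge_dhom codegeneracy_0_dhom]) (auto simp: ap_long_edge ap_codegeneracy)
  moreover have "dconst 0 0 0 = did 0" by (rule dhom_eqI[of _ 0 0]) auto
  ultimately show ?case using y0 ind_did[OF y0(1)] sim_refl[OF y0(1)] by auto
next
  case (Suc k)
  define r where "r = 2 * k"
  have r: "2 * Suc k = Suc (Suc r)" by (simp add: r_def)
  obtain y where y: "y \<in> pts r" "\<And>i. i < r \<Longrightarrow> ind X (principal_edge r i) 0 y \<in> nondegenerate_edges X"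
    and y_long: "sim 1 (ind X (long_edge r) 0 y) (ind X (long_edge 2) 0 \<sigma>)"
    and y_last: "sim 0 (ind X (dconst 0 r r) 0 y) y0"
    using Suc unfolding r_def by blast
  have c: "codegeneracy r r \<in> dhom (Suc r) r" by simp
  have l: "dconst 0 r r \<in> dhom 0 r" by simp
  \<comment> \<open>The last edge of \<open>z\<close> is degenerate at the end of \<open>y\<close>,
    hence joined to the long edge of \<open>\<sigma>\<close>; along it the triangle can be glued
    in.\<close>
  define z where "z = ind X (codegeneracy r r) 0 y"
  have z: "z \<in> pts (Suc r)" unfolding z_def by (rule ind_pts[OF c y(1)])
  have pe: "principal_edge (Suc r) i \<in> dhom 1 (Suc r)" if "i \<le> r" for i using that by simp
  have "dcomp (codegeneracy r r) (principal_edge (Suc r) r) = dcomp (dconst 0 r r) (codegeneracy 0 0)"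
    using degeneracy_pushout[of r r] by (simp add: pushout_square_def commuting_square_def)
  then have "sim 1 (ind X (principal_edge (Suc r) r) 0 z) (ind X (codegeneracy 0 0) 0 (ind X (dconst 0 r r) 0 y))"
    unfolding z_def by (intro sim_square[OF pe c codegeneracy_0_dhom l _ y(1)]) auto
  also have "sim 1 (ind X (codegeneracy 0 0) 0 (ind X (dconst 0 r r) 0 y)) (ind X (codegeneracy 0 0) 0 y0)"
    by (rule sim_ind[OF codegeneracy_0_dhom y_last])
  also note y0(2)
  finally have glue: "sim 1 (ind X (long_edge 2) 0 \<sigma>) (ind X (principal_edge (Suc r) r) 0 z)"
    by (rule sim_sym)
  obtain p where p: "p \<in> pts (Suc (Suc r))" "sim 2 (ind X (last_triangle r) 0 p) \<sigma>"
    "sim (Suc r) (ind X (coface (Suc r) (Suc r)) 0 p) z"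
    using pushout_vertex[OF long_edge_dhom is_generic_long_edge pe[OF order_refl] is_free_principal_edge[OF lessI]
        last_triangle_dhom coface_dhom subdivision_pushout \<sigma>(1) z glue] by blast
  let ?d = "coface (Suc r) (Suc r)"
  \<comment> \<open>Restrictions of \<open>p\<close> along maps that avoid vertex
    \<open>r + 1\<close> can be computed in \<open>z\<close>, and hence in \<open>y\<close>.\<close>
  have via_d: "sim m (ind X h 0 p) (ind X h' 0 y)"
    if e: "e \<in> dhom m (Suc r)" and h: "h = dcomp ?d e" "h' = dcomp (codegeneracy r r) e" for m e h h'
  proof -
    have "sim m (ind X h 0 p) (ind X e 0 (ind X ?d 0 p))"
      unfolding h by (rule sim_sym[OF sim_comp[OF e coface_dhom p(1)]])
    also have "sim m \<dots> (ind X e 0 z)" by (rule sim_ind[OF e p(3)])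
    also have "sim m \<dots> (ind X h' 0 y)" unfolding h z_def by (rule sim_comp[OF e c y(1)])
    finally show ?thesis .
  qed
  have principal: "ind X (principal_edge (Suc (Suc r)) i) 0 p \<in> nondegenerate_edges X" if i: "i < Suc (Suc r)" for i
  proof (cases "i < r")
    case True
    have e: "principal_edge (Suc r) i \<in> dhom 1 (Suc r)" using True by simp
    have "sim 1 (ind X (principal_edge (Suc (Suc r)) i) 0 p) (ind X (principal_edge r i) 0 y)"
    proof (rule via_d[OF e])
      show "principal_edge (Suc (Suc r)) i = dcomp ?d (principal_edge (Suc r) i)"
        by (rule dhom_eqI[OF _ dcomp_dhom[OF coface_dhom e]])
          (use True in \<open>auto simp: ap_dcomp[OF e] ap_principal_edge ap_coface\<close>)
      show "principal_edge r i = dcomp (codegeneracy r r) (principal_edge (Suc r) i)"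
        by (rule dhom_eqI[OF _ dcomp_dhom[OF c e]])
          (use True in \<open>auto simp: ap_dcomp[OF e] ap_principal_edge ap_codegeneracy\<close>)
    qed
    then show ?thesis using nondegenerate_edges_sim[OF y(2)[OF True] sim_sym] by blast
  next
    case False
    define t where "t = i - r"
    have t: "t < 2" "i = r + t" using False i by (auto simp: t_def)
    have e: "principal_edge 2 t \<in> dhom 1 2" using t by simp
    have "principal_edge (Suc (Suc r)) i = dcomp (last_triangle r) (principal_edge 2 t)"
      by (rule dhom_eqI[OF _ dcomp_dhom[OF last_triangle_dhom e]])
        (use t in \<open>auto simp: ap_dcomp[OF e] ap_principal_edge ap_last_triangle\<close>)
    then have "sim 1 (ind X (principal_edge 2 t) 0 (ind X (last_triangle r) 0 p)) (ind X (principal_edge (Suc (Suc r)) i) 0 p)"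
      using sim_comp[OF e last_triangle_dhom p(1)] by simp
    moreover have "sim 1 (ind X (principal_edge 2 t) 0 \<sigma>) (ind X (principal_edge 2 t) 0 (ind X (last_triangle r) 0 p))"
      by (rule sim_ind[OF e sim_sym[OF p(2)]])
    ultimately show ?thesis using nondegenerate_edges_sim[OF \<sigma>(2)[OF t(1)]] sim_trans by blast
  qed
  have "sim 1 (ind X (long_edge (Suc (Suc r))) 0 p) (ind X (long_edge r) 0 y)"
  proof (rule via_d[OF long_edge_dhom[of "Suc r"]])
    show "long_edge (Suc (Suc r)) = dcomp ?d (long_edge (Suc r))"
      by (rule dhom_eqI[OF _ dcomp_dhom[OF coface_dhom long_edge_dhom]])
        (auto simp: ap_dcomp[OF long_edge_dhom] ap_long_edge ap_coface)
    show "long_edge r = dcomp (codegeneracy r r) (long_edge (Suc r))"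
      by (rule dhom_eqI[OF _ dcomp_dhom[OF c long_edge_dhom]])
        (auto simp: ap_dcomp[OF long_edge_dhom] ap_long_edge ap_codegeneracy)
  qed
  then have long: "sim 1 (ind X (long_edge (Suc (Suc r))) 0 p) (ind X (long_edge 2) 0 \<sigma>)"
    using y_long by (rule sim_trans)
  \<comment> \<open>The coface sends \<open>r + 1\<close> to the new last vertex
    \<open>r + 2\<close>, the codegeneracy sends it to \<open>r\<close>; so the end stays at
    \<open>y0\<close>, ready for the next gluing.\<close>
  have "sim 0 (ind X (dconst 0 (Suc (Suc r)) (Suc (Suc r))) 0 p) (ind X (dconst 0 r r) 0 y)"
    by (rule via_d[OF dconst_dhom[OF order_refl, of 0 "Suc r"]])
      (simp_all add: dcomp_dconst_right[OF coface_dhom] dcomp_dconst_right[OF c] ap_coface ap_codegeneracy)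
  then have "sim 0 (ind X (dconst 0 (Suc (Suc r)) (Suc (Suc r))) 0 p) y0"
    using y_last by (rule sim_trans)
  then show ?case using p(1) principal long unfolding r by blast
qed

text \<open>The square exhibits \<open>degen X n i\<close> as a base change of
  \<open>degen X 0 0\<close>, so its fibre over \<open>b\<close> is controlled by the fibre of the
  latter over the principal edge \<open>i\<close> of \<open>b\<close>.\<close>

lemma degeneracy_monomorphism:
  assumes mono: "monomorphism (ob X 0) (ob X 1) (degen X 0 0)" and i: "i \<le> n"
  shows "monomorphism (ob X n) (ob X (Suc n)) (degen X n i)"
  unfolding monomorphism_def
proof
  fix b assume b: "b \<in> splx (ob X (Suc n)) 0"
  let ?e = "principal_edge (Suc n) i"
  have pe: "?e \<in> dhom 1 (Suc n)" using i by simp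
  have c: "codegeneracy n i \<in> dhom (Suc n) n" using i by simp
  interpret hp: homotopy_pullback "ob X 0" "ob X (Suc n)" "ob X 1" "ind X (codegeneracy 0 0)" "ind X ?e"
    using is_kan_ob ind_smap[OF codegeneracy_0_dhom] ind_smap[OF pe] by unfold_locales
  have "sends_to_pullback X (codegeneracy 0 0) ?e (dconst 0 n i) (codegeneracy n i)"
    using dec is_generic_codegeneracy is_free_principal_edge[of i "Suc n"] degeneracy_pushout[OF i] i
    unfolding decomposition_space_def by auto
  then have sq: "hequiv (ob X n) hp.Q (\<lambda>m x. (ind X (dconst 0 n i) m x,
      adjoint_path (ob X n) (ind2 X (codegeneracy 0 0) (dconst 0 n i)) m x,
      adjoint_path (ob X n) (ind2 X ?e (codegeneracy n i)) m x, ind X (codegeneracy n i) m x))"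
    using dhomD[OF pe] by (simp add: sends_to_pullback_def pullback_square_def One_nat_def)
  show "empty_sset (hfibre (ob X n) (ob X (Suc n)) (degen X n i) b) \<or>
      contractible (hfibre (ob X n) (ob X (Suc n)) (degen X n i) b)"
    by (rule hp.hfibre_pullback[OF is_kan_ob sq ind_smap[OF c] _ b])
      (use mono ind_pts[OF pe b] in \<open>auto simp: monomorphism_def\<close>)
qed

lemma long_edge_nondegenerate:
  assumes tight: "tight_decomposition_space X" and \<sigma>: "\<sigma> \<in> pts 2"
    and nd: "\<And>t. t < 2 \<Longrightarrow> ind X (principal_edge 2 t) 0 \<sigma> \<in> nondegenerate_edges X"
  shows "ind X (long_edge 2) 0 \<sigma> \<in> nondegenerate_edges X"
proof (rule ccontr)
  let ?a = "ind X (long_edge 2) 0 \<sigma>"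
  assume "?a \<notin> nondegenerate_edges X"
  moreover have a: "?a \<in> pts 1" by (rule ind_pts[OF long_edge_dhom \<sigma>])
  ultimately obtain y0 where y0: "y0 \<in> pts 0" "sim 1 (ind X (codegeneracy 0 0) 0 y0) ?a"
    using degenerate_edge_iff by blast
  obtain N where N: "\<And>r. N \<le> r \<Longrightarrow> empty_sset (hfibre (vec_ob X r) (ob X 1) (ind X (long_edge r)) ?a)"
    using tight a unfolding tight_decomposition_space_def by blast
  \<comment> \<open>\<open>N\<close> copies of the triangle give \<open>2 * N\<close> principal
    edges, within the range excluded by tightness.\<close>
  obtain y where y: "y \<in> pts (2 * N)" "\<And>i. i < 2 * N \<Longrightarrow> ind X (principal_edge (2 * N) i) 0 y \<in> nondegenerate_edges X"
    "sim 1 (ind X (long_edge (2 * N)) 0 y) ?a"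
    using iterated_gluing[OF \<sigma> nd y0, of N] by blast
  have d0: "dconst 0 0 0 = did 0" by (rule dhom_eqI[of _ 0 0]) auto
  have yv: "y \<in> splx (vec_ob X (2 * N)) 0"
    using y(1,2) act_did[OF is_sset_ob y(1)] by (simp add: vec_ob_def full_sub_def d0)
  have pt: "point_map (ob X 1) ?a 0 (did 0) = ?a"
    using act_did[OF is_sset_ob a] by (simp add: point_map_def)
  obtain \<alpha> \<beta> where "(y, \<alpha>, \<beta>, did 0) \<in> splx (hfibre (vec_ob X (2 * N)) (ob X 1) (ind X (long_edge (2 * N))) ?a) 0"
    unfolding hfibre_def
    using hpullback_vertex[of "ob X 1" y "vec_ob X (2 * N)" "did 0" "std 0" "ind X (long_edge (2 * N))"
        "point_map (ob X 1) ?a"] is_sset_ob yv pt y(3)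
    by (auto simp: sim_def)
  moreover have "empty_sset (hfibre (vec_ob X (2 * N)) (ob X 1) (ind X (long_edge (2 * N))) ?a)"
    by (rule N) simp
  ultimately show False by (auto simp: empty_sset_def)
qed

text \<open>Principal edges of a face are principal edges of \<open>x\<close>, except that face
  \<open>i = j + 1\<close> merges the edges \<open>j\<close> and \<open>j + 1\<close> into the long
  edge of a triangle.\<close>

lemma face_nondegenerate:
  assumes tight: "tight_decomposition_space X" and i: "i \<le> Suc n" and x: "x \<in> nondegenerate X (Suc n)"
  shows "face X n i 0 x \<in> nondegenerate X n"
  unfolding nondegenerate_iff
proof (intro conjI allI impI)
  have xp: "x \<in> pts (Suc n)" and xe: "\<And>j. j < Suc n \<Longrightarrow> ind X (principal_edge (Suc n) j) 0 x \<in> nondegenerate_edges X"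
    using x by (auto simp: nondegenerate_iff)
  show "face X n i 0 x \<in> pts n" by (rule ind_pts[OF coface_dhom xp])
  fix j assume j: "j < n"
  have e: "principal_edge n j \<in> dhom 1 n" using j by simp
  have step: "ind X (principal_edge n j) 0 (face X n i 0 x) \<in> nondegenerate_edges X"
    if "ind X (dcomp (coface n i) (principal_edge n j)) 0 x \<in> nondegenerate_edges X"
    using nondegenerate_edges_sim[OF that sim_sym[OF sim_comp[OF e coface_dhom xp]]] .
  consider "i = Suc j" | "i \<le> j" | "Suc j < i" by linarith
  then show "ind X (principal_edge n j) 0 (face X n i 0 x) \<in> nondegenerate_edges X"
  proof cases
    case 1
    \<comment> \<open>The triangle on the vertices \<open>j\<close>, \<open>j + 1\<close>,
      \<open>j + 2\<close>, whose middle vertex is the one omitted by the face.\<close>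
    define m where "m = mk_dmap 2 (Suc n) (\<lambda>t. j + t)"
    have m: "m \<in> dhom 2 (Suc n)" unfolding m_def by (rule mk_dmap_dhom) (use j in auto)
    have apm: "ap m t = j + t" if "t \<le> 2" for t using that by (simp add: m_def)
    have "dcomp (coface n i) (principal_edge n j) = dcomp m (long_edge 2)"
      by (rule dhom_eqI[OF dcomp_dhom[OF coface_dhom e] dcomp_dhom[OF m long_edge_dhom]])
        (use 1 j in \<open>auto simp: ap_dcomp[OF e] ap_dcomp[OF long_edge_dhom] ap_principal_edge
          ap_long_edge ap_coface apm elim!: le_1_cases\<close>)
    moreover have "ind X (long_edge 2) 0 (ind X m 0 x) \<in> nondegenerate_edges X"
    proof (rule long_edge_nondegenerate[OF tight ind_pts[OF m xp]])
      fix t :: nat assume t: "t < 2"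
      have pt: "principal_edge 2 t \<in> dhom 1 2" using t by simp
      have "dcomp m (principal_edge 2 t) = principal_edge (Suc n) (j + t)"
        by (rule dhom_eqI[OF dcomp_dhom[OF m pt]])
          (use t j in \<open>auto simp: ap_dcomp[OF pt] ap_principal_edge apm\<close>)
      then show "ind X (principal_edge 2 t) 0 (ind X m 0 x) \<in> nondegenerate_edges X"
        using nondegenerate_edges_sim[OF _ sim_sym[OF sim_comp[OF pt m xp]]] xe[of "j + t"] t j by simp
    qed
    ultimately show ?thesis
      using nondegenerate_edges_sim[OF _ sim_comp[OF long_edge_dhom m xp]] step by simp
  next
    case 2
    have "dcomp (coface n i) (principal_edge n j) = principal_edge (Suc n) (Suc j)"
      by (rule dhom_eqI[OF dcomp_dhom[OF coface_dhom e]])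
        (use 2 j in \<open>auto simp: ap_dcomp[OF e] ap_principal_edge ap_coface\<close>)
    then show ?thesis using step xe[of "Suc j"] j by simp
  next
    case 3
    have "dcomp (coface n i) (principal_edge n j) = principal_edge (Suc n) j"
      by (rule dhom_eqI[OF dcomp_dhom[OF coface_dhom e]])
        (use 3 j in \<open>auto simp: ap_dcomp[OF e] ap_principal_edge ap_coface\<close>)
    then show ?thesis using step xe[of j] j by simp
  qed
qed

end

theorem corollary3p5p7:
  fixes X :: "'a cdiag"
  assumes "tight_decomposition_space X"
  shows "split_simplicial_space X"
proof -
  have c: "decomposition_space X" "monomorphism (ob X 0) (ob X 1) (degen X 0 0)"
    using assms by (simp_all add: tight_decomposition_space_def complete_decomposition_space_def)
  then have "simplicial_space X" by (simp add: decomposition_space_def)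
  then interpret decomposition_diagram X using c(1) by unfold_locales
  show ?thesis
    using X degeneracy_monomorphism[OF c(2)] face_nondegenerate[OF assms]
    by (simp add: split_simplicial_space_def complete_simplicial_space_def)
qed

end
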